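(* Let $\mathcal{I}$ satisfy (A1)–(A7). If $P,Q,R$ are collinear finite points on a line $d$, then the composition $PQR$ of the half-turns about $P,Q,R$ is an involution, and moreover $PQR=P'$ (the half-turn about $P'$) for some finite point $P'$ on $d$.
   Context: $\mathcal{I}$ is an incidence structure of (finite) points and lines. Betweenness: for collinear $A,B,C$, $B$ is between $A$ and $C$ if every line through $B$ meets at least one line of each pair of intersecting lines through $A$ and $C$ respectively; segments and rays are defined as usual. Rays $r,s$ with endpoints $R,S$ are parallel if non-collinear and every line meeting one of them meets the other or the segment $\overline{RS}$; lines are parallel if they contain parallel rays. A rimpoint is a pair $(a,b)$ of parallel lines such that some line $\ell$ is parallel to both and some line meets $a,b,\ell$; $(a,b)=(c,d)$ if any two of $a,b,c,d$ are equal or parallel; $(a,b)$ is incident with $\ell$ if $\ell\in\{a,b\}$ or $\ell$ is parallel to both and some line meets $a,b,\ell$. "Point" means finite point or rimpoint; $AB$ is the line through distinct points $A,B$. Axioms: (A1) two distinct points lie on a unique line; (A2) each line is on at least one point; (A3) there exist three non-collinear points and three collinear points; (A4) of three collinear points, at least one has the property that every line through it meets at least one of each pair of intersecting lines through the other two; (A5) if $P$ is not on $\ell$, there are two distinct lines on $P$ not meeting $\ell$ such that each line meeting $\ell$ meets at least one of them; (A6) any two non-collinear rays have a common parallel line; (A7) if $A,\dots,F$ are rimpoints such that $AB\cap DE$, $BC\cap EF$, $CD\cap FA$ exist as finite points, they are collinear. Every line carries exactly two rimpoints. Let $\mathcal{O}$ be the set of rimpoints. For a finite point $P$, the half-turn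 about $P$ is the permutation of $\mathcal{O}$ sending $X$ to $X^P$, the other rimpoint on $XP$; it is denoted by the same letter $P$, and products are composed left to right: $X^{PQ}=(X^P)^Q$.
   Formalization: Equality of rimpoints (a,b)=(c,d) also requires each pair to be incident with the lines of the other, as the literal clause merges distinct rimpoints of an ideal triangle's side; in (A6), for non-parallel rays, the line of one ray may serve as common parallel if it is parallel to the other. *)

theory Defs
  imports Main "HOL-Combinatorics.Permutations"
begin

(* Finite points are the elements of 'p, lines are the elements of 'l. *)
locale incidence_structure =
  fixes inc :: "'p \<Rightarrow> 'l \<Rightarrow> bool"
begin

definition points_of :: "'l \<Rightarrow> 'p set" where
  "points_of l = {P. inc P l}"

definition collinear :: "'p set \<Rightarrow> bool" where
  "collinear S \<longleftrightarrow> (\<exists>l. S \<subseteq> points_of l)"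

(* A line does not meet itself: otherwise the clause "each line meeting l meets p or q" of axiom
   A5 below would apply to l and contradict the choice of p and q. *)
definition meets :: "'l \<Rightarrow> 'l \<Rightarrow> bool" where
  "meets l m \<longleftrightarrow> l \<noteq> m \<and> (\<exists>P. inc P l \<and> inc P m)"

definition hits :: "'l \<Rightarrow> 'p set \<Rightarrow> bool" where
  "hits l S \<longleftrightarrow> (\<exists>P\<in>S. inc P l)"

(* between A B C: B lies between A and C.  B = A and B = C are allowed (and satisfy the condition),
   so that segments and rays contain their endpoints. *)
definition between :: "'p \<Rightarrow> 'p \<Rightarrow> 'p \<Rightarrow> bool" where
  "between A B C \<longleftrightarrow> collinear {A, B, C} \<and>
     (\<forall>k m n. inc B k \<and> inc A m \<and> inc C n \<and> meets m n \<longrightarrow> meets k m \<or> meets k n)"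

definition segment :: "'p \<Rightarrow> 'p \<Rightarrow> 'p set" where
  "segment A B = {X. between A X B}"

definition ray :: "'p \<Rightarrow> 'p \<Rightarrow> 'p set" where
  "ray A B = {X. between A X B \<or> between A B X}"

definition ray_from :: "'p \<Rightarrow> 'p set \<Rightarrow> bool" where
  "ray_from A r \<longleftrightarrow> (\<exists>B. B \<noteq> A \<and> r = ray A B)"

definition is_ray :: "'p set \<Rightarrow> bool" where
  "is_ray r \<longleftrightarrow> (\<exists>A. ray_from A r)"

definition parallel_rays :: "'p set \<Rightarrow> 'p set \<Rightarrow> bool" where
  "parallel_rays r s \<longleftrightarrow> \<not> collinear (r \<union> s) \<and>
     (\<exists>R S. ray_from R r \<and> ray_from S s \<and>
        (\<forall>k. (hits k r \<longrightarrow> hits k s \<or> hits k (segment R S)) \<and>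
             (hits k s \<longrightarrow> hits k r \<or> hits k (segment R S))))"

definition parallel :: "'l \<Rightarrow> 'l \<Rightarrow> bool" where
  "parallel a b \<longleftrightarrow> (\<exists>r s. r \<subseteq> points_of a \<and> s \<subseteq> points_of b \<and> parallel_rays r s)"

definition parallel_to_ray :: "'l \<Rightarrow> 'p set \<Rightarrow> bool" where
  "parallel_to_ray l r \<longleftrightarrow> (\<exists>s. s \<subseteq> points_of l \<and> parallel_rays s r)"

definition common_transversal :: "'l \<Rightarrow> 'l \<Rightarrow> 'l \<Rightarrow> bool" where
  "common_transversal a b c \<longleftrightarrow> (\<exists>t. meets t a \<and> meets t b \<and> meets t c)"

definition rim_pairs :: "('l \<times> 'l) set" where
  "rim_pairs = {(a, b). parallel a b \<and>
     (\<exists>l. parallel l a \<and> parallel l b \<and> common_transversal a b l)}"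

definition pair_on :: "'l \<times> 'l \<Rightarrow> 'l \<Rightarrow> bool" where
  "pair_on = (\<lambda>(a, b) l. l = a \<or> l = b \<or>
     (parallel l a \<and> parallel l b \<and> common_transversal a b l))"

(* The pairwise condition says that any two of a, b, c, d are equal or parallel.  Alone it would
   identify distinct rimpoints: if a, b, c are the three sides of an ideal triangle, any two of
   them are parallel although (a, b) and (a, c) are different ends of a.  Three parallel lines with
   a common transversal, on the other hand, do share an end, so each pair is also required to be
   incident with the lines of the other. *)
definition same_rimpoint :: "(('l \<times> 'l) \<times> ('l \<times> 'l)) set" where
  "same_rimpoint = {((a, b), (c, d)). (a, b) \<in> rim_pairs \<and> (c, d) \<in> rim_pairs \<and>
     pairwise parallel {a, b, c, d} \<and>
     pair_on (a, b) c \<and> pair_on (a, b) d \<and> pair_on (c, d) a \<and> pair_on (c, d) b}"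

definition rimpoints :: "('l \<times> 'l) set set" where
  "rimpoints = rim_pairs // same_rimpoint"

definition rim_on :: "('l \<times> 'l) set \<Rightarrow> 'l \<Rightarrow> bool" where
  "rim_on X l \<longleftrightarrow> (\<exists>x\<in>X. pair_on x l)"

(* The half-turn about P, extended by the identity outside the set of rimpoints.
   Products of half-turns are read from left to right: PQR is
   half_turn R \<circ> half_turn Q \<circ> half_turn P. *)
definition half_turn :: "'p \<Rightarrow> ('l \<times> 'l) set \<Rightarrow> ('l \<times> 'l) set" where
  "half_turn P X = (if X \<in> rimpoints
     then (THE Y. Y \<in> rimpoints \<and> Y \<noteq> X \<and> (\<exists>l. inc P l \<and> rim_on X l \<and> rim_on Y l))
     else X)"

end

(* In A6 let r, s be non-parallel rays such that the line a containing r is parallel to s, i.e.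
   r and s have distinct ends and a joins them.  Then a is the line asked for, but it is not
   parallel to r in the sense above because it contains r, and in the hyperbolic plane there is no
   other line through both ends.  In this case (and only then) the line containing r counts as
   a common parallel. *)
locale hyperbolic_incidence_plane = incidence_structure inc
  for inc :: "'p \<Rightarrow> 'l \<Rightarrow> bool" +
  assumes A1: "P \<noteq> Q \<Longrightarrow> \<exists>!l. inc P l \<and> inc Q l"
    and A2: "\<exists>P. inc P l"
    and A3_noncollinear: "\<exists>A B C. A \<noteq> B \<and> B \<noteq> C \<and> A \<noteq> C \<and> \<not> collinear {A, B, C}"
    and A3_collinear: "\<exists>A B C. A \<noteq> B \<and> B \<noteq> C \<and> A \<noteq> C \<and> collinear {A, B, C}"
    and A4: "\<lbrakk>A \<noteq> B; B \<noteq> C; A \<noteq> C; collinear {A, B, C}\<rbrakk>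
      \<Longrightarrow> between B A C \<or> between A B C \<or> between A C B"
    and A5: "\<not> inc P l \<Longrightarrow> \<exists>p q. p \<noteq> q \<and> inc P p \<and> inc P q \<and> \<not> meets p l \<and> \<not> meets q l \<and>
      (\<forall>k. meets k l \<longrightarrow> meets k p \<or> meets k q)"
    and A6: "\<lbrakk>is_ray r; is_ray s; \<not> collinear (r \<union> s)\<rbrakk> \<Longrightarrow>
      \<exists>l. (parallel_to_ray l r \<and> parallel_to_ray l s) \<or>
          (\<not> parallel_rays r s \<and>
             ((r \<subseteq> points_of l \<and> parallel_to_ray l s) \<or> (s \<subseteq> points_of l \<and> parallel_to_ray l r)))"
    and A7: "\<lbrakk>{X1, X2, X3, X4, X5, X6} \<subseteq> rimpoints;
        X1 \<noteq> X2; X2 \<noteq> X3; X3 \<noteq> X4; X4 \<noteq> X5; X5 \<noteq> X6; X6 \<noteq> X1;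
        rim_on X1 l12; rim_on X2 l12; rim_on X2 l23; rim_on X3 l23;
        rim_on X3 l34; rim_on X4 l34; rim_on X4 l45; rim_on X5 l45;
        rim_on X5 l56; rim_on X6 l56; rim_on X6 l61; rim_on X1 l61;
        l12 \<noteq> l45; inc U l12; inc U l45;
        l23 \<noteq> l56; inc V l23; inc V l56;
        l34 \<noteq> l61; inc W l34; inc W l61\<rbrakk>
      \<Longrightarrow> collinear {U, V, W}"

definition involution_on :: "'a set \<Rightarrow> ('a \<Rightarrow> 'a) \<Rightarrow> bool" where
  "involution_on S f \<longleftrightarrow> f permutes S \<and> f \<noteq> id \<and> f \<circ> f = id"

end

theory Submission
  imports Defs
begin

text \<open>
  For distinct \<open>P\<close>, \<open>Q\<close>, \<open>R\<close> on \<open>d\<close> and a rimpoint \<open>X\<close> off \<open>d\<close>, the successive images of \<open>X\<close> under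
  \<open>P\<close>, \<open>Q\<close>, \<open>R\<close>, \<open>P\<close>, \<open>Q\<close> form an inscribed hexagon. Two pairs of opposite sides meet in \<open>P\<close> and \<open>Q\<close>,
  so by A7 the third pair meets on \<open>d\<close>, namely in \<open>R\<close>; this says that \<open>PQR\<close> is an involution. That
  the third pair meets at all is a matter of order: \<open>PQ\<close> shifts the rimpoints on both sides of \<open>d\<close> in
  the same direction. Since \<open>PQR = RQP\<close>, products of an even number of half-turns about points of \<open>d\<close>
  commute with each other, and they act transitively on the rimpoints on one side of \<open>d\<close>. Hence
  \<open>PQR\<close> agrees with the half-turn about the point \<open>P'\<close> where the line joining \<open>X\<close> to its image meets
  \<open>d\<close>.

  Order is obtained from A4 and A5 by comparing, for a point and two lines, which lines through the
  point avoid the one and the other line. An end of a line is the family of sides, one for each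
  line, that eventually contain a ray; axiom A5 supplies the lines through a given end, and A6 joins
  two ends.
\<close>

text \<open>Neither transitivity nor existence can be read off the definition of parallel rays,
  which involves point sets, a segment and free starting points. Recording which side of each line a
  ray finally enters turns parallelism into an equality of functions, except that lines missing both
  carriers are not compared; this leaves one hard case of transitivity. Two facts stand in for
  metric and continuity arguments: of three lines through a point, one separates the points chosen
  on the other two; and of three ends off a line, two lie on the same side. The latter tells the
  sides of an ideal triangle from three lines with a common end. The reversal
  \<open>PQR = RQP\<close> exchanges factors two places apart, which is why even products commute.
  They are transitive on a side because a half-turn takes one end across \<open>d\<close>, and the
  line given by A6 from there to the other end meets \<open>d\<close> in the second centre.\<close>

context hyperbolic_incidence_plane
begin

subsection \<open>Betweenness and sides of a line\<close>

definition apart :: "'l \<Rightarrow> 'l \<Rightarrow> bool" where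
  "apart l m \<longleftrightarrow> l \<noteq> m \<and> (\<forall>P. \<not> (inc P l \<and> inc P m))"

definition bt :: "'p \<Rightarrow> 'p \<Rightarrow> 'p \<Rightarrow> bool" where
  "bt A B C \<longleftrightarrow> A \<noteq> B \<and> B \<noteq> C \<and> A \<noteq> C \<and> between A B C"

definition opp_side :: "'l \<Rightarrow> 'p \<Rightarrow> 'p \<Rightarrow> bool" where
  "opp_side k P Q \<longleftrightarrow> \<not> inc P k \<and> \<not> inc Q k \<and> (\<exists>B. inc B k \<and> bt P B Q)"

definition same_side :: "'l \<Rightarrow> 'p \<Rightarrow> 'p \<Rightarrow> bool" where
  "same_side k P Q \<longleftrightarrow> \<not> inc P k \<and> \<not> inc Q k \<and> \<not> opp_side k P Q"

lemma apart_sym: "apart l m \<Longrightarrow> apart m l"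
  by (auto simp: apart_def)

lemma apart_irrefl [simp]: "\<not> apart l l"
  by (auto simp: apart_def)

lemma apart_iff: "apart l m \<longleftrightarrow> l \<noteq> m \<and> \<not> meets l m"
  by (auto simp: apart_def meets_def)

lemma apart_point: "apart l m \<Longrightarrow> inc P l \<Longrightarrow> \<not> inc P m"
  by (auto simp: apart_def)

lemma not_apartD: "\<not> apart l m \<Longrightarrow> l \<noteq> m \<Longrightarrow> \<exists>P. inc P l \<and> inc P m"
  by (auto simp: apart_def)

lemma line_unique: "\<lbrakk>A \<noteq> B; inc A l; inc B l; inc A m; inc B m\<rbrakk> \<Longrightarrow> l = m"
  using A1[of A B] by blast

lemma other_point: "\<exists>Q. Q \<noteq> (P::'p)"
  using A3_noncollinear by metis

lemma line_ex: "\<exists>l. inc A l \<and> inc B l"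
proof (cases "A = B")
  case True
  obtain Q where "Q \<noteq> A" using other_point by blast
  then show ?thesis using A1[of A Q] True by blast
qed (use A1 in blast)

lemma point_off: "\<exists>P. \<not> inc P l"
proof (rule ccontr)
  assume "\<not> ?thesis"
  then have "collinear S" for S by (auto simp: collinear_def points_of_def)
  then show False using A3_noncollinear by blast
qed

lemma apart_pair:
  assumes "\<not> inc P l"
  obtains p q where "p \<noteq> q" "inc P p" "inc P q" "apart p l" "apart q l"
    "\<And>k. apart k p \<Longrightarrow> apart k q \<Longrightarrow> k = l \<or> apart k l"
proof -
  obtain p q where *: "p \<noteq> q" "inc P p" "inc P q" "\<not> meets p l" "\<not> meets q l"
    "\<forall>k. meets k l \<longrightarrow> meets k p \<or> meets k q"
    using A5[OF assms] by blast
  have "p \<noteq> l" "q \<noteq> l" using * assms by auto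
  with * show ?thesis by (intro that[of p q]) (auto simp: apart_iff)
qed

lemma apart_ex: "\<not> inc P l \<Longrightarrow> \<exists>p. inc P p \<and> apart p l \<and> p \<noteq> g"
  by (metis apart_pair)

lemma bt_distinct: "bt A B C \<Longrightarrow> A \<noteq> B \<and> B \<noteq> C \<and> A \<noteq> C"
  by (auto simp: bt_def)

lemma bt_collinear: "bt A B C \<Longrightarrow> \<exists>l. inc A l \<and> inc B l \<and> inc C l"
  by (auto simp: bt_def between_def collinear_def points_of_def)

lemma bt_on_line:
  assumes "bt A B C"
  shows "inc A l \<Longrightarrow> inc B l \<Longrightarrow> inc C l" "inc A l \<Longrightarrow> inc C l \<Longrightarrow> inc B l"
    "inc B l \<Longrightarrow> inc C l \<Longrightarrow> inc A l"
  using bt_collinear[OF assms] bt_distinct[OF assms] line_unique by metis+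

lemma between_sym: "between A B C \<Longrightarrow> between C B A"
proof -
  assume "between A B C"
  moreover have "{C, B, A} = {A, B, C}" by auto
  ultimately show ?thesis unfolding between_def meets_def by (smt (verit))
qed

lemma bt_sym: "bt A B C \<Longrightarrow> bt C B A"
  using between_sym by (auto simp: bt_def)

text \<open>Contrapositive of betweenness: if \<open>a\<close> and \<open>c\<close> met,
  \<open>b\<close> would have to meet one of them; and \<open>a = c\<close> would contain
  \<open>B\<close>.\<close>

lemma bt_apart:
  assumes "bt A B C" "inc A a" "inc B b" "inc C c" "apart a b" "apart b c"
  shows "apart a c"
proof (rule ccontr)
  assume "\<not> apart a c"
  moreover have "a \<noteq> c" using assms bt_on_line apart_point by metis
  ultimately have "meets a c" by (simp add: apart_iff)
  then have "meets b a \<or> meets b c"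
    using assms by (auto simp: bt_def between_def)
  with assms show False by (auto simp: apart_def meets_def)
qed

lemma bt_cases:
  assumes "A \<noteq> B" "B \<noteq> C" "A \<noteq> C" "inc A l" "inc B l" "inc C l"
  shows "bt A B C \<or> bt B A C \<or> bt A C B"
proof -
  have "collinear {A, B, C}" using assms by (auto simp: collinear_def points_of_def)
  then show ?thesis using A4[OF assms(1-3)] assms(1-3) between_sym unfolding bt_def by blast
qed

text \<open>This is how A5 is used most often: if the lines through \<open>P\<close> avoiding \<open>l\<close> all avoid
  \<open>m\<close>, then \<open>m\<close> misses both lines of the pair given by A5, hence misses \<open>l\<close>.\<close>

lemma apart_imp:
  assumes "\<not> inc P l" "\<And>x. inc P x \<Longrightarrow> apart x l \<Longrightarrow> apart x m"
  shows "l = m \<or> apart l m"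
  using apart_pair[OF assms(1)] assms(2) apart_sym by metis

text \<open>By \<open>bt_apart\<close> the lines through \<open>A\<close> that avoid
  \<open>b\<close> also avoid \<open>c\<close>; the inclusion is strict. Otherwise the lines through
  \<open>A\<close> avoiding \<open>c\<close> would also avoid a second line \<open>c'\<close>
  through \<open>C\<close> that misses \<open>b\<close>, and A5 would make \<open>c\<close> and
  \<open>c'\<close> disjoint.\<close>

lemma bt_strict:
  assumes "bt A B C" "inc B b" "inc C c" "apart b c"
  shows "\<exists>x. inc A x \<and> apart x c \<and> \<not> apart x b"
proof (rule ccontr)
  assume neg: "\<not> ?thesis"
  obtain c' where c': "inc C c'" "apart c' b" "c' \<noteq> c"
    using apart_ex[of C b c] assms apart_point apart_sym by metis
  have "\<not> inc A c"
    using assms bt_on_line apart_point by metis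
  moreover have "apart x c'" if "inc A x" "apart x c" for x
    using bt_apart[OF assms(1) that(1) assms(2) c'(1)] neg that c'(2) apart_sym by blast
  ultimately have "c = c' \<or> apart c c'" using apart_imp by blast
  then show False using c' assms apart_point by metis
qed

text \<open>Take disjoint lines \<open>b\<close> through \<open>B\<close> and \<open>c\<close>
  through \<open>C\<close>. In the one order the lines through \<open>A\<close> avoiding
  \<open>b\<close> form a proper subset of those avoiding \<open>c\<close>; in the other order the
  opposite inclusion holds.\<close>

lemma bt_unique: "bt A B C \<Longrightarrow> \<not> bt A C B"
proof
  assume *: "bt A B C" "bt A C B"
  obtain O' where O': "\<exists>l. inc A l \<and> inc B l \<and> inc C l \<and> \<not> inc O' l"
    using bt_collinear[OF *(1)] point_off by metis
  then obtain l c where c: "inc A l" "inc B l" "inc C l" "\<not> inc O' l" "inc C c" "inc O' c"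
    using line_ex by metis
  have "\<not> inc B c" using c line_unique bt_distinct[OF *(1)] by metis
  then obtain b where b: "inc B b" "apart b c" using apart_ex by metis
  obtain x where "inc A x" "apart x c" "\<not> apart x b"
    using bt_strict[OF *(1) b(1) c(5) b(2)] by blast
  then show False using bt_apart[OF *(2) _ c(5) b(1)] b apart_sym by blast
qed

text \<open>Crossing of the cevians from \<open>B\<close> and \<open>E\<close> in the triangle
  \<open>A\<close>, \<open>B\<close>, \<open>E\<close>. If they were disjoint, the sets of lines
  through \<open>A\<close> avoiding \<open>k\<close> and \<open>g\<close> would be properly included
  one way along \<open>A\<close>, \<open>D\<close>, \<open>B\<close> and included the other way
  along \<open>A\<close>, \<open>C\<close>, \<open>E\<close>.\<close>

lemma bt_cross:
  assumes "bt A D B" "bt A C E" "inc D k" "inc E k" "inc B g" "inc C g"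
  shows "\<not> apart k g"
proof
  assume "apart k g"
  then obtain x where "inc A x" "apart x g" "\<not> apart x k"
    using bt_strict[OF assms(1,3,5)] by blast
  then show False using bt_apart[OF assms(2) _ assms(6,4)] \<open>apart k g\<close> apart_sym by blast
qed

section \<open>Plane separation by a line\<close>

lemma opp_off: "opp_side k P Q \<Longrightarrow> \<not> inc P k \<and> \<not> inc Q k"
  by (simp add: opp_side_def)

lemma opp_sym: "opp_side k P Q \<Longrightarrow> opp_side k Q P"
  using bt_sym by (auto simp: opp_side_def)

lemma opp_apart:
  assumes "opp_side k P Q" "inc P m" "inc Q n" "apart m k" "apart n k"
  shows "apart m n"
proof -
  obtain B where "inc B k" "bt P B Q" using assms by (auto simp: opp_side_def)
  then show ?thesis using bt_apart assms apart_sym by metis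
qed

text \<open>Together with \<open>opp_apart\<close> this expresses opposite sides by avoidance alone,
  which is the form that the proof of Pasch's axiom needs. Where the line \<open>PQ\<close> meets
  \<open>k\<close> outside the segment, \<open>bt_strict\<close> supplies the two lines.\<close>

lemma not_opp_apart:
  assumes "\<not> opp_side k P Q" "\<not> inc P k" "\<not> inc Q k"
  shows "\<exists>m n. inc P m \<and> inc Q n \<and> apart m k \<and> apart n k \<and> \<not> apart m n"
proof (cases "P = Q")
  case True
  then show ?thesis using apart_ex[OF assms(2)] by (metis apart_irrefl)
next
  case False
  obtain t where t: "inc P t" "inc Q t" using line_ex by blast
  show ?thesis
  proof (cases "apart t k")
    case True
    then show ?thesis using t apart_irrefl by blast
  next
    case False
    then obtain B where B: "inc B t" "inc B k" using not_apartD assms t by metis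
    then have "bt P Q B \<or> bt Q P B"
      using bt_cases[of P Q B t] \<open>P \<noteq> Q\<close> t assms unfolding opp_side_def by (metis bt_sym)
    then show ?thesis
    proof
      assume h: "bt P Q B"
      obtain n where n: "inc Q n" "apart n k" using apart_ex[OF assms(3)] by blast
      then show ?thesis using bt_strict[OF h n(1) B(2) n(2)] by blast
    next
      assume h: "bt Q P B"
      obtain m where m: "inc P m" "apart m k" using apart_ex[OF assms(2)] by blast
      then show ?thesis using bt_strict[OF h m(1) B(2) m(2)] apart_sym by blast
    qed
  qed
qed

text \<open>A weak form of Pasch's axiom: of the unwanted orders of \<open>R\<close>,
  \<open>Q\<close> and the point of \<open>RQ\<close> on \<open>k\<close>, only the one with
  \<open>R\<close> in the middle is refuted at once, by the crossing of cevians.\<close>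

lemma opp_shift_cases:
  assumes o: "opp_side k P Q" and l: "inc P l" "inc R l" "apart l k"
  shows "opp_side k R Q \<or> (\<exists>B. inc B k \<and> bt R Q B)"
proof -
  have off: "\<not> inc P k" "\<not> inc Q k" "\<not> inc R k" using opp_off[OF o] l apart_point by auto
  obtain t where t: "inc R t" "inc Q t" using line_ex by blast
  have "\<not> apart t k" using opp_apart[OF o l(1) t(2) l(3)] l(2) t(1) apart_point by blast
  then obtain B where B: "inc B t" "inc B k" using not_apartD off t by metis
  have "R \<noteq> Q" using opp_apart[OF o l(1) _ l(3) l(3)] l by auto
  then consider "bt R B Q" | "bt R Q B" | "bt Q R B"
    using bt_cases[of R Q B t] B off t bt_sym by metis
  then show ?thesis
  proof cases
    case 3
    obtain D where "inc D k" "bt Q D P" using o bt_sym by (auto simp: opp_side_def)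
    then have "\<not> apart k l" using bt_cross[OF _ 3] B l by blast
    then show ?thesis using l apart_sym by blast
  qed (use B off in \<open>auto simp: opp_side_def\<close>)
qed

text \<open>This is Pasch's axiom. Were \<open>C\<close> between \<open>X\<close> and a point of \<open>k\<close>, then both lines \<open>a1\<close>, \<open>a2\<close> of
  an A5 pair of \<open>A\<close> and \<open>k\<close> would contain such a point. Comparing, at a point \<open>B1\<close> of \<open>k\<close>, the
  lines avoiding \<open>a1\<close>, \<open>a2\<close> and a line through \<open>C\<close> leads to the conclusion that the lines through
  \<open>B1\<close> avoiding \<open>a2\<close> also avoid \<open>a1\<close>, which A5 forbids because \<open>a1\<close> and \<open>a2\<close> meet in \<open>A\<close>.\<close>

lemma opp_shift:
  assumes o: "opp_side k A C" and a: "inc A a" "inc X a" "apart a k"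
  shows "opp_side k X C"
proof (rule ccontr)
  assume neg: "\<not> opp_side k X C"
  have off: "\<not> inc A k" "\<not> inc C k" "\<not> inc X k" using opp_off[OF o] a apart_point by auto
  obtain x c0 where x: "inc X x" "inc C c0" "apart x k" "apart c0 k" "\<not> apart x c0"
    using not_opp_apart[OF neg off(3,2)] by blast
  have "apart a c0" using opp_apart[OF o a(1) x(2) a(3) x(4)] .
  then have "x \<noteq> c0" using a(2) x(1) apart_point by blast
  then obtain Y where Y: "inc Y x" "inc Y c0" using x(5) not_apartD by blast
  \<comment> \<open>\<open>Y\<close> lies on lines through \<open>X\<close> and through
    \<open>C\<close> that avoid \<open>k\<close>. It is not opposite \<open>A\<close>, so
    \<open>A\<close> lies between \<open>Y\<close> and a point of \<open>k\<close>; every line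
    through \<open>A\<close> avoiding \<open>k\<close> is then met by a line through
    \<open>Y\<close> avoiding \<open>k\<close>.\<close>
  have "\<not> opp_side k Y A"
    using opp_apart[of k Y A x a] Y(1) a x(1,3) apart_point by blast
  then obtain B'' where B'': "inc B'' k" "bt Y A B''"
    using opp_shift_cases[OF opp_sym[OF o] x(2) Y(2) x(4)] by blast
  obtain a1 a2 where a12: "a1 \<noteq> a2" "inc A a1" "inc A a2" "apart a1 k" "apart a2 k"
    "\<And>g. apart g a1 \<Longrightarrow> apart g a2 \<Longrightarrow> g = k \<or> apart g k"
    using apart_pair[OF off(1)] by blast
  have far: "\<exists>Z B. inc Z a' \<and> inc B k \<and> bt Z C B" if a': "inc A a'" "apart a' k" for a'
  proof -
    obtain y where y: "inc Y y" "apart y k" "\<not> apart y a'"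
      using bt_strict[OF B''(2) a'(1) B''(1) a'(2)] by blast
    have "apart a' c0" using opp_apart[OF o a'(1) x(2) a'(2) x(4)] .
    then have "y \<noteq> a'" using y Y apart_point by blast
    then obtain Z where Z: "inc Z y" "inc Z a'" using y not_apartD by blast
    have "\<not> opp_side k Z C"
      using opp_apart[of k Z C y c0] Z x y Y apart_point by blast
    then show ?thesis using opp_shift_cases[OF o a'(1) Z(2) a'(2)] Z by blast
  qed
  obtain X1 B1 where 1: "inc X1 a1" "inc B1 k" "bt X1 C B1" using far a12 by blast
  obtain X2 B2 where 2: "inc X2 a2" "inc B2 k" "bt X2 C B2" using far a12 by blast
  obtain c where c: "inc C c" "apart c k" using apart_ex[OF off(2)] by blast
  have ac: "apart a1 c" "apart a2 c" using opp_apart[OF o] a12 c by blast+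
  have "\<not> inc B1 c" using c 1 apart_point by blast
  then obtain g where g: "inc B1 g" "apart g c" "g \<noteq> k" using apart_ex[of B1 c k] by blast
  have "apart g a1" using bt_apart[OF bt_sym[OF 1(3)] g(1) c(1) 1(1) g(2)] ac apart_sym by blast
  then have g2: "\<not> apart g a2" using a12(6) g 1(2) apart_point by blast
  obtain w where w: "inc X2 w" "inc B1 w" using line_ex by blast
  have X2k: "\<not> inc X2 k" using 2 a12 apart_point by blast
  have "\<not> apart w c"
    using bt_apart[OF 2(3) w(1) c(1) 2(2)] c w 1(2) apart_point by blast
  then obtain D where D: "inc D w" "inc D c"
    using not_apartD w \<open>\<not> inc B1 c\<close> by metis
  have "D \<noteq> X2" "D \<noteq> B1" "X2 \<noteq> B1"
    using D 2(1) ac apart_point \<open>\<not> inc B1 c\<close> X2k 1(2) by blast+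
  then consider "bt X2 D B1" | "bt X2 B1 D" | "bt D X2 B1"
    using bt_cases[of X2 D B1 w] w D by blast
  then show False
  proof cases
    case 1
    then show False using bt_apart[OF bt_sym[OF 1] g(1) D(2) 2(1) g(2)] ac g2 apart_sym by blast
  next
    case b: 2
    then show False using bt_cross[OF b 2(3) 1(2) 2(2) D(2) c(1)] c apart_sym by blast
  next
    case b: 3
    have "\<not> inc B1 a2" using 1(2) a12 apart_point by blast
    moreover have "apart y a1" if y: "inc B1 y" "apart y a2" for y
    proof -
      have "apart y c" using bt_apart[OF bt_sym[OF b] y(1) 2(1) D(2) y(2)] ac by blast
      then show ?thesis using bt_apart[OF bt_sym[OF 1(3)] y(1) c(1) 1(1)] ac apart_sym by blast
    qed
    ultimately have "a2 = a1 \<or> apart a2 a1" using apart_imp by blast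
    then show False using a12 apart_point by metis
  qed
qed

lemma same_off: "same_side k P Q \<Longrightarrow> \<not> inc P k \<and> \<not> inc Q k"
  by (simp add: same_side_def)

lemma same_sym: "same_side k P Q \<Longrightarrow> same_side k Q P"
  using opp_sym by (auto simp: same_side_def)

lemma same_refl: "\<not> inc P k \<Longrightarrow> same_side k P P"
  by (auto simp: same_side_def opp_side_def bt_def)

text \<open>Lying on the same side yields lines through \<open>P\<close> and \<open>Q\<close> that
  avoid \<open>k\<close> and share a point; \<open>opp_shift\<close> is applied along the first and
  then along the second.\<close>

lemma opp_same_trans:
  assumes "opp_side k P R" "same_side k P Q" shows "opp_side k Q R"
proof -
  obtain m n where mn: "inc P m" "inc Q n" "apart m k" "apart n k" "\<not> apart m n"
    using not_opp_apart assms(2) unfolding same_side_def by metis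
  obtain Z where "inc Z m" "inc Z n" using mn not_apartD by (metis A2)
  then show ?thesis using opp_shift assms(1) mn by metis
qed

lemma same_trans: "same_side k P Q \<Longrightarrow> same_side k Q R \<Longrightarrow> same_side k P R"
  using opp_same_trans[of k P R Q] by (auto simp: same_side_def)

lemma bt_opp: "bt A B C \<Longrightarrow> inc B k \<Longrightarrow> \<not> inc A k \<Longrightarrow> opp_side k A C"
  using bt_on_line unfolding opp_side_def by metis

lemma bt_same: "bt A B C \<Longrightarrow> inc A k \<Longrightarrow> \<not> inc B k \<Longrightarrow> same_side k B C"
proof -
  assume *: "bt A B C" "inc A k" "\<not> inc B k"
  have "\<not> opp_side k B C"
  proof
    assume "opp_side k B C"
    then obtain D where D: "inc D k" "bt B D C" by (auto simp: opp_side_def)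
    obtain l where l: "inc A l" "inc B l" "inc C l" using bt_collinear * by blast
    have "inc D l" using D l bt_on_line by metis
    then have "D = A" using l D * line_unique by metis
    then show False using D *(1) bt_unique bt_sym by metis
  qed
  then show ?thesis using * bt_on_line(1,2) by (metis same_side_def)
qed

lemma off_cases: "\<not> inc P k \<Longrightarrow> \<not> inc Q k \<Longrightarrow> opp_side k P Q \<or> same_side k P Q"
  by (auto simp: same_side_def)

text \<open>Suppose all three pairs are separated. In a triangle, the middle one of the three
  crossing points on \<open>k\<close> lies on a side line \<open>g\<close>, while the other two lie
  on the side of \<open>g\<close> containing the third vertex, so \<open>g\<close> cannot separate
  them. For collinear points the crossing points coincide, and a line through the middle point
  avoiding \<open>k\<close> gives the contradiction.\<close>

lemma opp_opp_same:
  assumes "opp_side k A B" "opp_side k B C" shows "same_side k A C"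
proof (rule ccontr)
  assume "\<not> same_side k A C"
  then have AC: "opp_side k A C" using off_cases opp_off assms by metis
  have tri: False if o: "opp_side k A B" "opp_side k B C" "opp_side k A C"
    and D: "inc D1 k" "bt A D1 B" "inc D2 k" "bt B D2 C" "inc D3 k" "bt A D3 C"
    and b: "bt D1 D2 D3" for A B C D1 D2 D3
  proof -
    obtain g where g: "inc B g" "inc C g" "inc D2 g" using bt_collinear D by metis
    have off: "\<not> inc A k" "\<not> inc B k" "\<not> inc C k" using o opp_off by auto
    have D1g: "\<not> inc D1 g" using b g D off line_unique bt_distinct by metis
    have D3g: "\<not> inc D3 g" using b g D off line_unique bt_distinct by metis
    have "same_side g D1 A" using bt_same[OF bt_sym[OF D(2)] g(1) D1g] .
    moreover have "same_side g D3 A" using bt_same[OF bt_sym[OF D(6)] g(2) D3g] .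
    moreover have "opp_side g D1 D3" using bt_opp[OF b g(3) D1g] .
    ultimately show False using same_trans same_sym unfolding same_side_def by metis
  qed
  have lin: False if o: "opp_side k A B" "opp_side k B C"
    and D: "inc D k" "bt A D B" "bt B D C" and b: "bt A B C" for A B C D
  proof -
    obtain g where g: "inc B g" "apart g k" using apart_ex opp_off o by metis
    have Dg: "\<not> inc D g" using g D apart_point by blast
    have "same_side g D A" using bt_same[OF bt_sym[OF D(2)] g(1) Dg] .
    moreover have "same_side g D C" using bt_same[OF D(3) g(1) Dg] .
    moreover have "opp_side g A C" using bt_opp[OF b g(1)] same_off calculation by blast
    ultimately show False using same_trans same_sym unfolding same_side_def by metis
  qed
  obtain D1 D2 D3 where D: "inc D1 k" "bt A D1 B" "inc D2 k" "bt B D2 C" "inc D3 k" "bt A D3 C"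
    using assms AC by (auto simp: opp_side_def)
  have off: "\<not> inc A k" "\<not> inc B k" "\<not> inc C k" using assms opp_off by auto
  show False
  proof (cases "\<exists>l. inc A l \<and> inc B l \<and> inc C l")
    case True
    then obtain l where l: "inc A l" "inc B l" "inc C l" by blast
    then have "inc D1 l" "inc D2 l" "inc D3 l" using D bt_on_line(2) by metis+
    then have eq: "D2 = D1" "D3 = D1" using line_unique[of _ D1 l k] D l off by metis+
    have ne: "A \<noteq> B" "B \<noteq> C" "A \<noteq> C" using D bt_distinct by metis+
    show False
      using bt_cases[OF ne l] lin[of A B C D1] lin[of B A C D1] lin[of A C B D1] D eq assms AC
        bt_sym opp_sym by metis
  next
    case False
    have ne: "E \<noteq> F" if col: "bt P E Q" "bt Q F S" "\<nexists>l. inc P l \<and> inc Q l \<and> inc S l" for P Q S E F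
    proof
      assume "E = F"
      obtain l m where "inc P l" "inc E l" "inc Q l" "inc Q m" "inc F m" "inc S m"
        using bt_collinear col(1,2) by metis
      moreover from this have "l = m"
        using line_unique[of E Q l m] \<open>E = F\<close> bt_distinct[OF col(1)] by blast
      ultimately show False using col(3) by blast
    qed
    have "D1 \<noteq> D2" using ne[OF D(2,4)] False by blast
    moreover have "D2 \<noteq> D3" using ne[OF D(4) bt_sym[OF D(6)]] False by blast
    moreover have "D1 \<noteq> D3" using ne[OF bt_sym[OF D(2)] D(6)] False by blast
    ultimately show False
      using bt_cases[of D1 D2 D3 k] D assms AC tri[of A B C D1 D2 D3] tri[of B A C D1 D3 D2]
        tri[of A C B D3 D2 D1] tri[of C A B D3 D1 D2] tri[of B C A D2 D3 D1] bt_sym opp_sym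
      by (metis (full_types))
  qed
qed

subsection \<open>Order on a line and rays\<close>

lemma apart_same: "\<lbrakk>apart l k; inc A l; inc B l\<rbrakk> \<Longrightarrow> same_side k A B"
  using apart_point bt_on_line(2) unfolding same_side_def opp_side_def by metis

text \<open>Every point is on at least three lines: the A5 pair at \<open>Q\<close> for a line
  missing \<open>Q\<close>, and the line joining \<open>Q\<close> to a point of that line.\<close>

lemma line_ex_avoiding: "\<exists>l. inc Q l \<and> l \<noteq> g \<and> l \<noteq> h"
proof -
  obtain m where m: "\<not> inc Q m"
  proof -
    obtain l where "inc Q l" using line_ex by blast
    obtain R where "\<not> inc R l" using point_off by blast
    then obtain m where "inc R m" "apart m l" using apart_ex by blast
    then show ?thesis using that \<open>inc Q l\<close> apart_point by blast
  qed
  obtain p q where pq: "p \<noteq> q" "inc Q p" "inc Q q" "apart p m" "apart q m"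
    using apart_pair[OF m] by metis
  obtain M where "inc M m" using A2 by blast
  then obtain r where "inc Q r" "inc M r" using line_ex by blast
  moreover have "r \<noteq> p" "r \<noteq> q" using pq \<open>inc M m\<close> \<open>inc M r\<close> apart_point by blast+
  ultimately show ?thesis using pq by metis
qed

text \<open>A2 gives only one point per line. Here \<open>t\<close> meets \<open>k\<close>, so by A5
  it meets one of two lines avoiding \<open>k\<close>, and the common point is not
  \<open>B\<close>.\<close>

lemma second_point:
  assumes "inc B t" shows "\<exists>A. inc A t \<and> A \<noteq> B"
proof -
  obtain k where k: "inc B k" "k \<noteq> t" using line_ex_avoiding by blast
  obtain C where C: "\<not> inc C k" using point_off by blast
  obtain p q where pq: "inc C p" "apart p k" "apart q k"
    "\<And>g. apart g p \<Longrightarrow> apart g q \<Longrightarrow> g = k \<or> apart g k"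
    using apart_pair[OF C] by metis
  have "\<not> apart t k" using k assms apart_point by blast
  then have "\<not> apart t p \<or> \<not> apart t q" using pq(4) k by blast
  then show ?thesis using not_apartD[of t p] not_apartD[of t q] pq k assms apart_point by metis
qed

text \<open>By A5 the transversal \<open>t\<close> meets a line through \<open>C\<close> that avoids
  \<open>k\<close>. Such a line lies wholly on the side of \<open>C\<close>, so \<open>t\<close>
  reaches that side.\<close>

lemma opp_on_transversal:
  assumes o: "opp_side k A C" and t: "inc A t" "inc B t" "inc B k"
  shows "\<exists>C'. inc C' t \<and> bt A B C'"
proof -
  have off: "\<not> inc A k" "\<not> inc C k" using opp_off[OF o] by auto
  obtain p q where pq: "inc C p" "inc C q" "apart p k" "apart q k"
    "\<And>g. apart g p \<Longrightarrow> apart g q \<Longrightarrow> g = k \<or> apart g k"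
    using apart_pair[OF off(2)] by metis
  have "\<not> apart t k" "t \<noteq> k" using t off apart_point by blast+
  then have "\<not> apart t p \<or> \<not> apart t q" using pq(5) by blast
  moreover have ?thesis if p: "\<not> apart t p" "apart p k" "inc C p" for p
  proof -
    have "t \<noteq> p" using p t apart_point by blast
    then obtain C' where C': "inc C' t" "inc C' p" using not_apartD p by blast
    have "opp_side k A C'" using opp_same_trans[OF opp_sym[OF o] apart_same[OF p(2,3) C'(2)]] opp_sym by blast
    then obtain D where D: "inc D k" "bt A D C'" by (auto simp: opp_side_def)
    then have "D = B" using bt_on_line(2)[OF D(2) t(1) C'(1)] t off line_unique by metis
    then show ?thesis using D C' by blast
  qed
  ultimately show ?thesis using pq by blast
qed

text \<open>A3 provides a single ordered triple, hence one line with points on both sides. The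
  property passes to any line sharing a point with it, and two such passages reach every
  line.\<close>

lemma opp_pair_ex: "\<exists>A B. opp_side k A B"
proof -
  have step: "\<exists>A C. opp_side l A C" if b: "opp_side b A0 C0" "inc B b" "inc B l" for b l A0 C0 B
  proof (cases "l = b")
    case True
    then show ?thesis using b by blast
  next
    case False
    obtain t where t: "inc B t" "t \<noteq> b" "t \<noteq> l" using line_ex_avoiding by blast
    obtain A where A: "inc A t" "A \<noteq> B" using second_point t by blast
    have Ab: "\<not> inc A b" using line_unique A t b by metis
    then have "\<exists>C. opp_side b A C"
      using b(1) opp_same_trans[of b A0 C0 A] off_cases[of A0 b A] opp_off by (metis opp_sym)
    then obtain C where "inc C t" "bt A B C" using opp_on_transversal A t b by metis
    moreover have "\<not> inc A l" using line_unique A t b(3) by metis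
    ultimately show ?thesis using bt_opp b(3) by blast
  qed
  obtain A0 B0 C0 where "bt A0 B0 C0"
    using A3_collinear A4 unfolding bt_def by metis
  then obtain t0 where t0: "inc A0 t0" "inc B0 t0" using bt_collinear by blast
  obtain b where b: "inc B0 b" "b \<noteq> t0" using line_ex_avoiding by blast
  have "\<not> inc A0 b" using line_unique b t0 bt_distinct[OF \<open>bt A0 B0 C0\<close>] by metis
  then have 0: "opp_side b A0 C0" using bt_opp[OF \<open>bt A0 B0 C0\<close> b(1)] by blast
  obtain K where K: "inc K k" using A2 by blast
  obtain m where m: "inc B0 m" "inc K m" using line_ex by blast
  obtain A C where "opp_side m A C" using step[OF 0 b(1) m(1)] by blast
  then show ?thesis using step m(2) K by blast
qed

lemma opp_ex: "\<not> inc A k \<Longrightarrow> \<exists>C. opp_side k A C"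
  using opp_pair_ex[of k] opp_same_trans off_cases opp_off opp_sym by metis

lemma bt_extend:
  assumes "A \<noteq> B" shows "\<exists>C. bt A B C"
proof -
  obtain t where t: "inc A t" "inc B t" using line_ex by blast
  obtain k where k: "inc B k" "k \<noteq> t" using line_ex_avoiding by blast
  have "\<not> inc A k" using line_unique t k assms by metis
  then show ?thesis using opp_ex opp_on_transversal t k by metis
qed

text \<open>If \<open>AZ\<close> is extended beyond \<open>Z\<close> to \<open>A'\<close>, the
  segment from \<open>C\<close> to \<open>A'\<close> meets \<open>b\<close> in a point
  \<open>W\<close> on the same side of \<open>a\<close> as \<open>B\<close> but on the other side of
  \<open>c\<close>. Both \<open>a\<close> and \<open>c\<close> cross \<open>b\<close> in
  \<open>Z\<close>, so they must agree on whether \<open>W\<close> and \<open>B\<close> are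
  separated.\<close>

lemma crossbar:
  assumes abc: "inc Z a" "inc Z b" "inc Z c" "inc A a" "inc B b" "inc C c"
    and s: "same_side a B C" "same_side b A C" "same_side c A B"
  shows False
proof -
  have off: "\<not> inc B a" "\<not> inc C a" "\<not> inc A b" "\<not> inc C b" "\<not> inc A c" "\<not> inc B c"
    using s same_off by blast+
  have "A \<noteq> Z" using off abc by blast
  then obtain A' where A': "bt A Z A'" using bt_extend by blast
  have A'a: "inc A' a" using bt_on_line(1)[OF A'] abc by blast
  have ob: "opp_side b A A'" "opp_side c A A'" using bt_opp[OF A'] abc off by blast+
  have "opp_side b C A'" using opp_same_trans ob(1) s(2) by blast
  then obtain W where W: "inc W b" "bt C W A'" by (auto simp: opp_side_def)
  have Wa: "\<not> inc W a" using bt_on_line(3)[OF W(2), of a] A'a off by blast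
  have Wc: "\<not> inc W c" using bt_on_line(1)[OF W(2), of c] abc ob opp_off by blast
  have sa: "same_side a W B" using bt_same[OF bt_sym[OF W(2)] A'a Wa] s(1) same_sym same_trans by blast
  have "same_side c W A'" using bt_same[OF W(2) _ Wc] abc by blast
  then have "opp_side c W B" using ob(2) s(3) opp_same_trans opp_sym same_sym by metis
  then obtain D where D: "inc D c" "bt W D B" by (auto simp: opp_side_def)
  have "inc D b" using bt_on_line(2)[OF D(2) W(1)] abc by blast
  then have "D = Z" using line_unique[of D Z b c] D abc off by metis
  then have "opp_side a W B" using bt_opp[OF D(2), of a] abc Wa by blast
  then show False using sa by (simp add: same_side_def)
qed

section \<open>Order of several points on a line\<close>

lemma bt_chain:
  assumes "bt A B C" "bt A C D"
  shows "bt A B D" "bt B C D"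
proof -
  obtain l where l: "inc A l" "inc B l" "inc C l" using bt_collinear assms by blast
  have Dl: "inc D l" using bt_on_line(1)[OF assms(2)] l by blast
  have ne: "A \<noteq> B" "B \<noteq> C" "A \<noteq> C" "C \<noteq> D" "A \<noteq> D" using assms bt_distinct by blast+
  obtain k where k: "inc C k" "k \<noteq> l" using line_ex_avoiding by blast
  have off: "\<not> inc A k" "\<not> inc B k" "\<not> inc D k" using line_unique k l Dl ne by metis+
  have "same_side k A B" using bt_same[OF bt_sym[OF assms(1)] k(1) off(2)] same_sym by blast
  then have "opp_side k B D" using bt_opp[OF assms(2) k(1) off(1)] opp_same_trans by blast
  then obtain C' where C': "inc C' k" "bt B C' D" by (auto simp: opp_side_def)
  have "C' = C" using bt_on_line(2)[OF C'(2)] l Dl k C' line_unique by metis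
  then show BCD: "bt B C D" using C' by blast
  obtain g where g: "inc B g" "g \<noteq> l" using line_ex_avoiding by blast
  have offg: "\<not> inc A g" "\<not> inc C g" using line_unique g l ne by metis+
  have "same_side g C D" using bt_same[OF BCD g(1) offg(2)] .
  then have "opp_side g A D" using bt_opp[OF assms(1) g(1) offg(1)] opp_same_trans opp_sym by metis
  then obtain B' where B': "inc B' g" "bt A B' D" by (auto simp: opp_side_def)
  have "B' = B" using bt_on_line(2)[OF B'(2)] l Dl g B' line_unique by metis
  then show "bt A B D" using B' by blast
qed

lemma bt_chain2:
  assumes "bt A B C" "bt B C D"
  shows "bt A B D" "bt A C D"
proof -
  obtain l where l: "inc A l" "inc B l" "inc C l" using bt_collinear assms by blast
  have Dl: "inc D l" using bt_on_line(1)[OF assms(2)] l by blast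
  have ne: "A \<noteq> B" "B \<noteq> C" "A \<noteq> C" "C \<noteq> D" "B \<noteq> D" using assms bt_distinct by blast+
  obtain k where k: "inc C k" "k \<noteq> l" using line_ex_avoiding by blast
  have off: "\<not> inc A k" "\<not> inc B k" "\<not> inc D k" using line_unique k l Dl ne by metis+
  have "same_side k B A" using bt_same[OF bt_sym[OF assms(1)] k(1) off(2)] .
  then have "opp_side k A D" using bt_opp[OF assms(2) k(1) off(2)] opp_same_trans by blast
  then obtain C' where C': "inc C' k" "bt A C' D" by (auto simp: opp_side_def)
  have "C' = C" using bt_on_line(2)[OF C'(2)] l Dl k C' line_unique by metis
  then show ACD: "bt A C D" using C' by blast
  then show "bt A B D" using bt_chain(1) assms by blast
qed

lemma bt_ray_cases:
  assumes "bt A B D \<or> B = D \<or> bt A D B" "bt A B E \<or> B = E \<or> bt A E B" "A \<noteq> B"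
  shows "bt A D E \<or> D = E \<or> bt A E D"
proof -
  have ne: "A \<noteq> B" "A \<noteq> D" "A \<noteq> E" using assms bt_distinct by blast+
  obtain l where l: "inc A l" "inc B l" using line_ex by blast
  have DE: "inc D l" "inc E l"
    using l assms(1,2) bt_on_line(1)[of A B D l] bt_on_line(2)[of A D B l]
      bt_on_line(1)[of A B E l] bt_on_line(2)[of A E B l] by blast+
  obtain k where k: "inc A k" "k \<noteq> l" using line_ex_avoiding by blast
  have off: "\<not> inc B k" "\<not> inc D k" "\<not> inc E k" using line_unique k l DE ne by metis+
  have "same_side k B D" using assms(1) bt_same k off same_sym same_refl by metis
  moreover have "same_side k B E" using assms(2) bt_same k off same_sym same_refl by metis
  ultimately have "same_side k D E" using same_sym same_trans by blast
  then have "\<not> bt D A E" using k off unfolding same_side_def opp_side_def by blast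
  then show ?thesis using bt_cases[of D A E l] bt_sym[of D E A] ne l DE by blast
qed

text \<open>The value at \<open>k\<close> is the side of \<open>k\<close> that eventually contains the ray from \<open>A\<close> through \<open>B\<close>;
  it is empty if \<open>k\<close> is the line \<open>AB\<close>. As a function of \<open>k\<close> it depends only on the direction of
  the ray and not on its starting point.\<close>

definition tail :: "'p \<Rightarrow> 'p \<Rightarrow> 'l \<Rightarrow> 'p set" where
  "tail A B k = {P. \<exists>D. (D = B \<or> bt A B D) \<and> (\<forall>C. bt A D C \<longrightarrow> same_side k P C)}"

lemma tailI: "\<lbrakk>D = B \<or> bt A B D; \<And>C. bt A D C \<Longrightarrow> same_side k P C\<rbrakk> \<Longrightarrow> P \<in> tail A B k"
  by (auto simp: tail_def)

lemma tailE:
  assumes "P \<in> tail A B k"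
  obtains D where "D = B \<or> bt A B D" "\<And>C. bt A D C \<Longrightarrow> same_side k P C"
  using assms by (auto simp: tail_def)

lemma tail_bt1:
  assumes "bt A B D" shows "tail A B = tail A D"
proof (rule ext, rule set_eqI)
  fix k P
  show "P \<in> tail A B k \<longleftrightarrow> P \<in> tail A D k"
  proof
    assume "P \<in> tail A B k"
    then obtain D0 where D0: "D0 = B \<or> bt A B D0" "\<And>C. bt A D0 C \<Longrightarrow> same_side k P C"
      using tailE by metis
    have "bt A D0 D \<or> D0 = D \<or> bt A D D0"
      using bt_ray_cases[of A B D0 D] D0(1) assms bt_distinct[OF assms] by blast
    then show "P \<in> tail A D k"
    proof (elim disjE)
      assume *: "bt A D0 D"
      show ?thesis using D0(2) bt_chain(1)[OF *] by (intro tailI[of D]) auto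
    qed (use D0(2) in \<open>auto intro: tailI[of D0]\<close>)
  next
    assume "P \<in> tail A D k"
    then obtain E where E: "E = D \<or> bt A D E" "\<And>C. bt A E C \<Longrightarrow> same_side k P C"
      using tailE by metis
    have "bt A B E" using E(1) bt_chain(1)[OF assms] assms by auto
    then show "P \<in> tail A B k" using E(2) by (intro tailI[of E]) auto
  qed
qed

lemma tail_bt2:
  assumes "bt A B D" shows "tail A D = tail B D"
proof (rule ext, rule set_eqI)
  fix k P
  show "P \<in> tail A D k \<longleftrightarrow> P \<in> tail B D k"
  proof
    assume "P \<in> tail A D k"
    then obtain E where E: "E = D \<or> bt A D E" "\<And>C. bt A E C \<Longrightarrow> same_side k P C"
      using tailE by metis
    have e: "E = D \<or> bt B D E" "bt A B E" using E(1) assms bt_chain[OF assms] by auto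
    show "P \<in> tail B D k"
      using e(1) E(2) bt_chain2(2)[OF e(2)] by (intro tailI[of E]) auto
  next
    assume "P \<in> tail B D k"
    then obtain E where E: "E = D \<or> bt B D E" "\<And>C. bt B E C \<Longrightarrow> same_side k P C"
      using tailE by metis
    have e: "E = D \<or> bt A D E" "bt A B E"
      using E(1) assms bt_chain2[OF assms] bt_chain(1)[OF assms] by auto
    show "P \<in> tail A D k"
      using e(1) E(2) bt_chain(2)[OF e(2)] by (intro tailI[of E]) auto
  qed
qed

text \<open>Directions may be based at any point of the line, so a direction can be compared with a
  crossing line from their common point.\<close>

lemma tail_from:
  assumes "A \<noteq> B" "inc A l" "inc B l" "inc Z l"
  shows "\<exists>B'. B' \<noteq> Z \<and> inc B' l \<and> tail Z B' = tail A B"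
proof (cases "Z = A")
  case True
  then show ?thesis using assms by (intro exI[of _ B]) auto
next
  case ZA: False
  show ?thesis
  proof (cases "Z = B")
    case True
    obtain D where D: "bt A B D" using bt_extend assms by blast
    then show ?thesis using True tail_bt1[OF D] tail_bt2[OF D] bt_distinct bt_on_line(1) assms by metis
  next
    case False
    then consider "bt A B Z" | "bt A Z B" | "bt Z A B"
      using bt_cases[of A B Z l] ZA assms bt_sym by metis
    then show ?thesis
    proof cases
      case 1
      obtain D where D: "bt A Z D" using bt_extend ZA by metis
      then show ?thesis using tail_bt1[OF 1] tail_bt1[OF D] tail_bt2[OF D] bt_distinct bt_on_line(1) assms by metis
    next
      case 2
      then show ?thesis using tail_bt2[OF 2] assms False by metis
    next
      case 3
      then show ?thesis using tail_bt2[OF 3] assms False by metis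
    qed
  qed
qed

lemma tail_start:
  assumes "inc Z k" "\<not> inc B k" shows "tail Z B k = {P. same_side k B P}"
proof (rule set_eqI)
  fix P
  have "Z \<noteq> B" using assms by blast
  show "P \<in> tail Z B k \<longleftrightarrow> P \<in> {P. same_side k B P}"
  proof
    assume "P \<in> tail Z B k"
    then obtain D where D: "D = B \<or> bt Z B D" "\<And>C. bt Z D C \<Longrightarrow> same_side k P C"
      using tailE by metis
    then obtain C where C: "bt Z D C" using bt_extend bt_distinct \<open>Z \<noteq> B\<close> by metis
    have "bt Z B C" using C D bt_chain by blast
    then have "same_side k B C" using bt_same assms by blast
    then show "P \<in> {P. same_side k B P}" using C D same_trans same_sym by blast
  next
    assume "P \<in> {P. same_side k B P}"
    then have "same_side k P C" if "bt Z B C" for C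
      using bt_same[OF that assms] same_trans same_sym by blast
    then show "P \<in> tail Z B k" by (intro tailI[of B]) auto
  qed
qed

lemma tail_apart:
  assumes "apart l k" "inc A l" "inc B l" "A \<noteq> B" "inc Q l"
  shows "tail A B k = {P. same_side k Q P}"
proof (rule set_eqI)
  fix P
  show "P \<in> tail A B k \<longleftrightarrow> P \<in> {P. same_side k Q P}"
  proof
    assume "P \<in> tail A B k"
    then obtain D where D: "D = B \<or> bt A B D" "\<And>C. bt A D C \<Longrightarrow> same_side k P C"
      using tailE by metis
    then obtain C where C: "bt A D C" using bt_extend bt_distinct \<open>A \<noteq> B\<close> by metis
    have "inc C l" using C D bt_on_line(1) assms by metis
    then show "P \<in> {P. same_side k Q P}" using apart_same[OF assms(1,5)] C D same_trans same_sym by blast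
  next
    assume "P \<in> {P. same_side k Q P}"
    then have "same_side k P C" if "bt A B C" for C
      using apart_same[OF assms(1,5)] bt_on_line(1)[OF that] assms same_trans same_sym by blast
    then show "P \<in> tail A B k" by (intro tailI[of B]) auto
  qed
qed

lemma tail_self:
  assumes "inc A l" "inc B l" "A \<noteq> B" shows "tail A B l = {}"
proof -
  have False if "D = B \<or> bt A B D" "\<forall>C. bt A D C \<longrightarrow> same_side l P C" for P D
  proof -
    have "A \<noteq> D" using that assms bt_distinct by blast
    then obtain C where "bt A D C" using bt_extend by blast
    moreover from this have "inc C l" using that bt_on_line(1) assms by metis
    ultimately show False using that same_off by blast
  qed
  then show ?thesis by (auto simp: tail_def)
qed

subsection \<open>Directions and asymptotic lines\<close>

definition directions :: "'l \<Rightarrow> ('l \<Rightarrow> 'p set) set" where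
  "directions l = {tail A B |A B. A \<noteq> B \<and> inc A l \<and> inc B l}"

text \<open>Lines \<open>k\<close> that meet neither \<open>a\<close> nor \<open>b\<close> are exempt, since they may separate \<open>a\<close> from \<open>b\<close>
  while passing through the common end. If \<open>k = b\<close> meets \<open>a\<close>, the condition fails because
  \<open>\<sigma> b\<close> is empty; so asymptotic lines are equal or disjoint.\<close>

definition asymptotic :: "'l \<Rightarrow> ('l \<Rightarrow> 'p set) \<Rightarrow> 'l \<Rightarrow> ('l \<Rightarrow> 'p set) \<Rightarrow> bool" where
  "asymptotic a \<tau> b \<sigma> \<longleftrightarrow> \<tau> \<in> directions a \<and> \<sigma> \<in> directions b \<and> (\<forall>k. meets k a \<or> meets k b \<longrightarrow> \<tau> k = \<sigma> k)"

lemma tail_in_dirs: "\<lbrakk>A \<noteq> B; inc A l; inc B l\<rbrakk> \<Longrightarrow> tail A B \<in> directions l"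
  by (auto simp: directions_def)

lemma dir_from:
  assumes "\<tau> \<in> directions l" "inc Z l"
  obtains B where "B \<noteq> Z" "inc B l" "\<tau> = tail Z B"
  using assms tail_from unfolding directions_def by (smt (verit) mem_Collect_eq)

lemma dir_self: "\<tau> \<in> directions l \<Longrightarrow> \<tau> l = {}"
  using tail_self by (auto simp: directions_def)

lemma dir_apart: "\<lbrakk>\<tau> \<in> directions l; apart l k; inc Q l\<rbrakk> \<Longrightarrow> \<tau> k = {P. same_side k Q P}"
  using tail_apart by (fastforce simp: directions_def)

lemma dir_side:
  assumes "\<tau> \<in> directions l" "k \<noteq> l"
  obtains Q where "\<not> inc Q k" "\<tau> k = {P. same_side k Q P}"
proof (cases "apart l k")
  case True
  obtain Q where "inc Q l" using A2 by blast
  then show ?thesis using that dir_apart[OF assms(1) True] True apart_point by blast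
next
  case False
  then obtain Z where Z: "inc Z l" "inc Z k" using not_apartD assms by metis
  obtain B where B: "B \<noteq> Z" "inc B l" "\<tau> = tail Z B" using dir_from[OF assms(1) Z(1)] .
  have "\<not> inc B k" using line_unique B Z assms by metis
  then show ?thesis using that tail_start Z B by metis
qed

lemma same_set_eq: "\<not> inc P k \<Longrightarrow> {R. same_side k P R} = {R. same_side k Q R} \<longleftrightarrow> same_side k P Q"
  using same_refl same_sym same_trans by blast

lemma dir_nonempty: "\<tau> \<in> directions l \<Longrightarrow> k \<noteq> l \<Longrightarrow> \<tau> k \<noteq> {}"
  using dir_side same_refl by (metis empty_iff mem_Collect_eq)

lemma meets_sym: "meets k l \<Longrightarrow> meets l k"
  by (auto simp: meets_def)

lemma meets_point: "\<lbrakk>inc P k; inc P l; k \<noteq> l\<rbrakk> \<Longrightarrow> meets k l"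
  by (auto simp: meets_def)

lemma asymptotic_sym: "asymptotic a \<tau> b \<sigma> \<Longrightarrow> asymptotic b \<sigma> a \<tau>"
  by (auto simp: asymptotic_def)

lemma asymptotic_refl: "\<tau> \<in> directions a \<Longrightarrow> asymptotic a \<tau> a \<tau>"
  by (auto simp: asymptotic_def)

lemma asymptotic_lines: "asymptotic a \<tau> b \<sigma> \<Longrightarrow> a = b \<or> apart a b"
proof -
  assume *: "asymptotic a \<tau> b \<sigma>"
  have "\<not> meets b a"
    using * dir_self[of \<sigma> b] dir_nonempty[of \<tau> a b] unfolding asymptotic_def meets_def by metis
  then show ?thesis using meets_sym by (auto simp: apart_iff)
qed

lemma asymptotic_same_line: "asymptotic a \<tau> a \<sigma> \<Longrightarrow> \<tau> = \<sigma>"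
proof (rule ext)
  fix k
  assume *: "asymptotic a \<tau> a \<sigma>"
  obtain Q where "inc Q a" using A2 by blast
  then show "\<tau> k = \<sigma> k"
    using * dir_apart[of \<tau> a k Q] dir_apart[of \<sigma> a k Q] dir_self[of \<tau> a] dir_self[of \<sigma> a] apart_sym
    unfolding asymptotic_def apart_iff by (metis meets_sym)
qed

lemma tail_same:
  assumes "inc T k" "inc T l" "inc A l" "inc V l" "same_side k A V"
  shows "tail T A = tail T V"
proof -
  have ne: "A \<noteq> T" "V \<noteq> T" using assms same_off by blast+
  have "\<not> bt A T V" using assms(1,5) unfolding same_side_def opp_side_def by blast
  then consider "A = V" | "bt T A V" | "bt T V A"
    using bt_cases[of A T V l] assms ne bt_sym by metis
  then show ?thesis using tail_bt1 by cases auto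
qed

text \<open>Join a common point \<open>Z\<close> of \<open>a\<close> and \<open>c\<close> to a point
  \<open>B\<close> of \<open>b\<close> by \<open>m\<close>. Comparing the directions on
  \<open>a\<close>, \<open>c\<close> and \<open>m\<close> gives the three same-side relations that
  \<open>crossbar\<close> forbids at \<open>Z\<close>.\<close>

lemma asymptotic_not_meets:
  assumes ab: "asymptotic a \<tau> b \<sigma>" and bc: "asymptotic b \<sigma> c \<rho>" and m: "meets a c"
  shows False
proof -
  obtain Z where Z: "inc Z a" "inc Z c" "a \<noteq> c" using m by (auto simp: meets_def)
  have directions: "\<tau> \<in> directions a" "\<sigma> \<in> directions b" "\<rho> \<in> directions c" using ab bc by (auto simp: asymptotic_def)
  have "a \<noteq> b" using asymptotic_lines[OF bc] m Z(3) by (auto simp: apart_iff)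
  then have apab: "apart a b" using asymptotic_lines[OF ab] by blast
  have "b \<noteq> c" using asymptotic_lines[OF ab] m Z(3) by (auto simp: apart_iff)
  then have apbc: "apart b c" using asymptotic_lines[OF bc] by blast
  obtain A where A: "A \<noteq> Z" "inc A a" "\<tau> = tail Z A" using dir_from[OF directions(1) Z(1)] .
  obtain C where C: "C \<noteq> Z" "inc C c" "\<rho> = tail Z C" using dir_from[OF directions(3) Z(2)] .
  obtain B where B: "inc B b" using A2 by blast
  obtain m where m: "inc Z m" "inc B m" using line_ex by blast
  have Boff: "\<not> inc B a" "\<not> inc B c" using B apab apbc apart_point by blast+
  have ma: "m \<noteq> a" "m \<noteq> c" using m Boff by blast+
  have off: "\<not> inc C a" "\<not> inc A c" "\<not> inc A m" "\<not> inc C m"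
    using line_unique A C Z m ma by metis+
  have "\<rho> a = \<sigma> a" using bc meets_point Z by (metis asymptotic_def)
  then have 1: "same_side a B C"
    using dir_apart[OF directions(2) apart_sym[OF apab] B] tail_start[OF Z(1) off(1)] C(3)
      same_set_eq[OF Boff(1), of C] by metis
  have "\<tau> c = \<sigma> c" using ab meets_point Z by (metis asymptotic_def)
  then have 2: "same_side c A B"
    using dir_apart[OF directions(2) apbc B] tail_start[OF Z(2) off(2)] A(3)
      same_set_eq[OF off(2), of B] by metis
  have "\<tau> m = \<sigma> m" using ab meets_point m(1) Z(1) ma by (metis asymptotic_def)
  moreover have "\<sigma> m = \<rho> m" using bc meets_point m(1) Z(2) ma by (metis asymptotic_def)
  ultimately have 3: "same_side m A C"
    using tail_start[OF m(1) off(3)] tail_start[OF m(1) off(4)] A(3) C(3)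
      same_set_eq[OF off(3), of C] by metis
  show False using crossbar[OF Z(1) m(1) Z(2) A(2) m(2) C(2) 1 3 2] .
qed

text \<open>The hard case is a line \<open>k\<close> meeting \<open>a\<close> but neither
  \<open>b\<close> nor \<open>c\<close>, on which \<sigma> and \<rho> are not compared by
  hypothesis. If they differed, an auxiliary line \<open>h\<close> through a point of
  \<open>b\<close>, avoiding \<open>k\<close> and meeting \<open>a\<close>, would help: it meets
  \<open>b\<close>, so all three directions agree on it.\<close>

lemma asymptotic_trans_half:
  assumes ab: "asymptotic a \<tau> b \<sigma>" and bc: "asymptotic b \<sigma> c \<rho>" and ka: "meets k a"
  shows "\<tau> k = \<rho> k"
proof (cases "meets k b \<or> meets k c")
  case True
  then show ?thesis using ab bc ka by (auto simp: asymptotic_def)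
next
  case False
  have directions: "\<tau> \<in> directions a" "\<sigma> \<in> directions b" "\<rho> \<in> directions c" using ab bc by (auto simp: asymptotic_def)
  have "\<tau> k = \<sigma> k" using ab ka by (auto simp: asymptotic_def)
  have "k \<noteq> b" using asymptotic_lines[OF ab] ka by (auto simp: apart_def meets_def)
  then have kb: "apart k b" using False by (simp add: apart_iff)
  have "k \<noteq> c" using asymptotic_not_meets[OF ab bc] ka meets_sym by blast
  then have kc: "apart k c" using False by (simp add: apart_iff)
  have "a \<noteq> b" using ka kb by (auto simp: apart_iff)
  then have apab: "apart a b" using asymptotic_lines[OF ab] by blast
  obtain B where B: "inc B b" using A2 by blast
  obtain C where C: "inc C c" using A2 by blast
  have sk: "\<sigma> k = {P. same_side k B P}" using dir_apart[OF directions(2) apart_sym[OF kb] B] .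
  have rk: "\<rho> k = {P. same_side k C P}" using dir_apart[OF directions(3) apart_sym[OF kc] C] .
  have Boff: "\<not> inc B k" "\<not> inc C k" using B C kb kc apart_point by blast+
  have "same_side k B C"
  proof (rule ccontr)
    assume "\<not> same_side k B C"
    obtain T where T: "inc T k" "inc T a" "k \<noteq> a" using ka by (auto simp: meets_def)
    obtain h1 h2 where h12: "inc B h1" "inc B h2" "apart h1 k" "apart h2 k"
      "\<And>g. apart g h1 \<Longrightarrow> apart g h2 \<Longrightarrow> g = k \<or> apart g k"
      using apart_pair[OF Boff(1)] by metis
    have "\<not> apart a k" using T apart_point by blast
    then obtain h where h: "inc B h" "apart h k" "\<not> apart a h" using h12 T by metis
    have "a \<noteq> h" using h T apart_point by blast
    then obtain V where V: "inc V a" "inc V h" using h not_apartD by blast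
    have "h \<noteq> b" using h apab by blast
    have \<tau>h: "\<tau> h = \<sigma> h" using ab meets_point[OF V(2,1)] \<open>a \<noteq> h\<close> by (auto simp: asymptotic_def)
    have \<sigma>h: "\<sigma> h = \<rho> h" using bc meets_point[OF h(1) B \<open>h \<noteq> b\<close>] by (auto simp: asymptotic_def)
    have hs: "same_side k B Z" if "inc Z h" for Z using apart_same[OF h(2,1) that] .
    have cs: "same_side k C Z" if "inc Z c" for Z using apart_same[OF apart_sym[OF kc] C that] .
    have hc: "apart c h"
      using hs cs \<open>\<not> same_side k B C\<close> same_sym same_trans A2 unfolding apart_def by metis
    have Th: "\<not> inc T h" using h T apart_point by blast
    have "\<not> opp_side h C T"
    proof
      assume "opp_side h C T"
      then obtain D where D: "inc D h" "bt T D C" using bt_sym by (auto simp: opp_side_def)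
      have "same_side k D C" using bt_same[OF D(2) T(1)] hs D(1) same_off by blast
      then show False using hs[OF D(1)] \<open>\<not> same_side k B C\<close> same_trans by blast
    qed
    then have "same_side h C T" using hc C Th apart_point by (auto simp: same_side_def)
    \<comment> \<open>\<open>c\<close> is on the side of \<open>T\<close> with respect to
      \<open>h\<close>, so the end would be there too; but \<tau> leads from \<open>T\<close>
      through \<open>V\<close> on \<open>h\<close> to the other side.\<close>
    then have "T \<in> \<tau> h" using \<tau>h \<sigma>h dir_apart[OF directions(3) hc C] by simp
    obtain A where A: "A \<noteq> T" "inc A a" "\<tau> = tail T A" using dir_from[OF directions(1) T(2)] .
    have "\<not> inc A k" using line_unique A T by metis
    then have "same_side k A B"
      using tail_start[OF T(1)] A(3) \<open>\<tau> k = \<sigma> k\<close> sk same_set_eq by metis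
    then have "same_side k A V" using hs[OF V(2)] same_trans by blast
    then have tV: "\<tau> = tail T V" using tail_same[OF T(1,2) A(2) V(1)] A(3) by simp
    have "T \<noteq> V" using V Th by blast
    then obtain W where W: "bt T V W" using bt_extend by blast
    have oW: "opp_side h T W" using bt_opp[OF W V(2) Th] .
    have "\<tau> h = {P. same_side h W P}"
      using tV tail_bt1[OF W] tail_bt2[OF W] tail_start[OF V(2)] oW opp_off by metis
    then show False using \<open>T \<in> \<tau> h\<close> oW same_sym by (simp add: same_side_def opp_sym)
  qed
  then show ?thesis using \<open>\<tau> k = \<sigma> k\<close> sk rk same_set_eq[OF Boff(1)] by simp
qed

lemma asymptotic_trans: "asymptotic a \<tau> b \<sigma> \<Longrightarrow> asymptotic b \<sigma> c \<rho> \<Longrightarrow> asymptotic a \<tau> c \<rho>"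
  using asymptotic_trans_half[of a \<tau> b \<sigma> c \<rho>] asymptotic_trans_half[of c \<rho> b \<sigma> a \<tau>] asymptotic_sym
  unfolding asymptotic_def by metis

section \<open>The two directions of a line\<close>

lemma tail_opposite:
  assumes "bt A Z B" "inc Z k" "\<not> inc A k"
  shows "tail Z A k = {P. opp_side k B P}" "tail Z B k = {P. same_side k B P}"
proof -
  have o: "opp_side k A B" using bt_opp assms by blast
  have "{P. same_side k A P} = {P. opp_side k B P}"
    using o opp_opp_same opp_same_trans opp_sym same_sym off_cases opp_off same_off
    by (smt (verit, best) Collect_cong)
  then show "tail Z A k = {P. opp_side k B P}" using tail_start[OF assms(2,3)] by simp
  show "tail Z B k = {P. same_side k B P}" using tail_start[OF assms(2)] o opp_off by blast
qed

lemma dirs_eq: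
  assumes "bt A Z B" "inc Z l" "inc A l"
  shows "directions l = {tail Z A, tail Z B}" "tail Z A \<noteq> tail Z B"
proof -
  have Bl: "inc B l" using bt_on_line(1)[OF assms(1)] assms by blast
  have ne: "A \<noteq> Z" "Z \<noteq> B" using assms bt_distinct by blast+
  obtain k where k: "inc Z k" "k \<noteq> l" using line_ex_avoiding by blast
  have Ak: "\<not> inc A k" using line_unique k assms ne by metis
  have o: "opp_side k A B" using bt_opp[OF assms(1) k(1) Ak] .
  show "tail Z A \<noteq> tail Z B"
    using tail_opposite[OF assms(1) k(1) Ak] o same_refl opp_off by (metis (mono_tags, lifting) mem_Collect_eq same_side_def)
  have "\<tau> = tail Z A \<or> \<tau> = tail Z B" if \<tau>: "\<tau> \<in> directions l" for \<tau>
  proof -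
    obtain C where C: "C \<noteq> Z" "inc C l" "\<tau> = tail Z C" using dir_from[OF \<tau> assms(2)] .
    have "\<not> inc C k" using line_unique k assms C by metis
    then have "same_side k C A \<or> same_side k C B"
      using o opp_opp_same off_cases opp_off opp_sym by metis
    then show ?thesis using tail_same[OF k(1) assms(2) C(2)] assms(3) Bl C(3) by metis
  qed
  moreover have "tail Z A \<in> directions l" "tail Z B \<in> directions l"
    using tail_in_dirs assms Bl ne by metis+
  ultimately show "directions l = {tail Z A, tail Z B}" by blast
qed

text \<open>A second line \<open>k\<close> through a point of \<open>a\<close> that avoids
  \<open>b\<close> has \<open>b\<close> entirely on one side, so all directions of \<open>b\<close>
  agree on \<open>k\<close>, while the two directions of \<open>a\<close> differ there.\<close>

lemma asymptotic_unique_line: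
  assumes "asymptotic a \<tau> b \<sigma>" "asymptotic a \<tau>' b \<sigma>'" "\<tau> \<noteq> \<tau>'"
  shows "a = b"
proof (rule ccontr)
  assume "a \<noteq> b"
  then have ab: "apart a b" using asymptotic_lines assms by blast
  obtain P where P: "inc P a" using A2 by blast
  then obtain k where k: "inc P k" "apart k b" "k \<noteq> a" using apart_ex ab apart_point by metis
  obtain B where B: "inc B b" using A2 by blast
  have m: "meets k a" using meets_point k P by blast
  have directions: "\<tau> \<in> directions a" "\<tau>' \<in> directions a" "\<sigma> \<in> directions b" "\<sigma>' \<in> directions b" using assms by (auto simp: asymptotic_def)
  have "\<tau> k = \<tau>' k"
    using assms(1,2) m dir_apart[OF directions(3) apart_sym[OF k(2)] B]
      dir_apart[OF directions(4) apart_sym[OF k(2)] B] by (auto simp: asymptotic_def)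
  moreover obtain A A' where "A \<noteq> P" "inc A a" "\<tau> = tail P A" "A' \<noteq> P" "inc A' a" "\<tau>' = tail P A'"
    using dir_from[OF directions(1) P] dir_from[OF directions(2) P] by metis
  moreover have "\<not> inc A k" "\<not> inc A' k" using line_unique calculation k P by metis+
  ultimately have "\<tau> = \<tau>'"
    using tail_start[OF k(1)] same_set_eq tail_same[OF k(1) P] by metis
  then show False using assms by blast
qed

subsection \<open>Existence of asymptotic lines\<close>

text \<open>\<open>crossbar\<close> at the common point \<open>S\<close> of \<open>m\<close>,
  \<open>k\<close> and \<open>b\<close> fixes the side of \<open>k\<close> on which \<open>P\<close>
  lies, according to whether \<tau> leads from \<open>P\<close> towards \<open>V\<close> or away
  from it.\<close>

lemma dir_agree_half:
  assumes pb: "apart p b" and directions: "\<tau> \<in> directions p" "\<sigma> \<in> directions b"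
    and S: "inc S b" "inc S m" "inc S k" and P: "inc P p" "inc P m" and V: "inc V p" "inc V k"
    and eq: "\<tau> m = \<sigma> m"
  shows "\<tau> k = \<sigma> k"
proof (cases "P = V")
  case True
  have "P \<noteq> S" using S P pb apart_point by blast
  then have "m = k" using True line_unique S P V by metis
  then show ?thesis using eq by simp
next
  case False
  obtain A where A: "A \<noteq> P" "inc A p" "\<tau> = tail P A" using dir_from[OF directions(1) P(1)] .
  obtain T where T: "T \<noteq> S" "inc T b" "\<sigma> = tail S T" using dir_from[OF directions(2) S(1)] .
  have mp: "m \<noteq> p" "m \<noteq> b" "k \<noteq> p" "k \<noteq> b" using S P V pb apart_point by blast+
  have off: "\<not> inc A m" "\<not> inc T m" "\<not> inc T k" "\<not> inc V m" "\<not> inc P k"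
    using line_unique A T S P V mp False by metis+
  have sAT: "same_side m A T"
    using eq A(3) T(3) tail_start[OF P(2) off(1)] tail_start[OF S(2) off(2)]
      same_set_eq[OF off(1), of T] by metis
  have bPV: "same_side b P V" using apart_same[OF pb P(1) V(1)] .
  have \<sigma>k: "\<sigma> k = {R. same_side k T R}" using tail_start[OF S(3) off(3)] T(3) by simp
  show ?thesis
  proof (cases "same_side m A V")
    case True
    then have \<tau>: "\<tau> = tail P V" using tail_same[OF P(2,1) A(2) V(1)] A(3) by simp
    obtain W where W: "bt P V W" using bt_extend[OF False] by blast
    have oW: "opp_side k P W" using bt_opp[OF W V(2) off(5)] .
    have \<tau>k: "\<tau> k = {R. same_side k W R}"
      using \<tau> tail_bt1[OF W] tail_bt2[OF W] tail_start[OF V(2)] oW opp_off by metis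
    have "same_side m V T" using sAT True same_sym same_trans by blast
    then have "\<not> same_side k P T"
      using crossbar[OF S(2,3,1) P(2) V(2) T(2)] bPV by blast
    then have "opp_side k T P" using off off_cases opp_sym by blast
    then have "same_side k T W" using oW opp_opp_same by blast
    then show ?thesis using \<tau>k \<sigma>k same_set_eq[OF off(3), of W] by metis
  next
    case neg: False
    then have o: "opp_side m A V" using off off_cases by blast
    then obtain P' where P': "inc P' m" "bt A P' V" by (auto simp: opp_side_def)
    have "P' = P" using bt_on_line(2)[OF P'(2) A(2) V(1)] P' P line_unique mp by metis
    then have bt: "bt V P A" using P' bt_sym by blast
    have \<tau>k: "\<tau> k = {R. same_side k P R}"
      using A(3) tail_bt2[OF bt] tail_bt1[OF bt] tail_start[OF V(2) off(5)] by simp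
    have "same_side k P T"
    proof (rule ccontr)
      assume "\<not> same_side k P T"
      then have oPT: "opp_side k P T" using off off_cases by blast
      obtain T' where T': "bt T S T'" using bt_extend T(1) by blast
      have T'b: "inc T' b" using bt_on_line(1)[OF T'] T S by blast
      have "opp_side k T T'" "opp_side m T T'" using bt_opp[OF T'] S off by blast+
      then have "same_side k P T'" "same_side m V T'"
        using oPT o sAT opp_opp_same opp_same_trans opp_sym same_sym by metis+
      then show False using crossbar[OF S(2,3,1) P(2) V(2) T'b] bPV by blast
    qed
    then show ?thesis using \<tau>k \<sigma>k same_set_eq[OF off(5), of T] by metis
  qed
qed

text \<open>The diagonal \<open>n\<close> shares a point of \<open>b\<close> with \<open>m\<close>
  and a point of \<open>p\<close> with \<open>k\<close>, so two half steps suffice.\<close>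

lemma dir_agree:
  assumes pb: "apart p b" and directions: "\<tau> \<in> directions p" "\<sigma> \<in> directions b"
    and m: "meets m p" "meets m b" and k: "meets k p" "meets k b"
    and eq: "\<tau> m = \<sigma> m"
  shows "\<tau> k = \<sigma> k"
proof -
  obtain P S V Z where pts: "inc P m" "inc P p" "inc S m" "inc S b"
    "inc V k" "inc V p" "inc Z k" "inc Z b"
    using m k by (auto simp: meets_def)
  obtain n where n: "inc V n" "inc S n" using line_ex by blast
  have "\<tau> n = \<sigma> n"
    using dir_agree_half[OF pb directions pts(4,3) n(2) pts(2,1,6) n(1) eq] .
  then have "\<sigma> k = \<tau> k"
    using dir_agree_half[OF apart_sym[OF pb] directions(2,1) pts(6) n(1) pts(5,4) n(2) pts(8,7)] by simp
  then show ?thesis by simp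
qed

text \<open>The two lines of an A5 pair are the two limiting parallels. The hypotheses on \<open>p1\<close> and \<open>q2\<close> say
  which half of each line faces \<open>b\<close>.\<close>

lemma asymptotic_of_pair:
  assumes p: "inc P p" "apart p b" and q: "inc P q" "apart q b" and "p \<noteq> q"
    and pair: "\<And>k. apart k p \<Longrightarrow> apart k q \<Longrightarrow> k = b \<or> apart k b"
    and S: "inc S b" "inc S1 b" "bt S1 S S2" and m: "inc P m" "inc S m"
    and p1: "inc p1 p" "same_side q p1 S" "same_side m p1 S1"
    and q2: "inc q2 q" "same_side p q2 S" "same_side m q2 S2"
  shows "asymptotic p (tail P p1) b (tail S S1)"
proof -
  define \<tau> where "\<tau> = tail P p1"
  define \<sigma> where "\<sigma> = tail S S1"
  have S2: "inc S2 b" using bt_on_line(1)[OF S(3)] S by blast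
  have offm: "\<not> inc p1 m" "\<not> inc S1 m" "\<not> inc q2 m" "\<not> inc S2 m" using p1 q2 same_off by blast+
  have ne: "p1 \<noteq> P" "S1 \<noteq> S" "q2 \<noteq> P" "S2 \<noteq> S" using offm m by blast+
  have directions: "\<tau> \<in> directions p" "\<sigma> \<in> directions b"
    using tail_in_dirs ne p(1) p1(1) S unfolding \<tau>_def \<sigma>_def by metis+
  have mb: "meets m p" "meets m b" "meets m q"
    using meets_point[OF m(1) p(1)] meets_point[OF m(2) S(1)] meets_point[OF m(1) q(1)] p1(1) q2(1) S(2) offm by blast+
  have \<tau>m: "\<tau> m = {R. same_side m S1 R}"
    using tail_start[OF m(1) offm(1)] same_set_eq[OF offm(1), of S1] p1(3) unfolding \<tau>_def by blast
  have \<sigma>m: "\<sigma> m = {R. same_side m S1 R}"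
    using tail_start[OF m(2) offm(2)] unfolding \<sigma>_def by blast
  have oS: "opp_side m S1 S2" using bt_opp[OF S(3) m(2) offm(2)] .
  have both: "\<tau> k = \<sigma> k" if "meets k p" "meets k b" for k
    using dir_agree[OF p(2) directions mb(1,2) that] \<tau>m \<sigma>m by simp
  have qb: "same_side b P A" if "inc A q" for A using apart_same[OF q(2,1) that] .
  \<comment> \<open>A line \<open>k\<close> meeting \<open>b\<close> but not \<open>p\<close> must
    meet \<open>q\<close>, in \<open>V\<close> say. If the directions disagreed on \<open>k\<close>,
    the direction of \<open>q\<close> towards \<open>q2\<close> would run from \<open>V\<close>
    through \<open>P\<close>, putting \<open>V\<close> beyond \<open>p\<close> as seen from
    \<open>b\<close>; but \<open>k\<close> joins \<open>V\<close> to \<open>b\<close> without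
    meeting \<open>p\<close>.\<close>
  have onlyb: "\<tau> k = \<sigma> k" if k: "meets k b" "\<not> meets k p" for k
  proof -
    have kp: "apart k p" using k p(2) unfolding apart_def meets_def by blast
    have kb: "k \<noteq> b" "\<not> apart k b" using k(1) unfolding meets_def apart_def by blast+
    have kq: "\<not> apart k q" "k \<noteq> q" using pair[OF kp] kb q(2) by blast+
    then obtain V where V: "inc V k" "inc V q" using not_apartD by blast
    obtain Z where Z: "inc Z k" "inc Z b" "k \<noteq> b" using k by (auto simp: meets_def)
    have \<tau>k: "\<tau> k = {R. same_side k P R}" using dir_apart[OF directions(1) apart_sym[OF kp] p(1)] .
    have Pk: "\<not> inc P k" using kp p apart_point by blast
    obtain X where X: "X \<noteq> Z" "inc X b" "\<sigma> = tail Z X" using dir_from[OF directions(2) Z(2)] .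
    have Xk: "\<not> inc X k" using line_unique X Z by metis
    have \<sigma>k: "\<sigma> k = {R. same_side k X R}" using tail_start[OF Z(1) Xk] X(3) by simp
    have "same_side k P X"
    proof (rule ccontr)
      assume "\<not> same_side k P X"
      then have oPX: "opp_side k P X" using off_cases Pk Xk by blast
      obtain X2 where X2: "bt X Z X2" using bt_extend X(1) by blast
      define \<sigma>' where "\<sigma>' = tail S S2"
      have "\<sigma>' \<noteq> \<sigma>" "directions b = {\<sigma>, \<sigma>'}" using dirs_eq[OF S(3,1,2)] unfolding \<sigma>_def \<sigma>'_def by auto
      moreover have "directions b = {\<sigma>, tail Z X2}" "\<sigma> \<noteq> tail Z X2" using dirs_eq[OF X2 Z(2) X(2)] X(3) by auto
      ultimately have \<sigma>'X: "\<sigma>' = tail Z X2" by blast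
      have \<sigma>'d: "\<sigma>' \<in> directions b" using \<open>directions b = {\<sigma>, \<sigma>'}\<close> by blast
      have "opp_side k X X2" using bt_opp[OF X2 Z(1) Xk] .
      then have X2P: "same_side k P X2" using oPX opp_opp_same by blast
      have \<sigma>'k: "\<sigma>' k = {R. same_side k P R}"
        using tail_start[OF Z(1)] \<sigma>'X X2P same_set_eq[OF Pk, of X2] same_off by metis
      define \<omega> where "\<omega> = tail P q2"
      have \<omega>d: "\<omega> \<in> directions q" using tail_in_dirs ne q q2 unfolding \<omega>_def by metis
      have "\<omega> m = \<sigma>' m"
        using tail_start[OF m(1) offm(3)] tail_start[OF m(2) offm(4)] same_set_eq[OF offm(3), of S2] q2(3)
        unfolding \<omega>_def \<sigma>'_def by blast
      then have "\<omega> k = \<sigma>' k"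
        using dir_agree[OF q(2) \<omega>d \<sigma>'d mb(3,2)] meets_point[OF V kq(2)] k by blast
      then have \<omega>k: "\<omega> k = {R. same_side k P R}" using \<sigma>'k by simp
      obtain Y where Y: "Y \<noteq> V" "inc Y q" "\<omega> = tail V Y" using dir_from[OF \<omega>d V(2)] .
      have Yk: "\<not> inc Y k" using line_unique Y V kq by metis
      have "same_side k Y P" using tail_start[OF V(1) Yk] \<omega>k Y(3) same_set_eq[OF Pk, of Y] same_sym by metis
      then have \<omega>V: "\<omega> = tail V P" using tail_same[OF V Y(2) q(1)] Y(3) by simp
      have Vp: "\<not> inc V p" using V kp apart_point by blast
      have "\<not> same_side p V q2"
      proof
        assume s: "same_side p V q2"
        then have \<omega>2: "\<omega> = tail P V"
          using tail_same[OF p(1) q(1) V(2) q2(1)] unfolding \<omega>_def by simp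
        have "P \<noteq> V" using Vp p by blast
        then obtain U where U: "bt P V U" using bt_extend by blast
        have "opp_side k P U" using bt_opp[OF U V(1) Pk] .
        moreover have "\<omega> k = {R. same_side k U R}"
          using \<omega>2 tail_bt1[OF U] tail_bt2[OF U] tail_start[OF V(1)] calculation opp_off by metis
        ultimately show False
          using \<omega>k same_set_eq[OF Pk, of U] unfolding same_side_def by metis
      qed
      moreover have "same_side p V Z" using apart_same[OF kp V(1) Z(1)] .
      moreover have "same_side p Z S" using apart_same[OF apart_sym[OF p(2)] Z(2) S(1)] .
      ultimately show False using q2(2) same_trans same_sym by metis
    qed
    then show ?thesis using \<tau>k \<sigma>k same_set_eq[OF Pk, of X] by simp
  qed
  \<comment> \<open>Here \<open>k\<close> avoids \<open>b\<close> and meets \<open>p\<close> at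
    \<open>P\<close> or ahead of it. A line \<open>z\<close> through \<open>S\<close> that avoids
    \<open>p\<close> and meets \<open>k\<close> is not \<open>b\<close>, so by the choice of the
    pair it meets \<open>q\<close>, in \<open>Y\<close>. If the directions disagreed on
    \<open>k\<close>, then \<open>Y\<close> would be on the side of \<open>S2\<close> for
    \<open>m\<close> and on that of \<open>S1\<close> for the line \<open>VS\<close>.\<close>
  have forward: "\<tau> k = \<sigma> k"
    if k: "meets k p" "\<not> meets k b" and V: "inc V k" "inc V p" and VP: "V = P \<or> \<tau> = tail P V" for k V
  proof -
    have kp: "k \<noteq> p" using k by (auto simp: meets_def)
    have kb: "apart k b" using k p(2) unfolding apart_def meets_def by blast
    have Sk: "\<not> inc S k" using kb S apart_point by blast
    have \<sigma>k: "\<sigma> k = {R. same_side k S R}" using dir_apart[OF directions(2) apart_sym[OF kb] S(1)] .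
    obtain X where X: "X \<noteq> V" "inc X p" "\<tau> = tail V X" using dir_from[OF directions(1) V(2)] .
    have Xk: "\<not> inc X k" using line_unique X V kp by metis
    have \<tau>k: "\<tau> k = {R. same_side k X R}" using tail_start[OF V(1) Xk] X(3) by simp
    have "same_side k S X"
    proof (rule ccontr)
      assume "\<not> same_side k S X"
      then have oSX: "opp_side k S X" using off_cases Sk Xk by blast
      have Sp: "\<not> inc S p" using S p apart_point by blast
      obtain z1 z2 where z12: "inc S z1" "inc S z2" "apart z1 p" "apart z2 p"
        "\<And>g. apart g z1 \<Longrightarrow> apart g z2 \<Longrightarrow> g = p \<or> apart g p"
        using apart_pair[OF Sp] by metis
      have "\<not> apart k p" using k by (simp add: apart_iff)
      then obtain z where z: "inc S z" "apart z p" "\<not> apart k z" using z12 kp by metis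
      have "k \<noteq> z" using z Sk by blast
      then obtain W where W: "inc W k" "inc W z" using z not_apartD by blast
      have "z \<noteq> b" using z kb by blast
      then have "\<not> apart z q" using pair[OF z(2)] z S apart_point by blast
      moreover have "z \<noteq> q" using z S q apart_point by blast
      ultimately obtain Y where Y: "inc Y z" "inc Y q" using not_apartD by blast
      have Yp: "\<not> inc Y p" using Y z apart_point by blast
      have YS: "same_side p Y S" using apart_same[OF z(2) Y(1) z(1)] .
      then have "same_side p Y q2" using q2(2) same_sym same_trans by blast
      then have "tail P Y = tail P q2" using tail_same[OF p(1) q(1) Y(2) q2(1)] by simp
      moreover have Ym: "\<not> inc Y m" using line_unique[of Y P m q] Y q m Yp p offm(3) q2(1) by metis
      ultimately have "same_side m Y q2" using tail_start[OF m(1)] offm(3) same_set_eq by metis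
      then have YS2: "same_side m Y S2" using q2(3) same_trans by blast
      obtain m' where m': "inc V m'" "inc S m'" using line_ex by blast
      have m'p: "m' \<noteq> p" using m' Sp by blast
      have m'b: "m' \<noteq> b" using m' V(2) p apart_point by blast
      have Xm': "\<not> inc X m'" using line_unique X V m' m'p by metis
      have S1m': "\<not> inc S1 m'" using line_unique ne S m' m'b by metis
      have "\<tau> m' = \<sigma> m'"
        using both meets_point[OF m'(1) V(2) m'p] meets_point[OF m'(2) S(1) m'b] by blast
      then have XS1: "same_side m' X S1"
        using tail_start[OF m'(1) Xm'] tail_start[OF m'(2) S1m'] X(3) same_set_eq[OF Xm', of S1]
        unfolding \<sigma>_def by metis
      have pSW: "same_side p S W" using apart_same[OF z(2,1) W(2)] .
      have "k \<noteq> m'" using m' Sk by blast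
      moreover have "W \<noteq> V" using W z V apart_point by blast
      ultimately have Wm': "\<not> inc W m'" using line_unique W V m' by metis
      have "same_side m' W X"
      proof (rule ccontr)
        assume "\<not> same_side m' W X"
        then have o: "opp_side m' W X" using off_cases Wm' Xm' by blast
        obtain X' where X': "bt X V X'" using bt_extend X(1) by blast
        have X'p: "inc X' p" using bt_on_line(1)[OF X'] X V by blast
        have "opp_side k X X'" "opp_side m' X X'" using bt_opp[OF X'] V m' Xk Xm' by blast+
        then have "same_side k S X'" "same_side m' W X'" using o oSX opp_opp_same by blast+
        then show False
          using crossbar[OF V(1) m'(1) V(2) W(1) m'(2) X'p] pSW same_sym by blast
      qed
      have "same_side b W V" using apart_same[OF kb W(1) V(1)] .
      moreover have VPb: "same_side b V P" using apart_same[OF p(2) V(2) p(1)] .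
      ultimately have bWY: "same_side b W Y" using qb[OF Y(2)] same_trans by blast
      have "z \<noteq> m'" using z V m' apart_point by blast
      moreover have "Y \<noteq> S" using Y(2) S(1) q apart_point by blast
      ultimately have Ym': "\<not> inc Y m'" using line_unique[of Y S z m'] Y z m' by blast
      have "same_side m' Y W"
      proof (rule ccontr)
        assume "\<not> same_side m' Y W"
        then have "opp_side m' Y W" using off_cases Ym' Wm' by blast
        then obtain D where D: "inc D m'" "bt Y D W" by (auto simp: opp_side_def)
        have "D = S" using bt_on_line(2)[OF D(2) Y(1) W(2)] D m' z line_unique \<open>z \<noteq> m'\<close> by metis
        then show False using bt_opp[OF D(2), of b] S bWY same_sym same_off unfolding same_side_def by metis
      qed
      then have YS1: "same_side m' Y S1" using \<open>same_side m' W X\<close> XS1 same_trans by blast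
      show False
      proof (cases "V = P")
        case True
        have "P \<noteq> S" using p Sp by blast
        then have "m' = m" using line_unique m m' True by metis
        then show False using YS1 YS2 oS same_sym same_trans unfolding same_side_def by metis
      next
        case False
        then have \<tau>V: "\<tau> = tail P V" using VP by blast
        obtain U where U: "bt P V U" using bt_extend False by metis
        have Pm': "\<not> inc P m'" using line_unique[of P V m' p] False p V m' m'p by blast
        have oPU: "opp_side m' P U" using bt_opp[OF U m'(1) Pm'] .
        have "\<tau> m' = {R. same_side m' U R}"
          using \<tau>V tail_bt1[OF U] tail_bt2[OF U] tail_start[OF m'(1)] oPU opp_off by metis
        then have "same_side m' X U"
          using tail_start[OF m'(1) Xm'] X(3) same_set_eq[OF Xm', of U] by metis
        then have "opp_side m' P Y"
          using oPU XS1 YS1 opp_same_trans opp_sym same_sym same_trans by metis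
        \<comment> \<open>For \<open>V\<close> ahead of \<open>P\<close> the line \<open>m'\<close>
          meets \<open>q\<close> in \<open>H\<close>, and \<open>S\<close> would lie between
          \<open>H\<close> and \<open>V\<close>, two points on the same side of
          \<open>b\<close>.\<close>
        then obtain H where H: "inc H m'" "bt P H Y" by (auto simp: opp_side_def)
        have Hq: "inc H q" using bt_on_line(2)[OF H(2) q(1) Y(2)] .
        have bHV: "same_side b H V" using qb[OF Hq] VPb same_trans same_sym by metis
        have mq: "m \<noteq> q" using q2 offm by blast
        have Hm: "\<not> inc H m" using line_unique[of H P m q] bt_distinct[OF H(2)] Hq q m mq by metis
        have "same_side m H S2" using bt_same[OF H(2) m(1) Hm] YS2 same_trans by blast
        moreover have Vm: "\<not> inc V m" using line_unique[of V P m p] False V p m offm(1) p1(1) by metis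
        have "same_side m V S1"
          using \<tau>V \<tau>m tail_start[OF m(1) Vm] same_set_eq[OF Vm, of S1] by metis
        ultimately have "opp_side m H V" using oS opp_same_trans opp_sym same_sym by metis
        then obtain D where D: "inc D m" "bt H D V" by (auto simp: opp_side_def)
        have "m \<noteq> m'" using Vm m' by blast
        then have "D = S" using bt_on_line(2)[OF D(2) H(1) m'(1)] D(1) m m' line_unique by metis
        then show False using bt_opp[OF D(2), of b] S bHV same_off unfolding same_side_def by metis
      qed
    qed
    then show ?thesis using \<tau>k \<sigma>k same_set_eq[OF Sk, of X] by simp
  qed
  \<comment> \<open>Behind \<open>P\<close> the claim is reduced to a line \<open>h\<close> through
    \<open>P\<close> avoiding \<open>k\<close>, for which it is already known.\<close>
  have onlyp: "\<tau> k = \<sigma> k" if k: "meets k p" "\<not> meets k b" for k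
  proof -
    obtain V where V: "inc V k" "inc V p" "k \<noteq> p" using k by (auto simp: meets_def)
    show ?thesis
    proof (cases "V = P \<or> \<tau> = tail P V")
      case True
      then show ?thesis using forward[OF k V(1,2)] by blast
    next
      case False
      have kb: "apart k b" using k p(2) unfolding apart_def meets_def by blast
      have Sk: "\<not> inc S k" using kb S apart_point by blast
      have \<sigma>k: "\<sigma> k = {R. same_side k S R}" using dir_apart[OF directions(2) apart_sym[OF kb] S(1)] .
      obtain U where U: "bt V P U" using bt_extend False by metis
      have \<tau>U: "\<tau> = tail P U" using dirs_eq[OF U p(1) V(2)] directions(1) False by blast
      then have \<tau>V: "\<tau> = tail V P" using tail_bt2[OF U] tail_bt1[OF U] by simp
      have Pk: "\<not> inc P k" using line_unique[of P V k p] False V p by metis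
      have \<tau>k: "\<tau> k = {R. same_side k P R}" using tail_start[OF V(1) Pk] \<tau>V by simp
      have "same_side k P S"
      proof (rule ccontr)
        assume "\<not> same_side k P S"
        then have o: "opp_side k P S" using off_cases Pk Sk by blast
        obtain h where h: "inc P h" "apart h k" "h \<noteq> p" using apart_ex[OF Pk, of p] by blast
        have hp: "meets h p" using meets_point h p by blast
        have "\<tau> h = \<sigma> h" using both[OF hp] forward[OF hp _ h(1) p(1)] by blast
        have hs: "same_side k P A" if "inc A h" for A using apart_same[OF h(2,1) that] .
        have bs: "same_side k S A" if "inc A b" for A using apart_same[OF apart_sym[OF kb] S(1) that] .
        have "apart h b"
          using hs bs o same_sym same_trans A2 unfolding apart_def same_side_def by metis
        then have \<sigma>h: "\<sigma> h = {R. same_side h S R}" using dir_apart[OF directions(2) apart_sym S(1)] by blast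
        have Sh: "\<not> inc S h" using \<open>apart h b\<close> S apart_point by blast
        have Vh: "\<not> inc V h" using V h apart_point by blast
        have oVU: "opp_side h V U" using bt_opp[OF U h(1) Vh] .
        have "\<tau> h = {R. same_side h U R}" using \<tau>U tail_start[OF h(1)] oVU opp_off by blast
        then have "same_side h S U" using \<open>\<tau> h = \<sigma> h\<close> \<sigma>h same_set_eq[OF Sh, of U] by metis
        then have "opp_side h V S" using oVU opp_same_trans opp_sym same_sym by metis
        then obtain D where D: "inc D h" "bt V D S" by (auto simp: opp_side_def)
        have "same_side k D S" using bt_same[OF D(2) V(1)] hs[OF D(1)] same_off by blast
        then show False using hs[OF D(1)] o same_trans unfolding same_side_def by metis
      qed
      then show ?thesis using \<tau>k \<sigma>k same_set_eq[OF Pk, of S] by simp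
    qed
  qed
  have "\<tau> k = \<sigma> k" if "meets k p \<or> meets k b" for k
    using that both onlyb onlyp by blast
  then show ?thesis using directions unfolding asymptotic_def \<tau>_def \<sigma>_def by blast
qed

text \<open>The transversal \<open>m\<close> matches the halves of \<open>p\<close> and
  \<open>q\<close> with the two directions of \<open>b\<close>. On each line one half faces
  \<open>b\<close>, and by \<open>crossbar\<close> the two facing halves are on different sides of
  \<open>m\<close>; so one of \<open>p\<close>, \<open>q\<close> serves the direction of
  \<open>S1\<close> and the other that of \<open>S2\<close>.\<close>

lemma asymptotic_exists:
  assumes Pb: "\<not> inc P b" and \<sigma>: "\<sigma> \<in> directions b"
  obtains p \<tau> where "inc P p" "asymptotic p \<tau> b \<sigma>"
proof -
  obtain p q where pq: "p \<noteq> q" "inc P p" "inc P q" "apart p b" "apart q b"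
    "\<And>k. apart k p \<Longrightarrow> apart k q \<Longrightarrow> k = b \<or> apart k b"
    using apart_pair[OF Pb] by metis
  obtain S where S: "inc S b" using A2 by blast
  obtain S1 where S1: "S1 \<noteq> S" "inc S1 b" using second_point[OF S] by blast
  obtain S2 where S2: "bt S1 S S2" using bt_extend[OF S1(1)] by blast
  have S2b: "inc S2 b" using bt_on_line(1)[OF S2 S1(2) S] .
  obtain m where m: "inc P m" "inc S m" using line_ex by blast
  have mb: "m \<noteq> b" using m Pb by blast
  have offS: "\<not> inc S1 m" "\<not> inc S2 m" using line_unique S1 S2b S m mb bt_distinct[OF S2] by metis+
  have oS: "opp_side m S1 S2" using bt_opp[OF S2 m(2) offS(1)] .
  have points: "\<exists>x1 x2. bt x1 P x2 \<and> inc x1 x \<and> inc x2 x \<and> same_side m x1 S1 \<and> same_side m x2 S2"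
    if x: "inc P x" "apart x b" for x
  proof -
    obtain A where A: "inc A x" "A \<noteq> P" using second_point[OF x(1)] by blast
    obtain B where B: "bt A P B" using bt_extend A by blast
    have Bx: "inc B x" using bt_on_line(1)[OF B A(1) x(1)] .
    have "x \<noteq> m" using x m S apart_point by blast
    then have Am: "\<not> inc A m" using line_unique A x m by metis
    have o: "opp_side m A B" using bt_opp[OF B m(1) Am] .
    show ?thesis
    proof (cases "same_side m A S1")
      case True
      then have "same_side m B S2" using o oS opp_opp_same opp_same_trans opp_sym same_sym by metis
      then show ?thesis using True B A Bx by blast
    next
      case False
      then have "opp_side m A S1" using off_cases Am offS by blast
      then have "same_side m A S2" "same_side m B S1"
        using o oS opp_opp_same opp_sym by blast+
      then show ?thesis using bt_sym[OF B] A Bx by blast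
    qed
  qed
  obtain p1 p2 where p12: "bt p1 P p2" "inc p1 p" "inc p2 p" "same_side m p1 S1" "same_side m p2 S2"
    using points pq by blast
  obtain q1 q2 where q12: "bt q1 P q2" "inc q1 q" "inc q2 q" "same_side m q1 S1" "same_side m q2 S2"
    using points pq by blast
  have Soff: "\<not> inc S p" "\<not> inc S q" using S pq apart_point by blast+
  have ne: "p1 \<noteq> P" "p2 \<noteq> P" "q1 \<noteq> P" "q2 \<noteq> P" using p12 q12 bt_distinct by metis+
  have off: "\<not> inc p1 q" "\<not> inc p2 q" "\<not> inc q1 p" "\<not> inc q2 p"
    using line_unique ne p12 q12 pq by metis+
  have "opp_side q p1 p2" "opp_side p q1 q2" using bt_opp[OF p12(1)] bt_opp[OF q12(1)] pq off by blast+
  then have alt: "same_side q p1 S \<or> same_side q p2 S" "same_side p q1 S \<or> same_side p q2 S"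
    using off_cases Soff off opp_opp_same opp_sym by metis+
  have no1: "\<not> (same_side q p1 S \<and> same_side p q1 S)"
  proof
    assume *: "same_side q p1 S \<and> same_side p q1 S"
    have "same_side m p1 q1" using p12 q12 same_sym same_trans by metis
    then show False using crossbar[OF pq(2) m(1) pq(3) p12(2) m(2) q12(2)] * same_sym by metis
  qed
  have no2: "\<not> (same_side q p2 S \<and> same_side p q2 S)"
  proof
    assume *: "same_side q p2 S \<and> same_side p q2 S"
    have "same_side m p2 q2" using p12 q12 same_sym same_trans by metis
    then show False using crossbar[OF pq(2) m(1) pq(3) p12(3) m(2) q12(3)] * same_sym by metis
  qed
  have pair': "\<And>k. apart k q \<Longrightarrow> apart k p \<Longrightarrow> k = b \<or> apart k b" using pq(6) by blast
  have S12: "\<sigma> = tail S S1 \<or> \<sigma> = tail S S2" using dirs_eq[OF S2 S S1(2)] \<sigma> by blast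
  note pair_p = asymptotic_of_pair[OF pq(2,4,3,5,1) pq(6)] and pair_q = asymptotic_of_pair[OF pq(3,5,2,4) pq(1)[symmetric] pair']
  consider "same_side q p1 S" "same_side p q2 S" | "same_side q p2 S" "same_side p q1 S"
    using alt no1 no2 by blast
  then show ?thesis
  proof cases
    case 1
    have "asymptotic p (tail P p1) b (tail S S1)"
      using pair_p[OF _ _ S S1(2) S2 m p12(2) 1(1) p12(4) q12(3) 1(2) q12(5)] by blast
    moreover have "asymptotic q (tail P q2) b (tail S S2)"
      using pair_q[OF _ _ S S2b bt_sym[OF S2] m q12(3) 1(2) q12(5) p12(2) 1(1) p12(4)] by blast
    ultimately show ?thesis using that S12 pq by blast
  next
    case 2
    have "asymptotic p (tail P p2) b (tail S S2)"
      using pair_p[OF _ _ S S2b bt_sym[OF S2] m p12(3) 2(1) p12(5) q12(2) 2(2) q12(4)] by blast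
    moreover have "asymptotic q (tail P q1) b (tail S S1)"
      using pair_q[OF _ _ S S1(2) S2 m q12(2) 2(2) q12(4) p12(3) 2(1) p12(5)] by blast
    ultimately show ?thesis using that S12 pq by blast
  qed
qed

subsection \<open>Parallel rays\<close>

text \<open>Only \<open>A = B\<close> needs an argument: for \<open>X\<close> different from
  \<open>A\<close>, the A5 pair at \<open>A\<close> for a line \<open>k\<close> through
  \<open>X\<close> consists of intersecting lines missing \<open>k\<close>.\<close>

lemma between_iff: "between A X B \<longleftrightarrow> X = A \<or> X = B \<or> bt A X B"
proof
  assume b: "between A X B"
  show "X = A \<or> X = B \<or> bt A X B"
  proof (rule ccontr)
    assume neg: "\<not> ?thesis"
    then have "A = B" "X \<noteq> A" using b by (auto simp: bt_def)
    obtain l where l: "inc A l" "inc X l" using line_ex by blast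
    obtain k where k: "inc X k" "k \<noteq> l" using line_ex_avoiding by blast
    have "\<not> inc A k" using line_unique l k \<open>X \<noteq> A\<close> by metis
    then obtain p q where "p \<noteq> q" "inc A p" "inc A q" "apart p k" "apart q k"
      using apart_pair by metis
    then show False
      using b k(1) \<open>A = B\<close> meets_point[of A p q] meets_sym unfolding between_def apart_iff by metis
  qed
next
  have l: "between A A B" for A B
  proof -
    obtain l where "inc A l" "inc B l" using line_ex by blast
    then show ?thesis
      unfolding between_def collinear_def points_of_def meets_def by blast
  qed
  assume "X = A \<or> X = B \<or> bt A X B"
  then show "between A X B" using l between_sym by (auto simp: bt_def)
qed

lemma mem_ray:
  assumes "A \<noteq> B" "inc A l" "inc B l"
  shows "X \<in> ray A B \<longleftrightarrow> X = A \<or> X \<noteq> A \<and> inc X l \<and> tail A X = tail A B"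
proof -
  have ray: "X \<in> ray A B \<longleftrightarrow> X = A \<or> X = B \<or> bt A X B \<or> bt A B X"
    using assms(1) by (auto simp: ray_def between_iff)
  have "X = B \<or> bt A X B \<or> bt A B X" if X: "X \<noteq> A" "inc X l" "tail A X = tail A B"
  proof (rule ccontr)
    assume "\<not> ?thesis"
    then have "bt X A B" using bt_cases[of X A B l] X assms bt_sym by metis
    then show False using dirs_eq(2)[of X A B l] X assms by blast
  qed
  moreover have "inc X l \<and> tail A X = tail A B" if "bt A X B \<or> bt A B X"
    using that tail_bt1 bt_on_line(1,2) assms by metis
  ultimately show ?thesis using ray assms bt_distinct by metis
qed

lemma ray_on_line:
  assumes "A \<noteq> B" "inc A l" "inc B l" "X \<in> ray A B" shows "inc X l"
  using mem_ray[OF assms(1-3), of X] assms(2,4) by auto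

text \<open>Parallelism is defined for rays as point sets, so the direction must be recoverable from
  the set without its starting point.\<close>

lemma tail_ray_eq:
  assumes "A \<noteq> B" "C \<noteq> D" "ray A B = ray C D"
  shows "tail A B = tail C D"
proof -
  obtain l where l: "inc A l" "inc B l" using line_ex by blast
  obtain m where m: "inc C m" "inc D m" using line_ex by blast
  note r1 = mem_ray[OF assms(1) l] and r2 = mem_ray[OF assms(2) m]
  have "A \<in> ray C D" "B \<in> ray C D" using r1 l assms by auto
  then have "inc A m" "inc B m" using r2 m by auto
  then have "m = l" using line_unique l assms by blast
  show ?thesis
  proof (cases "A = C")
    case True
    then show ?thesis using \<open>B \<in> ray C D\<close> r2 assms by auto
  next
    case False
    have AC: "tail C A = tail C D" using False \<open>A \<in> ray C D\<close> r2 by auto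
    have "C \<in> ray A B" using assms(3) r2 by auto
    then have CA: "tail A C = tail A B" using False r1 by auto
    obtain Y where Y: "bt C A Y" using bt_extend False by metis
    have "Y \<noteq> A" "Y \<noteq> C" "inc Y l" using Y bt_distinct bt_on_line(1) l m \<open>m = l\<close> by metis+
    moreover have "tail C Y = tail C D" using tail_bt1[OF Y] AC by simp
    ultimately have "Y \<in> ray A B" using assms(3) r2 \<open>m = l\<close> by blast
    then have "tail A Y = tail A C" using r1 CA \<open>Y \<noteq> A\<close> by auto
    then show ?thesis using dirs_eq(2)[OF Y l(1)] m \<open>m = l\<close> by simp
  qed
qed

lemma mem_segment: "X \<in> segment A B \<longleftrightarrow> X = A \<or> X = B \<or> bt A X B"
  by (simp add: segment_def between_iff)

text \<open>If \<open>k\<close> meets the ray from \<open>R\<close> beyond \<open>R\<close>, it must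
  cross the segment from \<open>R\<close> to \<open>S\<close>, since it avoids \<open>b\<close>.
  Otherwise a line \<open>h\<close> through \<open>B\<close> avoiding \<open>k\<close> is tested
  instead.\<close>

lemma parallel_half:
  assumes ab: "apart a b" and R: "B \<noteq> R" "inc R a" "inc B a" and S: "D \<noteq> S" "inc S b" "inc D b"
    and H: "\<And>k. hits k (ray R B) \<Longrightarrow> hits k (ray S D) \<or> hits k (segment R S)"
    and ka: "meets k a" and kb: "\<not> meets k b"
  shows "tail R B k = tail S D k"
proof -
  note r = mem_ray[OF R(1)[symmetric] R(2,3)]
  have kb: "apart k b" using ka kb ab unfolding apart_def meets_def by blast
  obtain T where T: "inc T k" "inc T a" "k \<noteq> a" using ka by (auto simp: meets_def)
  have Sk: "\<not> inc S k" using kb S apart_point by blast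
  have \<sigma>k: "tail S D k = {P. same_side k S P}" using tail_apart[OF apart_sym[OF kb] S(2,3) _ S(2)] S(1) by blast
  have sb: "inc X b" if "X \<in> ray S D" for X using ray_on_line[OF S(1)[symmetric] S(2,3) that] .
  have nos: "\<not> hits k (ray S D)" using sb kb apart_point unfolding hits_def by blast
  show ?thesis
  proof (cases "T \<noteq> R \<and> tail R T = tail R B")
    case True
    have Rk: "\<not> inc R k" using line_unique[of R T k a] T R True by blast
    have "T \<in> ray R B" using True T r by blast
    then have "hits k (segment R S)" using H nos T unfolding hits_def by blast
    then have o: "opp_side k R S" using Rk Sk by (auto simp: hits_def mem_segment opp_side_def)
    obtain W where W: "bt R T W" using bt_extend True by metis
    have oW: "opp_side k R W" using bt_opp[OF W T(1) Rk] .
    have "tail R B k = {P. same_side k W P}"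
      using True tail_bt1[OF W] tail_bt2[OF W] tail_start[OF T(1)] oW opp_off by metis
    moreover have "same_side k S W" using o oW opp_opp_same opp_sym by blast
    ultimately show ?thesis using \<sigma>k same_set_eq[OF Sk, of W] by metis
  next
    case False
    have TR: "T = R \<or> bt T R B"
    proof (cases "T = R")
      case f: False
      then have "\<not> bt R T B" "\<not> bt R B T" "T \<noteq> B" using False tail_bt1 by metis+
      then show ?thesis using bt_cases[of T R B a] f T R bt_sym by metis
    qed simp
    have \<tau>: "tail R B = tail T B" using TR tail_bt2 by auto
    have "T \<noteq> B" using TR R bt_distinct by metis
    then have Bk: "\<not> inc B k" using line_unique[of B T k a] T R by blast
    have \<tau>k: "tail R B k = {P. same_side k B P}" using \<tau> tail_start[OF T(1) Bk] by simp
    have "same_side k S B"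
    proof (rule ccontr)
      assume "\<not> same_side k S B"
      then have o: "opp_side k B S" using off_cases Sk Bk opp_sym by blast
      obtain h where h: "inc B h" "apart h k" "h \<noteq> a" using apart_ex[OF Bk, of a] by blast
      have hs: "same_side k B A" if "inc A h" for A using apart_same[OF h(2,1) that] .
      have bs: "same_side k S A" if "inc A b" for A using apart_same[OF apart_sym[OF kb] S(2) that] .
      have hb: "\<not> (inc A h \<and> inc A b)" for A
        using hs bs o same_sym same_trans unfolding same_side_def by metis
      have "\<not> hits h (ray S D)" using sb hb unfolding hits_def by blast
      moreover have "hits h (ray R B)" using r h R unfolding hits_def by blast
      ultimately have "hits h (segment R S)" using H by blast
      moreover have Rh: "\<not> inc R h" using line_unique[of R B h a] R h by blast
      moreover have "\<not> inc S h" using hb S by blast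
      ultimately obtain Q where Q: "inc Q h" "bt R Q S" by (auto simp: hits_def mem_segment)
      have oh: "opp_side h R S" using bt_opp[OF Q(2,1) Rh] .
      obtain Q0 where Q0: "inc Q0 k" "Q0 = R \<or> bt R Q0 S"
      proof (cases "T = R")
        case True
        then show ?thesis using that T by blast
      next
        case False
        then have bt: "bt T R B" using TR by blast
        have Rk: "\<not> inc R k" using line_unique[of R T k a] False T R by blast
        have "same_side k R B" using bt_same[OF bt T(1) Rk] .
        then have "opp_side k R S" using o opp_same_trans opp_sym same_sym by metis
        then show ?thesis using that by (auto simp: opp_side_def)
      qed
      have "same_side h R T"
        using TR bt_same[OF bt_sym h(1) Rh] same_refl[OF Rh] by blast
      then have "same_side h R Q0" using apart_same[OF apart_sym[OF h(2)] T(1) Q0(1)] same_trans by blast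
      then have "opp_side h Q0 S" using oh opp_same_trans by blast
      then obtain Q' where Q': "inc Q' h" "bt Q0 Q' S" by (auto simp: opp_side_def)
      have "same_side k Q' S" using bt_same[OF Q'(2) Q0(1)] hs[OF Q'(1)] same_off by blast
      then show False using hs[OF Q'(1)] o same_trans unfolding same_side_def by metis
    qed
    then show ?thesis using \<sigma>k \<tau>k same_set_eq[OF Sk, of B] by simp
  qed
qed

text \<open>Given a common point \<open>Z\<close>, take a line avoiding \<open>b\<close> through a
  point \<open>T\<close> of the first ray that is neither an endpoint nor an inner point of the
  segment from \<open>R\<close> to \<open>Z\<close>. It would have to cross the segment from
  \<open>R\<close> to \<open>S\<close>, hence also the one from \<open>R\<close> to
  \<open>Z\<close>, at \<open>T\<close>.\<close>

lemma parallel_rays_apart: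
  assumes ab: "a \<noteq> b" and R: "B \<noteq> R" "inc R a" "inc B a" and S: "D \<noteq> S" "inc S b" "inc D b"
    and H: "\<And>k. hits k (ray R B) \<Longrightarrow> hits k (ray S D) \<or> hits k (segment R S)"
  shows "apart a b"
proof (rule ccontr)
  note r = mem_ray[OF R(1)[symmetric] R(2,3)]
  assume "\<not> apart a b"
  then obtain Z where Z: "inc Z a" "inc Z b" using ab not_apartD by blast
  have "\<exists>T. T \<in> ray R B \<and> T \<noteq> R \<and> T \<noteq> Z \<and> \<not> bt R T Z"
  proof (cases "Z = B \<or> bt R B Z")
    case True
    then have "R \<noteq> Z" using R bt_distinct by blast
    then obtain T where T: "bt R Z T" using bt_extend by blast
    have "bt R B T" using True T bt_chain by blast
    then have "T \<in> ray R B" using r tail_bt1 bt_on_line(1) R bt_distinct by metis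
    then show ?thesis using T bt_distinct bt_unique by metis
  next
    case False
    then show ?thesis using r R by blast
  qed
  then obtain T where T: "T \<in> ray R B" "T \<noteq> R" "T \<noteq> Z" "\<not> bt R T Z" by blast
  have Ta: "inc T a" using T r by blast
  then have Tb: "\<not> inc T b" using line_unique T Z ab by metis
  obtain k where k: "inc T k" "apart k b" "k \<noteq> a" using apart_ex[OF Tb] by blast
  have Rk: "\<not> inc R k" using line_unique[of R T k a] T Ta R k by blast
  have Sk: "\<not> inc S k" using S k apart_point by blast
  have "\<not> hits k (ray S D)"
    using ray_on_line[OF S(1)[symmetric] S(2,3)] apart_point[OF k(2)] unfolding hits_def by blast
  then have "hits k (segment R S)" using H T k unfolding hits_def by blast
  then have "opp_side k R S" using Rk Sk by (auto simp: hits_def mem_segment opp_side_def)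
  moreover have "same_side k S Z" using apart_same[OF apart_sym[OF k(2)] S(2) Z(2)] .
  ultimately have "opp_side k R Z" using opp_same_trans opp_sym by blast
  then obtain T' where T': "inc T' k" "bt R T' Z" by (auto simp: opp_side_def)
  have "T' = T" using bt_on_line(2)[OF T'(2) R(2) Z(1)] Ta k T' line_unique by metis
  then show False using T' T by blast
qed

lemma parallel_rays_asym:
  assumes ab: "a \<noteq> b" and R: "B \<noteq> R" "inc R a" "inc B a" and S: "D \<noteq> S" "inc S b" "inc D b"
    and H: "\<And>k. hits k (ray R B) \<Longrightarrow> hits k (ray S D) \<or> hits k (segment R S)"
    and H': "\<And>k. hits k (ray S D) \<Longrightarrow> hits k (ray R B) \<or> hits k (segment R S)"
  shows "asymptotic a (tail R B) b (tail S D)"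
proof -
  note r = mem_ray[OF R(1)[symmetric] R(2,3)] and s = mem_ray[OF S(1)[symmetric] S(2,3)]
  have apab: "apart a b" using parallel_rays_apart[OF ab R S H] .
  have directions: "tail R B \<in> directions a" "tail S D \<in> directions b" using tail_in_dirs R S by metis+
  obtain m where m: "inc R m" "inc S m" using line_ex by blast
  have ma: "m \<noteq> a" "m \<noteq> b" using m R S apab apart_point by blast+
  have off: "\<not> inc B m" "\<not> inc D m" using line_unique m R S ma by metis+
  have mm: "meets m a" "meets m b" using meets_point m R S ma by blast+
  have "same_side m B D"
  proof (rule ccontr)
    assume "\<not> same_side m B D"
    then have o: "opp_side m B D" using off_cases off by blast
    \<comment> \<open>If the rays lay on different sides of \<open>RS\<close>, the line from
      \<open>B\<close> to a point \<open>D'\<close> behind \<open>S\<close> would miss both the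
      second ray and the segment.\<close>
    obtain D' where D': "bt D S D'" using bt_extend S by blast
    have D'b: "inc D' b" using bt_on_line(1)[OF D' S(3,2)] .
    have "opp_side m D D'" using bt_opp[OF D' m(2) off(2)] .
    then have BD': "same_side m B D'" using o opp_opp_same by blast
    obtain k where k: "inc B k" "inc D' k" using line_ex by blast
    have kk: "k \<noteq> a" "k \<noteq> b" using k R D'b apab apart_point by blast+
    have "D' \<noteq> S" using D' bt_distinct by blast
    have offk: "\<not> inc R k" "\<not> inc S k" using line_unique k R S D'b kk \<open>D' \<noteq> S\<close> by metis+
    have "\<not> hits k (ray S D)"
    proof
      assume "hits k (ray S D)"
      then obtain X where X: "X \<in> ray S D" "inc X k" by (auto simp: hits_def)
      have "inc X b" using ray_on_line[OF S(1)[symmetric] S(2,3) X(1)] .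
      then have "X = D'" using X k D'b kk line_unique by metis
      then show False using X(1) s \<open>D' \<noteq> S\<close> dirs_eq(2)[OF D' S(2,3)] by simp
    qed
    moreover have "hits k (ray R B)" using k r R unfolding hits_def by blast
    ultimately have "hits k (segment R S)" using H by blast
    then obtain X where X: "inc X k" "bt R X S" using offk by (auto simp: hits_def mem_segment)
    have Xm: "inc X m" using bt_on_line(2)[OF X(2) m] .
    have Xa: "\<not> inc X a" using line_unique[of X R a m] X(2) Xm m R ma bt_distinct by metis
    have Xb: "\<not> inc X b" using line_unique[of X S b m] X(2) Xm m S ma bt_distinct by metis
    have "same_side a X S" using bt_same[OF X(2) R(2) Xa] .
    then have 1: "same_side a X D'" using apart_same[OF apart_sym[OF apab] S(2) D'b] same_trans by blast
    have "same_side b X R" using bt_same[OF bt_sym[OF X(2)] S(2) Xb] .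
    then have 2: "same_side b X B" using apart_same[OF apab R(2,3)] same_trans by blast
    have "X \<noteq> B" "X \<noteq> D'" "B \<noteq> D'" using Xm off BD' same_off D'b R apab apart_point by blast+
    then consider "bt B X D'" | "bt X B D'" | "bt X D' B"
      using bt_cases[of B X D' k] X k bt_sym by metis
    then show False
    proof cases
      case 1
      then show False using bt_opp[OF 1 Xm off(1)] BD' by (simp add: same_side_def)
    next
      case c: 2
      then show False using bt_opp[OF c R(3) Xa] 1 by (simp add: same_side_def)
    next
      case c: 3
      then show False using bt_opp[OF c D'b Xb] 2 by (simp add: same_side_def)
    qed
  qed
  then have eq: "tail R B m = tail S D m"
    using tail_start[OF m(1) off(1)] tail_start[OF m(2) off(2)] same_set_eq[OF off(1), of D] by simp
  have seg: "hits k (segment R S) \<longleftrightarrow> hits k (segment S R)" for k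
    unfolding hits_def mem_segment using bt_sym by (metis mem_segment)
  have "tail R B k = tail S D k" if k: "meets k a \<or> meets k b" for k
  proof -
    consider "meets k a" "meets k b" | "meets k a" "\<not> meets k b" | "\<not> meets k a" "meets k b"
      using k by blast
    then show ?thesis
    proof cases
      case 1
      then show ?thesis using dir_agree[OF apab directions mm _ _ eq] by blast
    next
      case 2
      then show ?thesis using parallel_half[OF apab R S H] by blast
    next
      case 3
      have "tail S D k = tail R B k"
        by (rule parallel_half[OF apart_sym[OF apab] S R _ 3(2,1)]) (use H' seg in blast)
      then show ?thesis by simp
    qed
  qed
  then show ?thesis using directions unfolding asymptotic_def by blast
qed

text \<open>A line hitting the first ray but missing the segment has \<open>R\<close> and
  \<open>S\<close> on one side and the end of the first ray on the other; if it also missed the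
  second ray, the end of that ray would stay with \<open>S\<close>.\<close>

lemma asymptotic_hits:
  assumes asymptotic: "asymptotic a (tail R B) b (tail S D)" and apab: "apart a b"
    and R: "B \<noteq> R" "inc R a" "inc B a" and S: "D \<noteq> S" "inc S b" "inc D b"
    and hit: "hits k (ray R B)"
  shows "hits k (ray S D) \<or> hits k (segment R S)"
proof (rule ccontr)
  note r = mem_ray[OF R(1)[symmetric] R(2,3)] and s = mem_ray[OF S(1)[symmetric] S(2,3)]
  assume "\<not> ?thesis"
  then have no: "\<not> hits k (ray S D)" "\<not> hits k (segment R S)" by auto
  then have off: "\<not> inc R k" "\<not> inc S k" by (auto simp: hits_def mem_segment)
  have "\<not> opp_side k R S" using no by (auto simp: opp_side_def hits_def mem_segment)
  then have sRS: "same_side k R S" using off by (simp add: same_side_def)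
  obtain T where T: "T \<in> ray R B" "inc T k" using hit by (auto simp: hits_def)
  have Ta: "inc T a" "T \<noteq> R" "tail R T = tail R B" using T off r by auto
  have "k \<noteq> a" using off R by blast
  then have \<tau>\<sigma>: "tail R B k = tail S D k" using asymptotic meets_point T Ta by (metis asymptotic_def)
  obtain W where W: "bt R T W" using bt_extend Ta by metis
  have oW: "opp_side k R W" using bt_opp[OF W T(2) off(1)] .
  have \<tau>k: "tail R B k = {P. same_side k W P}"
    using Ta tail_bt1[OF W] tail_bt2[OF W] tail_start[OF T(2)] oW opp_off by metis
  have "tail S D k = {P. same_side k S P}"
  proof (cases "apart k b")
    case True
    then show ?thesis using tail_apart[OF apart_sym[OF True] S(2,3) _ S(2)] S(1) by blast
  next
    case False
    have "k \<noteq> b" using T Ta apab apart_point by blast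
    then obtain Z where Z: "inc Z k" "inc Z b" using False not_apartD by blast
    have "Z \<notin> ray S D" using no Z by (auto simp: hits_def)
    then have "Z \<noteq> S" "tail S Z \<noteq> tail S D" using s Z by blast+
    then have "\<not> bt S Z D" "\<not> bt S D Z" "Z \<noteq> D" using tail_bt1 by metis+
    then have "bt Z S D" using bt_cases[of Z S D b] \<open>Z \<noteq> S\<close> S Z bt_sym by metis
    then show ?thesis using tail_bt1 tail_bt2 tail_start[OF Z(1) off(2)] by metis
  qed
  then have "same_side k S W" using \<tau>\<sigma> \<tau>k same_set_eq[OF off(2), of W] by simp
  then show False using sRS oW same_trans unfolding same_side_def by blast
qed

lemma asymptotic_parallel_rays:
  assumes asymptotic: "asymptotic a (tail R B) b (tail S D)" and ab: "a \<noteq> b"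
    and R: "B \<noteq> R" "inc R a" "inc B a" and S: "D \<noteq> S" "inc S b" "inc D b"
  shows "parallel_rays (ray R B) (ray S D)"
proof -
  have apab: "apart a b" using asymptotic_lines[OF asymptotic] ab by blast
  note r = mem_ray[OF R(1)[symmetric] R(2,3)] and s = mem_ray[OF S(1)[symmetric] S(2,3)]
  have "\<not> collinear (ray R B \<union> ray S D)"
  proof
    assume "collinear (ray R B \<union> ray S D)"
    then obtain l where l: "ray R B \<union> ray S D \<subseteq> points_of l" by (auto simp: collinear_def)
    have "R \<in> ray R B" "B \<in> ray R B" "S \<in> ray S D" using r s R by auto
    then have "inc R l" "inc B l" "inc S l" using l by (auto simp: points_of_def)
    then have "l = a" using line_unique R by blast
    then show False using \<open>inc S l\<close> S apab apart_point by blast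
  qed
  moreover have "ray_from R (ray R B)" "ray_from S (ray S D)"
    using R S by (auto simp: ray_from_def)
  moreover have "hits k (ray R B) \<Longrightarrow> hits k (ray S D) \<or> hits k (segment R S)" for k
    using asymptotic_hits[OF asymptotic apab R S] .
  moreover have "hits k (ray S D) \<Longrightarrow> hits k (ray R B) \<or> hits k (segment S R)" for k
    using asymptotic_hits[OF asymptotic_sym[OF asymptotic] apart_sym[OF apab] S R] .
  moreover have "hits k (segment S R) \<Longrightarrow> hits k (segment R S)" for k
    unfolding hits_def using bt_sym mem_segment by metis
  ultimately show ?thesis unfolding parallel_rays_def by blast
qed

lemma parallel_raysE:
  assumes par: "parallel_rays r s" and sub: "r \<subseteq> points_of a" "s \<subseteq> points_of b"
  obtains R B S D where "r = ray R B" "s = ray S D" "B \<noteq> R" "inc R a" "inc B a"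
    "D \<noteq> S" "inc S b" "inc D b" "asymptotic a (tail R B) b (tail S D)" "a \<noteq> b"
proof -
  obtain R S where RS: "\<not> collinear (r \<union> s)" "ray_from R r" "ray_from S s"
    "\<forall>k. (hits k r \<longrightarrow> hits k s \<or> hits k (segment R S)) \<and> (hits k s \<longrightarrow> hits k r \<or> hits k (segment R S))"
    using par unfolding parallel_rays_def by blast
  obtain B D where BD: "B \<noteq> R" "r = ray R B" "D \<noteq> S" "s = ray S D"
    using RS by (auto simp: ray_from_def)
  have "R \<in> ray R B" "B \<in> ray R B" "S \<in> ray S D" "D \<in> ray S D"
    by (auto simp: ray_def between_iff)
  then have inc: "inc R a" "inc B a" "inc S b" "inc D b"
    using sub BD by (auto simp: points_of_def)
  have "a \<noteq> b" using RS(1) sub by (auto simp: collinear_def)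
  moreover from this have "asymptotic a (tail R B) b (tail S D)"
    by (rule parallel_rays_asym[OF _ BD(1) inc(1,2) BD(3) inc(3,4)]) (use RS(4) BD in auto)
  ultimately show ?thesis using that BD inc by blast
qed

lemma parallel_iff: "parallel a b \<longleftrightarrow> a \<noteq> b \<and> (\<exists>\<tau> \<sigma>. asymptotic a \<tau> b \<sigma>)"
proof
  assume "parallel a b"
  then show "a \<noteq> b \<and> (\<exists>\<tau> \<sigma>. asymptotic a \<tau> b \<sigma>)"
    unfolding parallel_def using parallel_raysE by metis
next
  assume "a \<noteq> b \<and> (\<exists>\<tau> \<sigma>. asymptotic a \<tau> b \<sigma>)"
  then obtain \<tau> \<sigma> where *: "a \<noteq> b" "asymptotic a \<tau> b \<sigma>" by blast
  then obtain R B S D where RB: "R \<noteq> B" "inc R a" "inc B a" "\<tau> = tail R B"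
    and SD: "S \<noteq> D" "inc S b" "inc D b" "\<sigma> = tail S D"
    by (auto simp: asymptotic_def directions_def)
  have "ray R B \<subseteq> points_of a" "ray S D \<subseteq> points_of b"
    using mem_ray[OF RB(1-3)] mem_ray[OF SD(1-3)] RB SD by (auto simp: points_of_def)
  moreover have "parallel_rays (ray R B) (ray S D)"
    using asymptotic_parallel_rays[of a R B b S D] * RB SD by blast
  ultimately show "parallel a b" unfolding parallel_def by blast
qed

lemma parallel_to_ray_asym:
  assumes "parallel_to_ray l (ray A B)" "A \<noteq> B" "inc A a" "inc B a"
  shows "\<exists>\<rho>. asymptotic l \<rho> a (tail A B)"
proof -
  obtain s where s: "s \<subseteq> points_of l" "parallel_rays s (ray A B)"
    using assms(1) by (auto simp: parallel_to_ray_def)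
  have "ray A B \<subseteq> points_of a" using mem_ray[OF assms(2-4)] assms by (auto simp: points_of_def)
  then obtain R C S D where "ray A B = ray S D" "D \<noteq> S" "asymptotic l (tail R C) a (tail S D)"
    using parallel_raysE[OF s(2,1)] by metis
  then show ?thesis using tail_ray_eq assms(2) by metis
qed

subsection \<open>Ends and rimpoints\<close>

text \<open>An end is represented by the set of all lines through it.\<close>

definition pencil :: "'l \<Rightarrow> ('l \<Rightarrow> 'p set) \<Rightarrow> 'l set" where
  "pencil a \<tau> = {l. \<exists>\<rho>. asymptotic l \<rho> a \<tau>}"

definition ends :: "'l set set" where
  "ends = {pencil a \<tau> |a \<tau>. \<tau> \<in> directions a}"

definition line_pairs :: "'l set \<Rightarrow> ('l \<times> 'l) set" where
  "line_pairs E = {(a, b). a \<in> E \<and> b \<in> E \<and> a \<noteq> b}"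

lemma pencil_eq: "asymptotic a \<tau> b \<sigma> \<Longrightarrow> pencil a \<tau> = pencil b \<sigma>"
  unfolding pencil_def using asymptotic_trans asymptotic_sym by blast

lemma pencil_in_ends: "\<tau> \<in> directions a \<Longrightarrow> pencil a \<tau> \<in> ends"
  by (auto simp: ends_def)

lemma mem_pencil: "\<tau> \<in> directions a \<Longrightarrow> a \<in> pencil a \<tau>"
  using asymptotic_refl by (auto simp: pencil_def)

lemma end_dir:
  assumes "E \<in> ends" "l \<in> E"
  obtains \<tau> where "\<tau> \<in> directions l" "E = pencil l \<tau>"
proof -
  obtain a \<sigma> \<tau> where "E = pencil a \<sigma>" "asymptotic l \<tau> a \<sigma>"
    using assms by (auto simp: ends_def pencil_def)
  then show ?thesis using that pencil_eq by (metis asymptotic_def)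
qed

text \<open>If both directions of \<open>a\<close> had the same pencil, a line through a point off
  \<open>a\<close> would be asymptotic to \<open>a\<close> in both, which
  \<open>asymptotic_unique_line\<close> forbids.\<close>

lemma asymptotic_of_pencil:
  assumes "\<tau> \<in> directions a" "\<sigma> \<in> directions b" "pencil a \<tau> = pencil b \<sigma>"
  shows "asymptotic a \<tau> b \<sigma>"
proof -
  have "a \<in> pencil b \<sigma>" using mem_pencil assms by blast
  then obtain \<rho> where \<rho>: "asymptotic a \<rho> b \<sigma>" by (auto simp: pencil_def)
  have "\<rho> = \<tau>"
  proof (rule ccontr)
    assume ne: "\<rho> \<noteq> \<tau>"
    obtain P where P: "\<not> inc P a" using point_off by blast
    have d: "\<rho> \<in> directions a" using \<rho> by (auto simp: asymptotic_def)
    obtain p \<omega> where p: "inc P p" "asymptotic p \<omega> a \<rho>" using asymptotic_exists[OF P d] .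
    have "p \<in> pencil a \<tau>" using p(2) \<rho> assms(3) pencil_eq unfolding pencil_def by blast
    then obtain \<omega>' where \<omega>': "asymptotic p \<omega>' a \<tau>" by (auto simp: pencil_def)
    have "\<omega> \<noteq> \<omega>'"
    proof
      assume "\<omega> = \<omega>'"
      then have "asymptotic a \<rho> a \<tau>" using asymptotic_trans[OF asymptotic_sym[OF p(2)]] \<omega>' by blast
      then show False using asymptotic_same_line ne by blast
    qed
    then have "p = a" using asymptotic_unique_line p(2) \<omega>' by blast
    then show False using p P by blast
  qed
  then show ?thesis using \<rho> by blast
qed

lemma end_asym:
  assumes "E \<in> ends" "a \<in> E" "b \<in> E"
  obtains \<tau> \<sigma> where "asymptotic a \<tau> b \<sigma>" "E = pencil a \<tau>" "E = pencil b \<sigma>"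
  using end_dir[OF assms(1,2)] end_dir[OF assms(1,3)] asymptotic_of_pencil by metis

lemma end_apart: "\<lbrakk>E \<in> ends; a \<in> E; b \<in> E\<rbrakk> \<Longrightarrow> a = b \<or> apart a b"
  using end_asym asymptotic_lines by metis

lemma end_line_ex:
  assumes "E \<in> ends" shows "\<exists>l\<in>E. inc P l"
proof -
  obtain a \<tau> where a: "E = pencil a \<tau>" "\<tau> \<in> directions a" using assms by (auto simp: ends_def)
  show ?thesis
  proof (cases "inc P a")
    case True
    then show ?thesis using a mem_pencil by blast
  next
    case False
    then obtain p \<rho> where "inc P p" "asymptotic p \<rho> a \<tau>" using asymptotic_exists a by metis
    then show ?thesis using a by (auto simp: pencil_def)
  qed
qed

lemma end_line_unique: "\<lbrakk>E \<in> ends; l \<in> E; m \<in> E; inc P l; inc P m\<rbrakk> \<Longrightarrow> l = m"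
  using end_apart apart_point by blast

lemma end_eq:
  assumes "E \<in> ends" "F \<in> ends" "a \<in> E" "b \<in> E" "a \<in> F" "b \<in> F" "a \<noteq> b"
  shows "E = F"
proof -
  obtain \<tau> \<sigma> where 1: "asymptotic a \<tau> b \<sigma>" "E = pencil a \<tau>" using end_asym assms by metis
  obtain \<tau>' \<sigma>' where 2: "asymptotic a \<tau>' b \<sigma>'" "F = pencil a \<tau>'" using end_asym assms by metis
  have "\<tau> = \<tau>'" using asymptotic_unique_line[OF 1(1) 2(1)] assms by blast
  then show ?thesis using 1 2 by simp
qed

lemma line_ends:
  obtains E F where "E \<in> ends" "F \<in> ends" "E \<noteq> F" "l \<in> E" "l \<in> F"
    "\<And>G. G \<in> ends \<Longrightarrow> l \<in> G \<Longrightarrow> G = E \<or> G = F"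
proof -
  obtain Z where Z: "inc Z l" using A2 by blast
  obtain A where A: "inc A l" "A \<noteq> Z" using second_point[OF Z] by blast
  obtain B where B: "bt A Z B" using bt_extend A by blast
  note d = dirs_eq[OF B Z A(1)]
  have din: "tail Z A \<in> directions l" "tail Z B \<in> directions l" using d by auto
  have ne: "pencil l (tail Z A) \<noteq> pencil l (tail Z B)"
  proof
    assume "pencil l (tail Z A) = pencil l (tail Z B)"
    then have "asymptotic l (tail Z A) l (tail Z B)" using asymptotic_of_pencil din by blast
    then show False using asymptotic_same_line d by blast
  qed
  have "G = pencil l (tail Z A) \<or> G = pencil l (tail Z B)" if "G \<in> ends" "l \<in> G" for G
    using end_dir[OF that] d by (metis insertE singletonD)
  then show ?thesis
    using that[OF pencil_in_ends[OF din(1)] pencil_in_ends[OF din(2)] ne mem_pencil[OF din(1)]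
        mem_pencil[OF din(2)]] by blast
qed

text \<open>The definition of a rimpoint asks for a third line. The lines of \<open>E\<close>
  through two points \<open>C\<close>, \<open>D\<close> off \<open>a\<close> provide one unless both
  equal \<open>b\<close>; then a point off \<open>a\<close> and \<open>b\<close> does.\<close>

lemma third_line:
  assumes "E \<in> ends" shows "\<exists>l\<in>E. l \<noteq> a \<and> l \<noteq> b"
proof -
  obtain A where A: "inc A a" using A2 by blast
  obtain g where g: "inc A g" "g \<noteq> a" using line_ex_avoiding by blast
  obtain C where C: "inc C g" "C \<noteq> A" using second_point[OF g(1)] by blast
  obtain D where D: "bt A C D" using bt_extend C by metis
  have Dg: "inc D g" using bt_on_line(1)[OF D g(1) C(1)] .
  have off: "\<not> inc C a" "\<not> inc D a" using line_unique g A C D Dg bt_distinct by metis+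
  obtain c where c: "c \<in> E" "inc C c" using end_line_ex assms by blast
  obtain d where d: "d \<in> E" "inc D d" using end_line_ex assms by blast
  show ?thesis
  proof (cases "c = b \<and> d = b")
    case True
    then have "b = g" using line_unique[of C D b g] c d C Dg bt_distinct[OF D] by blast
    obtain P where P: "\<not> inc P a" "\<not> inc P b"
    proof -
      obtain m where m: "inc C m" "m \<noteq> g" using line_ex_avoiding by blast
      obtain Q where Q: "inc Q m" "Q \<noteq> C" using second_point[OF m(1)] by blast
      obtain Q' where Q': "bt C Q Q'" using bt_extend Q by metis
      have Q'm: "inc Q' m" using bt_on_line(1)[OF Q' m(1) Q(1)] .
      have "\<not> inc Q b" "\<not> inc Q' b"
        using line_unique[of Q C m g] line_unique[of Q' C m g] m C Q Q'm bt_distinct[OF Q'] \<open>b = g\<close> by blast+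
      moreover have "\<not> (inc Q a \<and> inc Q' a)"
        using line_unique[of Q Q' m a] bt_distinct[OF Q'] Q Q'm m(1) off(1) by blast
      ultimately show ?thesis using that by blast
    qed
    obtain p where "p \<in> E" "inc P p" using end_line_ex assms by blast
    then show ?thesis using P by (intro bexI[of _ p]) auto
  next
    case False
    then show ?thesis using c d off by metis
  qed
qed

lemma half_planes_le_2:
  assumes "\<tau> \<in> directions a" "\<sigma> \<in> directions b" "\<rho> \<in> directions c" "t \<noteq> a" "t \<noteq> b" "t \<noteq> c"
  shows "\<tau> t = \<sigma> t \<or> \<sigma> t = \<rho> t \<or> \<tau> t = \<rho> t"
proof -
  obtain P where P: "\<not> inc P t" "\<tau> t = {R. same_side t P R}" using dir_side[OF assms(1,4)] .
  obtain Q where Q: "\<not> inc Q t" "\<sigma> t = {R. same_side t Q R}" using dir_side[OF assms(2,5)] .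
  obtain R where R: "\<not> inc R t" "\<rho> t = {X. same_side t R X}" using dir_side[OF assms(3,6)] .
  have "same_side t P Q \<or> same_side t Q R \<or> same_side t P R"
    using P Q R off_cases opp_opp_same by metis
  then show ?thesis using P Q R same_set_eq by metis
qed

lemma dirs_differ:
  assumes "\<tau> \<in> directions l" "\<tau>' \<in> directions l" "\<tau> \<noteq> \<tau>'" "meets k l" shows "\<tau> k \<noteq> \<tau>' k"
proof
  assume eq: "\<tau> k = \<tau>' k"
  obtain Z where Z: "inc Z k" "inc Z l" "k \<noteq> l" using assms(4) by (auto simp: meets_def)
  obtain A where A: "A \<noteq> Z" "inc A l" "\<tau> = tail Z A" using dir_from[OF assms(1) Z(2)] .
  obtain B where B: "B \<noteq> Z" "inc B l" "\<tau>' = tail Z B" using dir_from[OF assms(2) Z(2)] .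
  have off: "\<not> inc A k" "\<not> inc B k" using line_unique A B Z by metis+
  have "same_side k A B"
    using eq A(3) B(3) tail_start[OF Z(1) off(1)] tail_start[OF Z(1) off(2)]
      same_set_eq[OF off(1), of B] by simp
  then show False using tail_same[OF Z(1,2) A(2) B(2)] A B assms(3) by simp
qed

text \<open>Otherwise each line joining points of two of \<open>a\<close>, \<open>b\<close>,
  \<open>l\<close> misses the third, and \<open>ab\<close>, \<open>a\<close>, \<open>al\<close>
  violate \<open>crossbar\<close> at \<open>A\<close>.\<close>

lemma common_transversal_end:
  assumes E: "E \<in> ends" "a \<in> E" "b \<in> E" "l \<in> E" and ne: "a \<noteq> b" "a \<noteq> l" "b \<noteq> l"
  shows "common_transversal a b l"
proof (rule ccontr)
  assume neg: "\<not> ?thesis"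
  obtain A where A: "inc A a" using A2 by blast
  obtain B where B: "inc B b" using A2 by blast
  obtain L where L: "inc L l" using A2 by blast
  have ap: "apart a b" "apart a l" "apart b l" using end_apart E ne by blast+
  obtain ab al bl where lines: "inc A ab" "inc B ab" "inc A al" "inc L al" "inc B bl" "inc L bl"
    using line_ex by metis
  have no: "\<not> (meets t a \<and> meets t b \<and> meets t l)" for t
    using neg unfolding common_transversal_def by blast
  have offa: "\<not> inc B a" "\<not> inc L a" "\<not> inc A b" "\<not> inc L b" "\<not> inc A l" "\<not> inc B l"
    using A B L ap apart_point by blast+
  have m: "meets ab a" "meets ab b" "meets al a" "meets al l" "meets bl b" "meets bl l"
    using meets_point lines A B L offa by metis+
  have ne': "ab \<noteq> l" "al \<noteq> b" "bl \<noteq> a" using lines offa by blast+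
  have ap': "apart l ab" "apart b al" "apart a bl"
    using no[of ab] no[of al] no[of bl] m ne' meets_sym unfolding apart_iff by metis+
  obtain \<tau> \<sigma> where 1: "asymptotic a \<tau> b \<sigma>" "E = pencil a \<tau>" using end_asym E by metis
  obtain \<tau>' \<rho> where 2: "asymptotic a \<tau>' l \<rho>" "E = pencil a \<tau>'" using end_asym[OF E(1,2,4)] by metis
  have d: "\<tau> \<in> directions a" "\<sigma> \<in> directions b" "\<rho> \<in> directions l" "\<tau>' \<in> directions a" using 1 2 by (auto simp: asymptotic_def)
  have "asymptotic a \<tau> a \<tau>'" using asymptotic_of_pencil[OF d(1,4)] 1 2 by simp
  then have al: "asymptotic a \<tau> l \<rho>" using asymptotic_same_line 2 by blast
  obtain X where X: "X \<noteq> A" "inc X a" "\<tau> = tail A X" using dir_from[OF d(1) A] .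
  have Xoff: "\<not> inc X ab" "\<not> inc X al"
    using line_unique[of X A ab a] line_unique[of X A al a] X A lines offa by metis+
  have "\<tau> ab = \<rho> ab" using al m by (auto simp: asymptotic_def)
  then have s1: "same_side ab L X"
    using dir_apart[OF d(3) ap'(1) L] tail_start[OF lines(1) Xoff(1)] X(3)
      same_set_eq[OF Xoff(1), of L] same_sym by metis
  have "\<tau> al = \<sigma> al" using 1 m by (auto simp: asymptotic_def)
  then have s2: "same_side al B X"
    using dir_apart[OF d(2) ap'(2) B] tail_start[OF lines(3) Xoff(2)] X(3)
      same_set_eq[OF Xoff(2), of B] same_sym by metis
  have "\<not> opp_side a B L"
  proof
    assume "opp_side a B L"
    then obtain D where D: "inc D a" "bt B D L" by (auto simp: opp_side_def)
    have "inc D bl" using bt_on_line(2)[OF D(2)] lines by blast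
    then show False using D ap'(3) apart_point by blast
  qed
  then have s3: "same_side a B L" using off_cases offa by blast
  show False using crossbar[OF lines(1) A lines(3) lines(2) X(2) lines(4)] s1 s2 s3 same_sym by blast
qed

section \<open>Parallel lines and rimpoints in terms of ends\<close>

lemma parallel_ends: "parallel a b \<longleftrightarrow> a \<noteq> b \<and> (\<exists>E\<in>ends. a \<in> E \<and> b \<in> E)"
proof -
  have "(\<exists>E\<in>ends. a \<in> E \<and> b \<in> E)" if "asymptotic a \<tau> b \<sigma>" for \<tau> \<sigma>
    using that pencil_in_ends[of \<tau> a] mem_pencil[of \<tau> a] mem_pencil[of \<sigma> b] pencil_eq[OF that]
    unfolding asymptotic_def by blast
  moreover have "\<exists>\<tau> \<sigma>. asymptotic a \<tau> b \<sigma>" if "E \<in> ends" "a \<in> E" "b \<in> E" for E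
    using end_asym that by metis
  ultimately show ?thesis unfolding parallel_iff by blast
qed

text \<open>Otherwise \<open>a\<close>, \<open>b\<close>, \<open>l\<close> are the sides of an ideal
  triangle, and a line meeting all three would put its three corners pairwise on different
  sides.\<close>

lemma end_of_transversal:
  assumes E: "E \<in> ends" "a \<in> E" "b \<in> E" "a \<noteq> b"
    and par: "parallel l a" "parallel l b" and t: "common_transversal a b l"
  shows "l \<in> E"
proof (rule ccontr)
  assume lE: "l \<notin> E"
  obtain F G where F: "F \<in> ends" "l \<in> F" "a \<in> F" and G: "G \<in> ends" "l \<in> G" "b \<in> G"
    using par by (auto simp: parallel_ends)
  obtain t where t: "meets t a" "meets t b" "meets t l" using t by (auto simp: common_transversal_def)
  have "F \<noteq> E" "G \<noteq> E" using F G lE by blast+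
  have "F \<noteq> G" using end_eq[OF F(1) E(1) F(3) _ E(2,3,4)] G(3) \<open>F \<noteq> E\<close> by blast
  obtain \<alpha> \<beta> where 1: "asymptotic a \<alpha> b \<beta>" "E = pencil a \<alpha>" "E = pencil b \<beta>" using end_asym[OF E(1-3)] .
  obtain \<alpha>' \<gamma> where 2: "asymptotic a \<alpha>' l \<gamma>" "F = pencil a \<alpha>'" "F = pencil l \<gamma>" using end_asym[OF F(1,3,2)] .
  obtain \<beta>' \<gamma>' where 3: "asymptotic b \<beta>' l \<gamma>'" "G = pencil b \<beta>'" "G = pencil l \<gamma>'" using end_asym[OF G(1,3,2)] .
  have d: "\<alpha> \<in> directions a" "\<beta> \<in> directions b" "\<alpha>' \<in> directions a" "\<gamma> \<in> directions l" "\<beta>' \<in> directions b" "\<gamma>' \<in> directions l"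
    using 1 2 3 by (auto simp: asymptotic_def)
  have "\<alpha> t \<noteq> \<alpha>' t" using dirs_differ[OF d(1,3) _ t(1)] 1 2 \<open>F \<noteq> E\<close> by blast
  moreover have "\<beta> t \<noteq> \<beta>' t" using dirs_differ[OF d(2,5) _ t(2)] 1 3 \<open>G \<noteq> E\<close> by blast
  moreover have "\<gamma> t \<noteq> \<gamma>' t" using dirs_differ[OF d(4,6) _ t(3)] 2 3 \<open>F \<noteq> G\<close> by blast
  moreover have "\<alpha> t = \<beta> t" "\<alpha>' t = \<gamma> t" "\<beta>' t = \<gamma>' t" using 1 2 3 t by (auto simp: asymptotic_def)
  moreover have "t \<noteq> a" "t \<noteq> b" "t \<noteq> l" using t by (auto simp: meets_def)
  ultimately show False using half_planes_le_2[OF d(1,4,5), of t] by simp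
qed

lemma pair_on_iff:
  assumes E: "E \<in> ends" "a \<in> E" "b \<in> E" "a \<noteq> b"
  shows "pair_on (a, b) l \<longleftrightarrow> l \<in> E"
  using end_of_transversal[OF E] common_transversal_end[OF E(1-3)] E
  unfolding pair_on_def parallel_ends by blast

lemma rim_pairs_iff: "(a, b) \<in> rim_pairs \<longleftrightarrow> a \<noteq> b \<and> (\<exists>E\<in>ends. a \<in> E \<and> b \<in> E)"
proof
  assume "(a, b) \<in> rim_pairs"
  then show "a \<noteq> b \<and> (\<exists>E\<in>ends. a \<in> E \<and> b \<in> E)"
    by (auto simp: rim_pairs_def parallel_ends)
next
  assume "a \<noteq> b \<and> (\<exists>E\<in>ends. a \<in> E \<and> b \<in> E)"
  then obtain E where E: "a \<noteq> b" "E \<in> ends" "a \<in> E" "b \<in> E" by blast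
  obtain l where l: "l \<in> E" "l \<noteq> a" "l \<noteq> b" using third_line[OF E(2)] by blast
  then have "common_transversal a b l" using common_transversal_end E by blast
  then show "(a, b) \<in> rim_pairs"
    using E l by (auto simp: rim_pairs_def parallel_ends)
qed

lemma same_rimpoint_iff:
  "((a, b), (c, d)) \<in> same_rimpoint \<longleftrightarrow>
    (\<exists>E\<in>ends. (a, b) \<in> line_pairs E \<and> (c, d) \<in> line_pairs E)"
proof
  assume *: "((a, b), (c, d)) \<in> same_rimpoint"
  then have "(a, b) \<in> rim_pairs" "(c, d) \<in> rim_pairs" by (auto simp: same_rimpoint_def)
  then obtain E where "c \<noteq> d" "a \<noteq> b" "E \<in> ends" "a \<in> E" "b \<in> E" by (auto simp: rim_pairs_iff)
  moreover have "pair_on (a, b) c" "pair_on (a, b) d" using * by (auto simp: same_rimpoint_def)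
  ultimately show "\<exists>E\<in>ends. (a, b) \<in> line_pairs E \<and> (c, d) \<in> line_pairs E"
    using pair_on_iff by (auto simp: line_pairs_def)
next
  assume "\<exists>E\<in>ends. (a, b) \<in> line_pairs E \<and> (c, d) \<in> line_pairs E"
  then obtain E where E: "E \<in> ends" "a \<in> E" "b \<in> E" "c \<in> E" "d \<in> E" "a \<noteq> b" "c \<noteq> d"
    by (auto simp: line_pairs_def)
  have "pairwise parallel {a, b, c, d}"
    unfolding pairwise_def parallel_ends using E by blast
  moreover have "(a, b) \<in> rim_pairs" "(c, d) \<in> rim_pairs" using E by (auto simp: rim_pairs_iff)
  ultimately show "((a, b), (c, d)) \<in> same_rimpoint"
    using pair_on_iff[OF E(1,2,3,6)] pair_on_iff[OF E(1,4,5,7)] E by (auto simp: same_rimpoint_def)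
qed

lemma line_pairs_eq: "\<lbrakk>E \<in> ends; F \<in> ends; x \<in> line_pairs E; x \<in> line_pairs F\<rbrakk> \<Longrightarrow> E = F"
  using end_eq by (auto simp: line_pairs_def)

lemma same_rimpoint_class:
  assumes "E \<in> ends" "x \<in> line_pairs E"
  shows "same_rimpoint `` {x} = line_pairs E"
proof -
  have iff: "(x, y) \<in> same_rimpoint \<longleftrightarrow> (\<exists>F\<in>ends. x \<in> line_pairs F \<and> y \<in> line_pairs F)" for y
    by (cases x, cases y) (simp only: same_rimpoint_iff)
  have "(x, y) \<in> same_rimpoint \<longleftrightarrow> y \<in> line_pairs E" for y
    unfolding iff using assms line_pairs_eq[OF _ assms(1) _ assms(2)] by metis
  then show ?thesis by blast
qed

lemma line_pairs_nonempty: "E \<in> ends \<Longrightarrow> \<exists>x. x \<in> line_pairs E"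
  using third_line unfolding line_pairs_def by (metis (mono_tags, lifting) case_prodI mem_Collect_eq)

lemma rimpoints_eq: "rimpoints = line_pairs ` ends"
proof -
  have rp: "x \<in> rim_pairs \<longleftrightarrow> (\<exists>E\<in>ends. x \<in> line_pairs E)" for x
    by (cases x) (simp add: rim_pairs_iff line_pairs_def, blast)
  show ?thesis
  proof
    show "rimpoints \<subseteq> line_pairs ` ends"
      unfolding rimpoints_def quotient_def using rp same_rimpoint_class by blast
    show "line_pairs ` ends \<subseteq> rimpoints"
    proof
      fix X assume "X \<in> line_pairs ` ends"
      then obtain E where E: "E \<in> ends" "X = line_pairs E" by blast
      obtain x where x: "x \<in> line_pairs E" using line_pairs_nonempty E by blast
      then have "x \<in> rim_pairs" using rp E by blast
      then show "X \<in> rimpoints"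
        unfolding rimpoints_def using same_rimpoint_class[OF E(1) x] E(2) quotientI by metis
    qed
  qed
qed

lemma line_pairs_inj: "inj_on line_pairs ends"
  using line_pairs_eq line_pairs_nonempty by (intro inj_onI) metis

lemma rim_on_iff: "E \<in> ends \<Longrightarrow> rim_on (line_pairs E) l \<longleftrightarrow> l \<in> E"
  using line_pairs_nonempty[of E] pair_on_iff[of E] unfolding rim_on_def line_pairs_def by fastforce

text \<open>The second alternative of A6 is harmless: there one of the two chosen lines itself
  passes through both ends.\<close>

lemma ends_join:
  assumes E: "E \<in> ends" and F: "F \<in> ends" and "E \<noteq> F"
  shows "\<exists>l. l \<in> E \<and> l \<in> F"
proof -
  obtain a \<tau> where a: "E = pencil a \<tau>" "\<tau> \<in> directions a" using E by (auto simp: ends_def)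
  show ?thesis
  proof (cases "a \<in> F")
    case True
    then show ?thesis using a mem_pencil by blast
  next
    case False
    obtain S where S: "\<not> inc S a" using point_off by blast
    obtain b where b: "b \<in> F" "inc S b" using end_line_ex F by blast
    obtain \<sigma> where \<sigma>: "\<sigma> \<in> directions b" "F = pencil b \<sigma>" using end_dir[OF F b(1)] .
    obtain R B where RB: "R \<noteq> B" "inc R a" "inc B a" "\<tau> = tail R B" using a by (auto simp: directions_def)
    obtain S' D where SD: "S' \<noteq> D" "inc S' b" "inc D b" "\<sigma> = tail S' D" using \<sigma> by (auto simp: directions_def)
    have r: "is_ray (ray R B)" "is_ray (ray S' D)"
      using RB SD unfolding is_ray_def ray_from_def by metis+
    have mem: "R \<in> ray R B" "B \<in> ray R B" "S' \<in> ray S' D" "D \<in> ray S' D"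
      by (auto simp: ray_def between_iff)
    have on: "m = a" if "ray R B \<subseteq> points_of m" for m
    proof -
      have "inc R m" "inc B m" using that mem by (auto simp: points_of_def)
      then show ?thesis using line_unique RB by blast
    qed
    have on': "m = b" if "ray S' D \<subseteq> points_of m" for m
    proof -
      have "inc S' m" "inc D m" using that mem by (auto simp: points_of_def)
      then show ?thesis using line_unique SD by blast
    qed
    have "a \<noteq> b" using S b by blast
    then have "\<not> collinear (ray R B \<union> ray S' D)" using on on' by (auto simp: collinear_def)
    then obtain l where l: "parallel_to_ray l (ray R B) \<and> parallel_to_ray l (ray S' D) \<or>
      ray R B \<subseteq> points_of l \<and> parallel_to_ray l (ray S' D) \<or>
      ray S' D \<subseteq> points_of l \<and> parallel_to_ray l (ray R B)"
      using A6[OF r] by blast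
    have 1: "l \<in> E" if "parallel_to_ray l (ray R B)"
      using parallel_to_ray_asym[OF that RB(1-3)] RB a by (auto simp: pencil_def)
    have 2: "l \<in> F" if "parallel_to_ray l (ray S' D)"
      using parallel_to_ray_asym[OF that SD(1-3)] SD \<sigma> by (auto simp: pencil_def)
    have "a \<in> E" using mem_pencil a by blast
    then show ?thesis using l 1 2 on on' b by blast
  qed
qed

subsection \<open>Half-turns\<close>

text \<open>For an end \<open>E\<close> and \<open>k\<close> outside \<open>E\<close>, all lines of
  the pencil give the same half-plane of \<open>k\<close>. For \<open>k\<close> in \<open>E\<close>
  no line of the pencil meets \<open>k\<close>, and the value is empty.\<close>

definition end_side :: "'l set \<Rightarrow> 'l \<Rightarrow> 'p set" where
  "end_side E k = {P. \<exists>l \<tau>. \<tau> \<in> directions l \<and> pencil l \<tau> = E \<and> meets k l \<and> P \<in> \<tau> k}"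

definition turn :: "'p \<Rightarrow> 'l set \<Rightarrow> 'l set" where
  "turn P E = (THE F. F \<in> ends \<and> F \<noteq> E \<and> (\<exists>l. inc P l \<and> l \<in> E \<and> l \<in> F))"

lemma meets_not_in_end: "\<lbrakk>E \<in> ends; l \<in> E; meets k l\<rbrakk> \<Longrightarrow> k \<notin> E"
  using end_apart apart_iff meets_def by metis

lemma end_side_eq:
  assumes "\<tau> \<in> directions l" "k \<notin> pencil l \<tau>"
  shows "end_side (pencil l \<tau>) k = \<tau> k"
proof -
  obtain P where P: "inc P k" using A2 by blast
  have E: "pencil l \<tau> \<in> ends" using pencil_in_ends assms by blast
  obtain l' where l': "l' \<in> pencil l \<tau>" "inc P l'" using end_line_ex[OF E] by blast
  then have m: "meets k l'" using meets_point P assms by metis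
  obtain \<tau>' where \<tau>': "\<tau>' \<in> directions l'" "pencil l \<tau> = pencil l' \<tau>'" using end_dir[OF E l'(1)] .
  have eq: "\<rho> k = \<tau> k" if "\<rho> \<in> directions n" "pencil n \<rho> = pencil l \<tau>" "meets k n" for n \<rho>
    using asymptotic_of_pencil[OF that(1) assms(1) that(2)] that(3) by (auto simp: asymptotic_def)
  show ?thesis unfolding end_side_def using eq eq[OF \<tau>'(1) \<tau>'(2)[symmetric] m] \<tau>' m by blast
qed

lemma end_side_dir:
  assumes "E \<in> ends" "k \<notin> E" "l \<in> E"
  obtains \<tau> where "\<tau> \<in> directions l" "E = pencil l \<tau>" "end_side E k = \<tau> k"
  using end_dir[OF assms(1,3)] end_side_eq assms(2) by metis

lemma end_side_apart:
  "\<lbrakk>E \<in> ends; k \<notin> E; l \<in> E; apart l k; inc Q l\<rbrakk> \<Longrightarrow> end_side E k = {P. same_side k Q P}"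
  using end_side_dir dir_apart by metis

lemma end_side_from:
  assumes "E \<in> ends" "k \<notin> E" "l \<in> E" "inc Z l"
  obtains A where "A \<noteq> Z" "inc A l" "E = pencil l (tail Z A)" "end_side E k = tail Z A k"
  using end_side_dir[OF assms(1-3)] dir_from assms(4) by metis

lemma end_side_start:
  assumes "E \<in> ends" "k \<notin> E" "l \<in> E" "inc Z l" "inc Z k"
  obtains A where "A \<noteq> Z" "inc A l" "\<not> inc A k" "E = pencil l (tail Z A)"
    "end_side E k = {P. same_side k A P}"
proof -
  obtain A where A: "A \<noteq> Z" "inc A l" "E = pencil l (tail Z A)" "end_side E k = tail Z A k"
    using end_side_from[OF assms(1-4)] .
  have "\<not> inc A k" using line_unique A assms by metis
  then show ?thesis using that A tail_start assms by metis
qed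

lemma end_side_cases:
  assumes "E \<in> ends" "F \<in> ends" "G \<in> ends" "k \<notin> E" "k \<notin> F" "k \<notin> G"
  shows "end_side E k = end_side F k \<or> end_side F k = end_side G k \<or> end_side E k = end_side G k"
proof -
  obtain a where a: "a \<in> E" using end_line_ex assms by blast
  obtain b where b: "b \<in> F" using end_line_ex assms by blast
  obtain c where c: "c \<in> G" using end_line_ex assms by blast
  obtain \<alpha> where 1: "\<alpha> \<in> directions a" "end_side E k = \<alpha> k" using end_side_dir[OF assms(1,4) a] by metis
  obtain \<beta> where 2: "\<beta> \<in> directions b" "end_side F k = \<beta> k" using end_side_dir[OF assms(2,5) b] by metis
  obtain \<gamma> where 3: "\<gamma> \<in> directions c" "end_side G k = \<gamma> k" using end_side_dir[OF assms(3,6) c] by metis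
  have "k \<noteq> a" "k \<noteq> b" "k \<noteq> c" using a b c assms by blast+
  then show ?thesis using half_planes_le_2[OF 1(1) 2(1) 3(1)] 1 2 3 by simp
qed

lemma end_side_differ:
  assumes "E \<in> ends" "F \<in> ends" "E \<noteq> F" "l \<in> E" "l \<in> F" "meets k l"
  shows "end_side E k \<noteq> end_side F k"
proof -
  have k: "k \<notin> E" "k \<notin> F" using meets_not_in_end assms by blast+
  obtain \<tau> where 1: "\<tau> \<in> directions l" "E = pencil l \<tau>" "end_side E k = \<tau> k"
    using end_side_dir[OF assms(1) k(1) assms(4)] .
  obtain \<sigma> where 2: "\<sigma> \<in> directions l" "F = pencil l \<sigma>" "end_side F k = \<sigma> k"
    using end_side_dir[OF assms(2) k(2) assms(5)] .
  then show ?thesis using dirs_differ[OF 1(1) 2(1) _ assms(6)] 1 assms by auto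
qed

lemma end_side_meets:
  assumes "E \<in> ends" "F \<in> ends" "k \<notin> E" "k \<notin> F" "l \<in> E" "l \<in> F"
    "end_side E k \<noteq> end_side F k"
  shows "meets k l"
proof (rule ccontr)
  assume "\<not> meets k l"
  moreover have "k \<noteq> l" using assms by blast
  ultimately have "apart l k" unfolding apart_def meets_def by blast
  moreover obtain Q where "inc Q l" using A2 by blast
  ultimately show False
    using end_side_apart[OF assms(1,3,5)] end_side_apart[OF assms(2,4,6)] assms(7) by metis
qed

section \<open>Half-turns acting on ends\<close>

lemma turn_ex1:
  assumes "E \<in> ends"
  shows "\<exists>!F. F \<in> ends \<and> F \<noteq> E \<and> (\<exists>l. inc P l \<and> l \<in> E \<and> l \<in> F)"
proof -
  obtain l where l: "l \<in> E" "inc P l" using end_line_ex assms by blast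
  obtain F where "F \<in> ends" "F \<noteq> E" "l \<in> F" using line_ends[of l] by metis
  moreover have "G = F" if G: "G \<in> ends" "G \<noteq> E" "inc P m" "m \<in> E" "m \<in> G"
    and F: "F \<in> ends" "F \<noteq> E" "l \<in> F" for G F m
  proof -
    have "m = l" using end_line_unique assms l G by blast
    obtain E1 E2 where *: "\<And>G. G \<in> ends \<Longrightarrow> l \<in> G \<Longrightarrow> G = E1 \<or> G = E2"
      using line_ends[of l] by metis
    show ?thesis
      using *[OF assms l(1)] *[OF F(1,3)] *[OF G(1)] G F \<open>m = l\<close> by blast
  qed
  ultimately show ?thesis using l by (intro ex1I[of _ F]) blast+
qed

lemma turn_props:
  assumes "E \<in> ends"
  shows "turn P E \<in> ends" "turn P E \<noteq> E" "\<exists>l. inc P l \<and> l \<in> E \<and> l \<in> turn P E"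
  using theI'[OF turn_ex1[OF assms]] unfolding turn_def by blast+

lemma turn_eqI:
  "\<lbrakk>E \<in> ends; F \<in> ends; F \<noteq> E; inc P l; l \<in> E; l \<in> F\<rbrakk> \<Longrightarrow> turn P E = F"
  using the1_equality[OF turn_ex1] unfolding turn_def by blast

lemma turn_turn: "E \<in> ends \<Longrightarrow> turn P (turn P E) = E"
  using turn_props[of E P] turn_eqI by metis

lemma turn_in: "\<lbrakk>E \<in> ends; inc P d\<rbrakk> \<Longrightarrow> d \<in> turn P E \<longleftrightarrow> d \<in> E"
  using turn_props turn_eqI end_line_unique by metis

lemma turn_side:
  assumes "E \<in> ends" "inc P d" "d \<notin> E"
  shows "end_side (turn P E) d \<noteq> end_side E d"
proof -
  obtain l where l: "inc P l" "l \<in> E" "l \<in> turn P E" using turn_props assms by blast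
  have "meets d l" using meets_point assms l by blast
  then show ?thesis using end_side_differ[OF assms(1) turn_props(1)[OF assms(1)]] turn_props(2) assms l by metis
qed

lemma turn_turn_side_same:
  assumes "E \<in> ends" "inc P d" "inc Q d" "d \<notin> E"
  shows "end_side (turn Q (turn P E)) d = end_side E d"
proof -
  have e: "turn P E \<in> ends" "turn Q (turn P E) \<in> ends" using turn_props assms by blast+
  have d: "d \<notin> turn P E" "d \<notin> turn Q (turn P E)" using turn_in assms e by blast+
  show ?thesis
    using end_side_cases[OF assms(1) e assms(4) d] turn_side[OF assms(1,2,4)] turn_side[OF e(1) assms(3) d(1)]
    by metis
qed

lemma turn_inj:
  assumes "E \<in> ends" "d \<notin> E" "inc P d" "inc Q d" "turn P E = turn Q E"
  shows "P = Q"
proof (rule ccontr)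
  assume "P \<noteq> Q"
  obtain l where l: "inc P l" "l \<in> E" "l \<in> turn P E" using turn_props assms by blast
  obtain m where m: "inc Q m" "m \<in> E" "m \<in> turn P E" using turn_props assms by metis
  have "l = m" using end_eq[OF assms(1) turn_props(1)[OF assms(1)] l(2) m(2) l(3) m(3)] turn_props(2)[OF assms(1)] by metis
  then have "l = d" using line_unique \<open>P \<noteq> Q\<close> l m assms by blast
  then show False using l assms by blast
qed

text \<open>The two ends of a line crossing \<open>d\<close> lie on different sides of
  \<open>d\<close>.\<close>

lemma same_side_line_not_in:
  assumes "E \<in> ends" "F \<in> ends" "E \<noteq> F" "d \<notin> E" "end_side E d = end_side F d"
    and "m \<in> F" "inc R m" "inc R d" "m \<noteq> d"
  shows "m \<notin> E"
proof
  assume "m \<in> E"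
  then show False
    using end_side_differ[OF assms(1-3) _ assms(6) meets_point[OF assms(8,7)]] assms by metis
qed

text \<open>The product of the half-turns about \<open>P\<close> and \<open>Q\<close> moves every end off \<open>d\<close> in the direction from
  \<open>P\<close> to \<open>Q\<close>. This provides the intersection point needed to apply A7.\<close>

lemma turn_turn_moves:
  assumes PQ: "P \<noteq> Q" "inc P d" "inc Q d" and E: "E \<in> ends" "d \<notin> E"
    and R: "inc R d" "inc R m" and m: "m \<in> turn Q (turn P E)"
  shows "m \<notin> E" "end_side E m = tail Q P m"
proof -
  define E1 where "E1 = turn P E"
  define E2 where "E2 = turn Q E1"
  have ends: "E1 \<in> ends" "E2 \<in> ends" using turn_props E unfolding E1_def E2_def by blast+
  have dE: "d \<notin> E1" "d \<notin> E2" using turn_in PQ E ends unfolding E1_def E2_def by blast+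
  have sd: "end_side E d = end_side E2 d"
    using turn_turn_side_same[OF E(1) PQ(2,3) E(2)] unfolding E1_def E2_def by simp
  have "E1 \<noteq> E" "E2 \<noteq> E1" using turn_props E ends unfolding E1_def E2_def by blast+
  have "E \<noteq> E2"
  proof
    assume "E = E2"
    then have "turn Q E = turn P E" using turn_turn[OF ends(1), of Q] unfolding E1_def E2_def by simp
    then show False using turn_inj[OF E PQ(3,2)] PQ(1) by blast
  qed
  have mE2: "m \<in> E2" using m unfolding E1_def E2_def .
  have md: "m \<noteq> d" using mE2 dE by blast
  show mE: "m \<notin> E"
    using same_side_line_not_in[OF E(1) ends(2) \<open>E \<noteq> E2\<close> E(2) sd mE2 R(2,1) md] .
  obtain l where l: "inc P l" "l \<in> E" "l \<in> E1" using turn_props E unfolding E1_def by blast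
  obtain c where c: "inc Q c" "c \<in> E1" "c \<in> E2" using turn_props ends unfolding E2_def by blast
  have cd: "c \<noteq> d" using c dE by blast
  have Pc: "\<not> inc P c" using line_unique PQ c cd by metis
  have lc: "apart l c" using end_apart[OF ends(1) l(3) c(2)] l Pc by blast
  have cE: "c \<notin> E"
  proof
    assume "c \<in> E"
    moreover have "l \<noteq> c" using lc by auto
    ultimately show False using end_eq[OF E(1) ends(1) l(2) _ l(3) c(2)] \<open>E1 \<noteq> E\<close> by blast
  qed
  \<comment> \<open>With respect to \<open>c\<close>, the end \<open>E\<close> is on the side of
    \<open>P\<close>, because \<open>l\<close> and \<open>c\<close> share the end \<open>E1\<close>
    and are disjoint. This is the claim for \<open>m = c\<close>; since \<open>m\<close> and
    \<open>c\<close> share the end \<open>E2\<close>, it can be carried over to other positions of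
    \<open>R\<close>.\<close>
  have sc: "end_side E c = {X. same_side c P X}" using end_side_apart[OF E(1) cE l(2) lc l(1)] .
  show "end_side E m = tail Q P m"
  proof (cases "R = Q")
    case True
    then have "m = c" using end_line_unique[OF ends(2) mE2 c(3)] R c by blast
    then show ?thesis using sc tail_start[OF c(1) Pc] by simp
  next
    case False
    have Rc: "\<not> inc R c" using line_unique False R PQ c cd by metis
    have mc: "apart m c" using end_apart[OF ends(2) mE2 c(3)] R Rc by blast
    have Qm: "\<not> inc Q m" using mc c apart_point by blast
    show ?thesis
    proof (cases "same_side c P R")
      case False
      \<comment> \<open>Here \<open>Q\<close> lies between \<open>P\<close> and \<open>R\<close>. If
        the line \<open>n\<close> of \<open>E\<close> through \<open>Q\<close> meets
        \<open>m\<close> at all, it does so behind \<open>Q\<close>, so \<open>E\<close> is on the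
        side of \<open>Q\<close>.\<close>
      then have oc: "opp_side c P R" using off_cases Pc Rc by blast
      then obtain Q' where Q': "inc Q' c" "bt P Q' R" by (auto simp: opp_side_def)
      have "Q' = Q" using bt_on_line(2)[OF Q'(2) PQ(2) R(1)] Q' c PQ cd line_unique by metis
      then have "tail Q P = tail R Q"
        using tail_bt1[OF bt_sym[OF Q'(2)]] tail_bt2[OF bt_sym[OF Q'(2)]] by simp
      then have \<delta>m: "tail Q P m = {X. same_side m Q X}" using tail_start[OF R(2) Qm] by simp
      obtain n where n: "n \<in> E" "inc Q n" using end_line_ex E by blast
      have nm: "n \<noteq> m" using n mE by blast
      have "end_side E m = {X. same_side m Q X}"
      proof (cases "apart n m")
        case True
        then show ?thesis using end_side_apart E mE n by blast
      next
        case False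
        then obtain Z where Z: "inc Z n" "inc Z m" using not_apartD nm by blast
        obtain A where A: "A \<noteq> Q" "inc A n" "\<not> inc A c" "E = pencil n (tail Q A)"
          "end_side E c = {X. same_side c A X}"
          using end_side_start[OF E(1) cE n(1,2) c(1)] .
        have "same_side c P A" using A(5) sc same_set_eq[OF A(3), of P] same_sym by blast
        moreover have "same_side c R Z" using apart_same[OF mc R(2) Z(2)] .
        ultimately have "opp_side c A Z" using oc opp_same_trans opp_sym by metis
        then obtain Q'' where Q'': "inc Q'' c" "bt A Q'' Z" by (auto simp: opp_side_def)
        have "n \<noteq> c" using n cE by blast
        then have "Q'' = Q" using bt_on_line(2)[OF Q''(2) A(2) Z(1)] Q'' c n line_unique by metis
        then have \<tau>: "tail Q A = tail Z Q"
          using tail_bt1[OF bt_sym[OF Q''(2)]] tail_bt2[OF bt_sym[OF Q''(2)]] by simp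
        have "tail Q A \<in> directions n" using tail_in_dirs A n by metis
        then have "end_side E m = tail Q A m" using end_side_eq A(4) mE by metis
        then show ?thesis using \<tau> tail_start[OF Z(2) Qm] by simp
      qed
      then show ?thesis using \<delta>m by simp
    next
      case True
      have \<delta>: "tail Q P = tail Q R" using tail_same[OF c(1) PQ(3,2) R(1) True] .
      obtain U where U: "bt Q R U" using bt_extend False by metis
      have oU: "opp_side m Q U" using bt_opp[OF U R(2) Qm] .
      have \<delta>m: "tail Q P m = {X. same_side m U X}"
        using \<delta> tail_bt1[OF U] tail_bt2[OF U] tail_start[OF R(2)] oU opp_off by metis
      obtain n where n: "n \<in> E" "inc R n" using end_line_ex E by blast
      have nm: "n \<noteq> m" "n \<noteq> d" "n \<noteq> c" using n mE E cE by blast+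
      have nE2: "n \<notin> E2"
        using same_side_line_not_in[OF ends(2) E(1) _ dE(2) sd[symmetric] n(1,2) R(1) nm(2)] \<open>E \<noteq> E2\<close> by metis
      obtain A where A: "A \<noteq> R" "inc A n" "\<not> inc A m" "E = pencil n (tail R A)"
        "end_side E m = {X. same_side m A X}"
        using end_side_start[OF E(1) mE n(1,2) R(2)] .
      have Ad: "\<not> inc A d" using line_unique A n R nm by metis
      have Adir: "tail R A \<in> directions n" using tail_in_dirs A n by metis
      have \<tau>d: "end_side E d = {X. same_side d A X}"
        using end_side_eq[OF Adir] A(4) E(2) tail_start[OF R(1) Ad] by simp
      \<comment> \<open>Here \<open>R\<close> is on the ray from \<open>Q\<close> through
        \<open>P\<close>. If \<open>E\<close> were on the side of \<open>Q\<close> with respect to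
        \<open>m\<close>, the lines \<open>d\<close>, \<open>m\<close>, \<open>n\<close> through
        \<open>R\<close> would violate \<open>crossbar\<close>.\<close>
      have "same_side m A U"
      proof (rule ccontr)
        assume "\<not> same_side m A U"
        then have "opp_side m A U" using off_cases A(3) oU opp_off by blast
        then have mAQ: "same_side m Q A" using oU opp_opp_same opp_sym by blast
        obtain B where B: "B \<noteq> R" "inc B m" "\<not> inc B d" "E2 = pencil m (tail R B)"
          "end_side E2 d = {X. same_side d B X}"
          using end_side_start[OF ends(2) dE(2) mE2 R(2,1)] .
        have dBA: "same_side d B A" using \<tau>d B(5) sd same_set_eq[OF B(3), of A] by simp
        have Bn: "\<not> inc B n" using line_unique B R n nm by metis
        have Qn: "\<not> inc Q n" using line_unique False PQ R n nm by metis
        have "tail R B \<in> directions m" using tail_in_dirs B R by metis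
        then have 1: "end_side E2 n = {X. same_side n B X}"
          using end_side_eq B(4) nE2 tail_start[OF n(2) Bn] by metis
        have 2: "end_side E2 n = {X. same_side n Q X}"
        proof (cases "apart c n")
          case True
          then show ?thesis using end_side_apart[OF ends(2) nE2 c(3)] c by blast
        next
          case cn: False
          then obtain Z where Z: "inc Z c" "inc Z n" using not_apartD nm by blast
          have "Z \<noteq> R" using Z Rc by blast
          have ntail: "tail R A \<noteq> tail R Z"
          proof
            assume t: "tail R A = tail R Z"
            obtain W where W: "bt R Z W" using bt_extend \<open>Z \<noteq> R\<close> by metis
            have oW: "opp_side c R W" using bt_opp[OF W Z(1) Rc] .
            have "end_side E c = tail R A c" using end_side_eq[OF Adir] A(4) cE by simp
            also have "\<dots> = {X. same_side c W X}"
              using t tail_bt1[OF W] tail_bt2[OF W] tail_start[OF Z(1)] oW opp_off by metis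
            finally have "same_side c P W" using sc same_set_eq[OF Pc, of W] by simp
            then show False using True oW same_trans same_sym unfolding same_side_def by metis
          qed
          then have "\<not> bt R A Z" "\<not> bt R Z A" "Z \<noteq> A" using tail_bt1 by metis+
          then have ZRA: "bt Z R A"
            using bt_cases[of Z R A n] \<open>Z \<noteq> R\<close> A Z n bt_sym by metis
          obtain C where C: "C \<noteq> Q" "inc C c" "\<not> inc C d" "E2 = pencil c (tail Q C)"
            "end_side E2 d = {X. same_side d C X}"
            using end_side_start[OF ends(2) dE(2) c(3,1) PQ(3)] .
          have dCA: "same_side d C A" using \<tau>d C(5) sd same_set_eq[OF C(3), of A] by simp
          have "opp_side d A Z" using bt_opp[OF bt_sym[OF ZRA] R(1) Ad] .
          then have "opp_side d Z C" using dCA opp_same_trans opp_sym same_sym by metis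
          then obtain Q' where Q': "inc Q' d" "bt Z Q' C" by (auto simp: opp_side_def)
          have "Q' = Q" using bt_on_line(2)[OF Q'(2) Z(1) C(2)] Q' c PQ cd line_unique by metis
          then have \<sigma>: "tail Q C = tail Z Q" using tail_bt1[OF Q'(2)] tail_bt2[OF Q'(2)] by simp
          have "tail Q C \<in> directions c" using tail_in_dirs C c by metis
          then have "end_side E2 n = tail Q C n" using end_side_eq C(4) nE2 by metis
          then show ?thesis using \<sigma> tail_start[OF Z(2) Qn] by simp
        qed
        have nBQ: "same_side n Q B" using 1 2 same_set_eq[OF Qn, of B] by simp
        show False
          using crossbar[OF R(1,2) n(2) PQ(3) B(2) A(2) dBA mAQ nBQ] .
      qed
      then show ?thesis using A(5) \<delta>m same_set_eq[OF A(3), of U] by simp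
    qed
  qed
qed

section \<open>Products of three half-turns on ends\<close>

lemma line_pairs_in: "E \<in> ends \<Longrightarrow> line_pairs E \<in> rimpoints"
  using rimpoints_eq by blast

lemma line_pairs_neq: "\<lbrakk>E \<in> ends; F \<in> ends; E \<noteq> F\<rbrakk> \<Longrightarrow> line_pairs E \<noteq> line_pairs F"
  using line_pairs_inj by (auto simp: inj_on_def)

lemma turn3_involution_off:
  assumes PQR: "P \<noteq> Q" "Q \<noteq> R" "P \<noteq> R" "inc P d" "inc Q d" "inc R d"
    and E0: "E0 \<in> ends" "d \<notin> E0"
  shows "turn R (turn Q (turn P (turn R (turn Q (turn P E0))))) = E0"
proof -
  define E1 where "E1 = turn P E0"
  define E2 where "E2 = turn Q E1"
  define E3 where "E3 = turn R E2"
  define E4 where "E4 = turn P E3"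
  define E5 where "E5 = turn Q E4"
  note defs = E1_def E2_def E3_def E4_def E5_def
  have e: "E1 \<in> ends" "E2 \<in> ends" "E3 \<in> ends" "E4 \<in> ends" "E5 \<in> ends"
    using turn_props(1) E0(1) by (simp_all add: defs)
  have d: "d \<notin> E1" "d \<notin> E2" "d \<notin> E3" "d \<notin> E4" "d \<notin> E5"
    using turn_in[OF E0(1) PQR(4)] turn_in[OF e(1) PQR(5)] turn_in[OF e(2) PQR(6)]
      turn_in[OF e(3) PQR(4)] turn_in[OF e(4) PQR(5)] E0(2) by (simp_all add: defs)
  \<comment> \<open>The vertices of the hexagon alternate between the sides of \<open>d\<close>;
    this keeps \<open>E5\<close> and \<open>E0\<close>, and likewise the opposite vertices,
    distinct.\<close>
  have s2: "end_side E2 d = end_side E0 d"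
    using turn_turn_side_same[OF E0(1) PQR(4,5) E0(2)] unfolding defs by simp
  have s3: "end_side E3 d \<noteq> end_side E0 d"
    using turn_side[OF e(2) PQR(6) d(2)] s2 unfolding E3_def by simp
  have s5: "end_side E5 d = end_side E3 d"
    using turn_turn_side_same[OF e(3) PQR(4,5) d(3)] unfolding E5_def E4_def by simp
  have s1: "end_side E1 d \<noteq> end_side E0 d" using turn_side[OF E0(1) PQR(4) E0(2)] unfolding E1_def .
  have s4: "end_side E4 d \<noteq> end_side E3 d" using turn_side[OF e(3) PQR(4) d(3)] unfolding E4_def .
  have s4': "end_side E4 d = end_side E0 d"
    using end_side_cases[OF E0(1) e(3,4) E0(2) d(3,4)] s3 s4 by metis
  have ne: "E0 \<noteq> E1" "E1 \<noteq> E2" "E2 \<noteq> E3" "E3 \<noteq> E4" "E4 \<noteq> E5" "E5 \<noteq> E0"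
    using turn_props(2) E0 e s5 s3 unfolding defs by metis+
  obtain l01 where l01: "inc P l01" "l01 \<in> E0" "l01 \<in> E1" using turn_props E0 unfolding E1_def by blast
  obtain l12 where l12: "inc Q l12" "l12 \<in> E1" "l12 \<in> E2" using turn_props e unfolding E2_def by blast
  obtain l23 where l23: "inc R l23" "l23 \<in> E2" "l23 \<in> E3" using turn_props e unfolding E3_def by blast
  obtain l34 where l34: "inc P l34" "l34 \<in> E3" "l34 \<in> E4" using turn_props e unfolding E4_def by blast
  obtain l45 where l45: "inc Q l45" "l45 \<in> E4" "l45 \<in> E5" using turn_props e unfolding E5_def by blast
  obtain l50 where l50: "l50 \<in> E5" "l50 \<in> E0" using ends_join e E0 ne by metis
  have only2: "F = G \<or> G = H \<or> F = H" if "F \<in> ends" "G \<in> ends" "H \<in> ends" "l \<in> F" "l \<in> G" "l \<in> H" for F G H l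
    using line_ends[of l] that by metis
  \<comment> \<open>A7 requires opposite sides to be distinct. If these agreed, then
    \<open>E1 = E3\<close>, and \<open>Q\<close> and \<open>R\<close> would take \<open>E2\<close>
    to the same end.\<close>
  have l01': "l01 \<noteq> l34"
  proof
    assume eq: "l01 = l34"
    have "E3 \<noteq> E0" using s3 by blast
    then have "E1 = E3" using only2[OF E0(1) e(1,3), of l01] l01 l34 eq ne by auto
    then have "turn Q E2 = turn R E2" using turn_turn[OF e(1), of Q] unfolding E2_def E3_def by simp
    then show False using turn_inj[OF e(2) d(2) PQR(5,6)] PQR by blast
  qed
  have l12': "l12 \<noteq> l45"
  proof
    assume eq: "l12 = l45"
    have "E4 \<noteq> E1" using s1 s4' by auto
    then have "E2 = E4" using only2[OF e(1,2,4), of l12] l12 l45 eq ne by auto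
    then have "turn P E3 = turn R E3" using turn_turn[OF e(2), of R] unfolding E3_def E4_def by simp
    then show False using turn_inj[OF e(3) d(3) PQR(4,6)] PQR by blast
  qed
  \<comment> \<open>\<open>l23\<close> passes through \<open>E2\<close>, which arises from
    \<open>E0\<close> by \<open>PQ\<close>, and through \<open>E3\<close>, which arises from
    \<open>E5\<close> by \<open>QP\<close>. So \<open>E0\<close> and \<open>E5\<close> lie on
    opposite sides of \<open>l23\<close>, and the closing side \<open>l50\<close> crosses
    it.\<close>
  have m1: "l23 \<notin> E0" "end_side E0 l23 = tail Q P l23"
    using turn_turn_moves[OF PQR(1,4,5) E0 PQR(6) l23(1)] l23(2) unfolding E1_def E2_def by blast+
  have "turn P (turn Q E5) = E3"
    using turn_turn[OF e(4), of Q] turn_turn[OF e(3), of P] unfolding E5_def E4_def by simp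
  then have m2: "l23 \<notin> E5" "end_side E5 l23 = tail P Q l23"
    using turn_turn_moves[OF PQR(1)[symmetric] PQR(5,4) e(5) d(5) PQR(6) l23(1)] l23(3) by simp_all
  have l23d: "l23 \<noteq> d" using l23 d by blast
  have "tail Q P l23 \<noteq> tail P Q l23"
  proof (rule dirs_differ[of _ d])
    show "tail Q P \<in> directions d" "tail P Q \<in> directions d" using tail_in_dirs PQR by metis+
    show "meets l23 d" using meets_point l23 PQR l23d by blast
    obtain U where U: "bt Q P U" using bt_extend PQR by metis
    show "tail Q P \<noteq> tail P Q"
      using dirs_eq(2)[OF U PQR(4,5)] tail_bt1[OF U] tail_bt2[OF U] by metis
  qed
  then have "meets l23 l50"
    using end_side_meets[OF E0(1) e(5) m1(1) m2(1) l50(2,1)] m1 m2 by simp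
  then obtain W where W: "inc W l23" "inc W l50" "l23 \<noteq> l50" by (auto simp: meets_def)
  have "collinear {P, Q, W}"
  proof (rule A7)
    show "{line_pairs E0, line_pairs E1, line_pairs E2, line_pairs E3, line_pairs E4, line_pairs E5} \<subseteq> rimpoints"
      using line_pairs_in E0 e by blast
    show "line_pairs E0 \<noteq> line_pairs E1" "line_pairs E1 \<noteq> line_pairs E2" "line_pairs E2 \<noteq> line_pairs E3"
      "line_pairs E3 \<noteq> line_pairs E4" "line_pairs E4 \<noteq> line_pairs E5" "line_pairs E5 \<noteq> line_pairs E0"
      using line_pairs_neq E0 e ne by metis+
    show "rim_on (line_pairs E0) l01" "rim_on (line_pairs E1) l01" "rim_on (line_pairs E1) l12"
      "rim_on (line_pairs E2) l12" "rim_on (line_pairs E2) l23" "rim_on (line_pairs E3) l23"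
      "rim_on (line_pairs E3) l34" "rim_on (line_pairs E4) l34" "rim_on (line_pairs E4) l45"
      "rim_on (line_pairs E5) l45" "rim_on (line_pairs E5) l50" "rim_on (line_pairs E0) l50"
      using rim_on_iff E0 e l01 l12 l23 l34 l45 l50 by metis+
  qed (use l01' l12' l01 l12 l34 l45 W in auto)
  then obtain g where "inc P g" "inc Q g" "inc W g" by (auto simp: collinear_def points_of_def)
  then have "inc W d" using line_unique PQR by metis
  then have "W = R" using line_unique[of W R l23 d] W l23 PQR l23d by blast
  then have "turn R E5 = E0" using turn_eqI[OF e(5) E0(1) ne(6)[symmetric] _ l50] W by blast
  then show ?thesis unfolding defs .
qed

lemma turn_on_line:
  assumes "E \<in> ends" "F \<in> ends" "E \<noteq> F" "d \<in> E" "d \<in> F" "inc P d"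
  shows "turn P E = F"
  using turn_eqI assms by metis

text \<open>Coincidences among \<open>P\<close>, \<open>Q\<close>, \<open>R\<close> are settled by
  cancelling equal neighbours, and an end of \<open>d\<close> is exchanged with the other one by
  each of the six half-turns.\<close>

lemma turn3_involution:
  assumes d: "inc P d" "inc Q d" "inc R d" and E: "E \<in> ends"
  shows "turn R (turn Q (turn P (turn R (turn Q (turn P E))))) = E"
proof -
  have e: "turn X F \<in> ends" "turn X (turn X F) = F" if "F \<in> ends" for X F
    using that turn_props turn_turn by blast+
  consider "P = Q \<or> Q = R \<or> P = R" | "P \<noteq> Q" "Q \<noteq> R" "P \<noteq> R" "d \<in> E" | "P \<noteq> Q" "Q \<noteq> R" "P \<noteq> R" "d \<notin> E"
    by blast
  then show ?thesis
  proof cases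
    case 1
    then show ?thesis using e E by (elim disjE) (simp_all)
  next
    case 2
    define F where "F = turn P E"
    have F: "F \<in> ends" "F \<noteq> E" "d \<in> F"
      using turn_props(1,2)[OF E] turn_in[OF E d(1)] 2(4) unfolding F_def by auto
    have "turn X E = F" "turn X F = E" if "inc X d" for X
      using turn_on_line[OF E F(1) F(2)[symmetric] 2(4) F(3) that]
        turn_on_line[OF F(1) E F(2,3) 2(4) that] by auto
    then show ?thesis using d by simp
  next
    case 3
    then show ?thesis using turn3_involution_off d E by blast
  qed
qed

section \<open>Half-turns on rimpoints\<close>

lemma half_turn_line_pairs:
  assumes "E \<in> ends" shows "half_turn P (line_pairs E) = line_pairs (turn P E)"
proof -
  obtain l where l: "inc P l" "l \<in> E" "l \<in> turn P E" using turn_props assms by blast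
  note t = turn_props[OF assms]
  have "(THE Y. Y \<in> rimpoints \<and> Y \<noteq> line_pairs E \<and> (\<exists>l. inc P l \<and> rim_on (line_pairs E) l \<and> rim_on Y l))
    = line_pairs (turn P E)"
  proof (rule the_equality)
    show "line_pairs (turn P E) \<in> rimpoints \<and> line_pairs (turn P E) \<noteq> line_pairs E \<and>
      (\<exists>l. inc P l \<and> rim_on (line_pairs E) l \<and> rim_on (line_pairs (turn P E)) l)"
      using line_pairs_in line_pairs_neq t assms rim_on_iff l by metis
  next
    fix Y
    assume Y: "Y \<in> rimpoints \<and> Y \<noteq> line_pairs E \<and> (\<exists>l. inc P l \<and> rim_on (line_pairs E) l \<and> rim_on Y l)"
    then obtain F where F: "F \<in> ends" "Y = line_pairs F" using rimpoints_eq by blast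
    then have "F \<noteq> E" using Y by blast
    moreover obtain l where "inc P l" "l \<in> E" "l \<in> F" using Y F rim_on_iff assms by metis
    ultimately show "Y = line_pairs (turn P E)" using turn_eqI[OF assms F(1)] F by metis
  qed
  then show ?thesis using line_pairs_in assms by (simp add: half_turn_def)
qed

lemma half_turn_half_turn: "half_turn P (half_turn P X) = X"
proof (cases "X \<in> rimpoints")
  case True
  then obtain E where E: "E \<in> ends" "X = line_pairs E" using rimpoints_eq by blast
  then show ?thesis using half_turn_line_pairs turn_props(1) turn_turn by simp
qed (simp add: half_turn_def)

text \<open>\<open>PQR\<close> is its own inverse, and the inverse of a product of half-turns is the
  product in reverse order.\<close>

lemma half_turn_reverse:
  assumes d: "inc P d" "inc Q d" "inc R d"
  shows "half_turn R (half_turn Q (half_turn P X)) = half_turn P (half_turn Q (half_turn R X))"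
proof (cases "X \<in> rimpoints")
  case True
  define Y where "Y = half_turn R (half_turn Q (half_turn P X))"
  obtain E where E: "E \<in> ends" "X = line_pairs E" using True rimpoints_eq by blast
  have "half_turn R (half_turn Q (half_turn P Y)) = X"
    unfolding Y_def using E turn3_involution[OF d E(1)] half_turn_line_pairs turn_props(1) by simp
  then have "half_turn P (half_turn Q (half_turn R X)) = Y"
    using half_turn_half_turn by metis
  then show ?thesis unfolding Y_def by simp
qed (simp add: half_turn_def)

lemma half_turn_permutes: "half_turn P permutes rimpoints"
proof (rule bij_imp_permutes)
  show "\<And>x. x \<notin> rimpoints \<Longrightarrow> half_turn P x = x" by (simp add: half_turn_def)
  show "bij_betw (half_turn P) rimpoints rimpoints"
  proof (rule bij_betwI[of _ _ _ "half_turn P"])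
    show "half_turn P \<in> rimpoints \<rightarrow> rimpoints"
      using half_turn_line_pairs turn_props(1) by (auto simp: rimpoints_eq)
    then show "half_turn P \<in> rimpoints \<rightarrow> rimpoints" .
  qed (simp_all add: half_turn_half_turn)
qed

lemma half_turn_involution: "involution_on rimpoints (half_turn P)"
proof -
  obtain E where E: "E \<in> ends" using line_ends by metis
  have "half_turn P (line_pairs E) \<noteq> line_pairs E"
    using half_turn_line_pairs[OF E] line_pairs_neq turn_props E by metis
  then have "half_turn P \<noteq> id" by auto
  then show ?thesis
    using half_turn_permutes half_turn_half_turn by (auto simp: involution_on_def)
qed

lemma half_turn_product:
  assumes d: "inc P d" "inc Q d" "inc R d"
  shows "\<exists>P'. inc P' d \<and> half_turn R \<circ> half_turn Q \<circ> half_turn P = half_turn P'"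
proof -
  let ?h = half_turn
  define T where "T X = ?h R (?h Q (?h P X))" for X
  obtain t where t: "inc P t" "t \<noteq> d" using line_ex_avoiding by blast
  obtain E where E: "E \<in> ends" "t \<in> E" using line_ends by metis
  have dE: "d \<notin> E" using meets_not_in_end[OF E] meets_point[of P d t] t d by blast
  define F where "F = turn R (turn Q (turn P E))"
  have F: "F \<in> ends" using turn_props E unfolding F_def by blast
  have dF: "d \<notin> F" using turn_in turn_props(1) E dE d unfolding F_def by metis
  have TE: "T (line_pairs E) = line_pairs F"
    unfolding T_def F_def using half_turn_line_pairs turn_props(1) E by simp
  \<comment> \<open>Three half-turns about points of \<open>d\<close> change the side of
    \<open>d\<close>, so the line joining \<open>E\<close> to \<open>F\<close> crosses
    \<open>d\<close>, which yields \<open>P'\<close>.\<close>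
  have EF: "end_side F d \<noteq> end_side E d"
    using turn_side[of "turn Q (turn P E)" R d] turn_turn_side_same[OF E(1) d(1,2) dE]
      turn_in turn_props(1) E dE d unfolding F_def by metis
  obtain l where l: "l \<in> E" "l \<in> F" using ends_join[OF E(1) F] EF by metis
  have "meets d l" using end_side_meets[OF E(1) F dE dF l] EF by metis
  then obtain P' where P': "inc P' d" "inc P' l" by (auto simp: meets_def)
  have hE: "?h P' (line_pairs E) = line_pairs F"
    using half_turn_line_pairs[OF E(1)] turn_eqI[OF E(1) F _ P'(2) l] EF by metis
  have rev: "?h C (?h B (?h A X)) = ?h A (?h B (?h C X))" if "inc A d" "inc B d" "inc C d" for A B C X
    using half_turn_reverse[OF that] .
  have TT: "T (T X) = X" for X
    unfolding T_def using rev[OF d] half_turn_half_turn by simp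
  \<comment> \<open>Read from left to right, the three reversals are
    \<open>ABPQR = AQPBR = PQABR = PQRBA\<close>.\<close>
  have comm: "T (?h B (?h A X)) = ?h A (?h B (T X))" if "inc A d" "inc B d" for A B X
  proof -
    have "T (?h B (?h A X)) = ?h R (?h B (?h P (?h Q (?h A X))))"
      unfolding T_def using rev[of B P Q] that d by simp
    also have "\<dots> = ?h R (?h B (?h A (?h Q (?h P X))))" using rev[of A Q P] that d by simp
    also have "\<dots> = ?h A (?h B (T X))" unfolding T_def using rev[of A B R] that d by simp
    finally show ?thesis .
  qed
  have agree: "T (line_pairs H) = ?h P' (line_pairs H)"
    if G: "G \<in> ends" "d \<notin> G" "T (line_pairs G) = ?h P' (line_pairs G)"
      and H: "H \<in> ends" "d \<notin> H" "end_side H d = end_side G d" for G H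
  proof -
    define K where "K = turn P G"
    have K: "K \<in> ends" "d \<notin> K" "end_side K d \<noteq> end_side G d"
      using turn_props(1) turn_in turn_side G d unfolding K_def by blast+
    obtain m where m: "m \<in> K" "m \<in> H" using ends_join[OF K(1) H(1)] K H by metis
    have "meets d m" using end_side_meets[OF K(1) H(1) K(2) H(2) m] K H by metis
    then obtain B where B: "inc B d" "inc B m" by (auto simp: meets_def)
    have "turn B K = H" using turn_eqI[OF K(1) H(1) _ B(2) m] K H by metis
    then have h: "line_pairs H = ?h B (?h P (line_pairs G))"
      using half_turn_line_pairs K G unfolding K_def by simp
    \<comment> \<open>Both \<open>T\<close> and \<open>P'\<close> reverse the even product
      \<open>PB\<close> when they pass it, so agreement at \<open>G\<close> is carried to
      \<open>H\<close>.\<close>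
    have "T (line_pairs H) = ?h P (?h B (?h P' (line_pairs G)))" using h comm d B G by simp
    also have "\<dots> = ?h P' (?h B (?h P (line_pairs G)))" using rev P' d B by simp
    finally show ?thesis using h by simp
  qed
  have "T X = ?h P' X" for X
  proof (cases "X \<in> rimpoints")
    case True
    then obtain H where H: "H \<in> ends" "X = line_pairs H" using rimpoints_eq by blast
    show ?thesis
    proof (cases "d \<in> H")
      case dH: True
      have on: "turn A G = turn P' G" if G: "G \<in> ends" "d \<in> G" and A: "inc A d" for A G
        using turn_on_line[OF G(1) turn_props(1)[OF G(1)] turn_props(2)[OF G(1), symmetric] G(2)]
          turn_in[OF G(1) P'(1)] G(2) A by blast
      have "turn R (turn Q (turn P H)) = turn P' H"
        using on d H dH turn_in[OF _ P'(1)] turn_props(1) turn_turn by metis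
      then show ?thesis unfolding T_def using H half_turn_line_pairs turn_props(1) by simp
    next
      case False
      consider "end_side H d = end_side E d" | "end_side H d = end_side F d"
        using end_side_cases[OF H(1) E(1) F False dE dF] EF by metis
      then show ?thesis
      proof cases
        case 1
        then show ?thesis using agree[OF E(1) dE _ H(1) False] TE hE H by simp
      next
        case 2
        \<comment> \<open>On the side of \<open>F\<close> the start is provided by \<open>F\<close>
          itself: \<open>T\<close> and \<open>P'\<close> are self-inverse and both take
          \<open>E\<close> to \<open>F\<close>.\<close>
        have "T (line_pairs F) = line_pairs E" using TT TE by metis
        moreover have "?h P' (line_pairs F) = line_pairs E" using half_turn_half_turn hE by metis
        ultimately show ?thesis using agree[OF F dF _ H(1) False 2] H by simp
      qed
    qed
  next
    case False
    then show ?thesis by (simp add: T_def half_turn_def)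
  qed
  then have "?h R \<circ> ?h Q \<circ> ?h P = ?h P'" by (auto simp: T_def)
  then show ?thesis using P' by blast
qed

end

theorem theorem3p7:
  fixes inc :: "'p \<Rightarrow> 'l \<Rightarrow> bool" and P Q R :: 'p and d :: 'l
  assumes "hyperbolic_incidence_plane inc"
    and "inc P d" and "inc Q d" and "inc R d"
  shows "involution_on (incidence_structure.rimpoints inc)
           (incidence_structure.half_turn inc R \<circ> incidence_structure.half_turn inc Q
              \<circ> incidence_structure.half_turn inc P) \<and>
         (\<exists>P'. inc P' d \<and>
           incidence_structure.half_turn inc R \<circ> incidence_structure.half_turn inc Q
              \<circ> incidence_structure.half_turn inc P = incidence_structure.half_turn inc P')"
proof -
  interpret hyperbolic_incidence_plane inc by fact
  obtain P' where "inc P' d" "half_turn R \<circ> half_turn Q \<circ> half_turn P = half_turn P'"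
    using half_turn_product[OF assms(2-4)] by blast
  then show ?thesis using half_turn_involution[of P'] by auto
qed

end
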